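(* The representable functors in $[\mathcal{UF},\mathbf{Set}]$ are closed under the monoidal structure $(I,\otimes)$ obtained by transporting the composition monoidal structure on $\mathsf{FC}(\mathbf{Set},\mathbf{Set})$ across the equivalence $[\mathcal{UF},\mathbf{Set}]\simeq\mathsf{FC}(\mathbf{Set},\mathbf{Set})$, and the induced monoidal structure on $\mathcal{UF}$ is that given by tensor product of ultrafilters.
   Context: An ultrafilter on a set $X$ is a collection $\mathcal U$ of subsets of $X$ with $X\in\mathcal U$; $U\cap V\in\mathcal U$ iff ($U\in\mathcal U$ and $V\in\mathcal U$); and $U\in\mathcal U$ iff $X\setminus U\notin\mathcal U$. $\beta X$ is the set of ultrafilters on $X$; for $f\colon X\to Y$ and $\mathcal U\in\beta X$, $f_!(\mathcal U)=\{V\subseteq Y:f^{-1}(V)\in\mathcal U\}$. The category $\mathcal{UF}$ has as objects pairs $(X,\mathcal U)$ with $X$ a set and $\mathcal U\in\beta X$. A partial function $f\colon X\rightharpoonup Y$ defined on a set in $\mathcal U$ is continuous $(X,\mathcal U)\rightharpoonup(Y,\mathcal V)$ if for all $V\subseteq Y$: $V\in\mathcal V$ iff $f^{-1}(V)\in\mathcal U$. Two such partial functions are $=_{\mathcal U}$-equivalent if $\{x : f(x)\text{ and }g(x)\text{ are both defined and equal}\}\in\mathcal U$. Morphisms $(X,\mathcal U)\to(Y,\mathcal V)$ are $=_{\mathcal U}$-equivalence classes $[f]$ of partial continuous functions defined on a set in $\mathcal U$. The tensor product of $\mathcal U\in\beta X$ and $\mathcal V\in\beta Y$ is the ultrafilter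 $\mathcal U\otimes\mathcal V=\{A\subseteq X\times Y:\{x\in X:\{y\in Y:(x,y)\in A\}\in\mathcal V\}\in\mathcal U\}$ on $X\times Y$. It gives a monoidal structure on $\mathcal{UF}$ with $(X,\mathcal U)\otimes(Y,\mathcal V)=(X\times Y,\mathcal U\otimes\mathcal V)$, $[f]\otimes[g]=[f\times g]$, unit the unique ultrafilter on the one-element set, and coherence inherited from the cartesian product of sets. $\mathsf{FC}(\mathbf{Set},\mathbf{Set})$ is the category of finite-coproduct-preserving endofunctors of $\mathbf{Set}$, with monoidal structure given by composition and the identity functor. The equivalence sends $B\in[\mathcal{UF},\mathbf{Set}]$ to $\int B$ with $(\int B)Y=\sum_{\mathcal V\in\beta Y}B(Y,\mathcal V)$ and $(\int B)f\colon(\mathcal V,a)\mapsto(f_!(\mathcal V),B([f])(a))$; the transported tensor satisfies $\int(A\otimes B)\cong\int A\circ\int B$. The representables are identified with $\mathcal{UF}^{\mathrm{op}}$ through the Yoneda embedding, and the "induced monoidal structure on $\mathcal{UF}$" is the one obtained via this identification. *)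

theory Defs
  imports "HOL-Library.FuncSet" "HOL-Library.Nat_Bijection"
begin

section \<open>Sets\<close>

text \<open>
  HOL has no type of all sets, so the category of sets is taken relative to an arbitrary type
  \<open>'v\<close> whose elements are the sets of a universe: extensional, closed under subsets, pairs, power
  sets, and unions of families indexed by a member (with \<^emph>\<open>all\<close> HOL functions allowed as families, so
  this is second-order replacement). Any model of second-order ZF is such a universe.
  Neither infinity nor well-foundedness is imposed, as no construction here needs them.
\<close>

class set_universe =
  fixes elts :: "'a \<Rightarrow> 'a set"
  assumes elts_inject: "elts x = elts y \<Longrightarrow> x = y"
    and ex_subset: "A \<subseteq> elts x \<Longrightarrow> \<exists>z. elts z = A"
    and ex_pair: "\<exists>z. elts z = {x, y}"
    and ex_power: "\<exists>z. elts z = {y. elts y \<subseteq> elts x}"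
    and ex_Union: "\<exists>z. elts z = (\<Union>y\<in>elts x. elts (f y))"

text \<open>The hereditarily finite sets, in Ackermann's coding, show that the axioms are consistent.\<close>

instantiation nat :: set_universe
begin

definition elts_nat :: "nat \<Rightarrow> nat set" where
  "elts_nat = set_decode"

instance
proof
  have ex: "\<exists>z. elts z = A" if "finite A" for A :: "nat set"
    using set_encode_inverse[OF that] unfolding elts_nat_def by blast
  have fin: "finite (elts x)" for x :: nat
    by (simp add: elts_nat_def)
  fix x y :: nat and A :: "nat set" and f :: "nat \<Rightarrow> nat"
  show "elts x = elts y \<Longrightarrow> x = y"
    unfolding elts_nat_def by (metis set_decode_inverse)
  show "A \<subseteq> elts x \<Longrightarrow> \<exists>z. elts z = A"
    by (meson ex fin finite_subset)
  show "\<exists>z. elts z = {x, y}"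
    by (intro ex) simp
  have "inj (elts :: nat \<Rightarrow> nat set)"
    unfolding elts_nat_def by (metis injI set_decode_inverse)
  moreover have "elts ` {y :: nat. elts y \<subseteq> elts x} \<subseteq> Pow (elts x)"
    by blast
  ultimately show "\<exists>z. elts z = {y. elts y \<subseteq> elts x}"
    by (metis ex fin finite_Pow_iff finite_imageD finite_subset inj_on_subset top_greatest)
  show "\<exists>z. elts z = (\<Union>y\<in>elts x. elts (f y))"
    by (intro ex) (simp add: fin)
qed

end

text \<open>\<open>vset A\<close> is the set of the universe with elements \<open>A\<close>; meaningful only if \<open>A\<close> is small.\<close>

definition vset :: "'v::set_universe set \<Rightarrow> 'v" where
  "vset A = (THE z. elts z = A)"

definition vpair :: "'v::set_universe \<Rightarrow> 'v \<Rightarrow> 'v" where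
  "vpair x y = vset {vset {x}, vset {x, y}}"

definition vfst :: "'v::set_universe \<Rightarrow> 'v" where
  "vfst p = (THE x. \<exists>y. p = vpair x y)"

definition vsnd :: "'v::set_universe \<Rightarrow> 'v" where
  "vsnd p = (THE y. \<exists>x. p = vpair x y)"

definition vtimes :: "'v::set_universe \<Rightarrow> 'v \<Rightarrow> 'v" where
  "vtimes X Y = vset {vpair x y | x y. x \<in> elts X \<and> y \<in> elts Y}"


section \<open>Categories, functors and natural transformations\<close>

record ('o, 'a) cat =
  Ob :: "'o set"
  Ar :: "'a set"
  Dm :: "'a \<Rightarrow> 'o"
  Cd :: "'a \<Rightarrow> 'o"
  One :: "'o \<Rightarrow> 'a"
  Cmp :: "'a \<Rightarrow> 'a \<Rightarrow> 'a"  (infixr \<open>\<cdot>\<index>\<close> 70)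

definition Hom :: "('o, 'a) cat \<Rightarrow> 'o \<Rightarrow> 'o \<Rightarrow> 'a set" where
  "Hom C A B = {f \<in> Ar C. Dm C f = A \<and> Cd C f = B}"

locale category =
  fixes C :: "('o, 'a) cat" (structure)
  assumes dm_cd: "f \<in> Ar C \<Longrightarrow> Dm C f \<in> Ob C \<and> Cd C f \<in> Ob C"
    and one_hom: "A \<in> Ob C \<Longrightarrow> One C A \<in> Hom C A A"
    and cmp_hom: "f \<in> Hom C A B \<Longrightarrow> g \<in> Hom C B D \<Longrightarrow> g \<cdot> f \<in> Hom C A D"
    and cmp_one: "f \<in> Hom C A B \<Longrightarrow> f \<cdot> One C A = f"
    and one_cmp: "f \<in> Hom C A B \<Longrightarrow> One C B \<cdot> f = f"
    and cmp_assoc: "f \<in> Hom C A B \<Longrightarrow> g \<in> Hom C B D \<Longrightarrow> h \<in> Hom C D E \<Longrightarrow>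
      (h \<cdot> g) \<cdot> f = h \<cdot> (g \<cdot> f)"

definition inverse_pair :: "('o, 'a) cat \<Rightarrow> 'a \<Rightarrow> 'a \<Rightarrow> bool" where
  "inverse_pair C f g \<longleftrightarrow> f \<in> Ar C \<and> g \<in> Hom C (Cd C f) (Dm C f) \<and>
     g \<cdot>\<^bsub>C\<^esub> f = One C (Dm C f) \<and> f \<cdot>\<^bsub>C\<^esub> g = One C (Cd C f)"

definition iso :: "('o, 'a) cat \<Rightarrow> 'a \<Rightarrow> bool" where
  "iso C f \<longleftrightarrow> (\<exists>g. inverse_pair C f g)"

definition inv_ar :: "('o, 'a) cat \<Rightarrow> 'a \<Rightarrow> 'a" where
  "inv_ar C f = (THE g. inverse_pair C f g)"

definition isomorphic :: "('o, 'a) cat \<Rightarrow> 'o \<Rightarrow> 'o \<Rightarrow> bool" where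
  "isomorphic C A B \<longleftrightarrow> (\<exists>f \<in> Hom C A B. iso C f)"

definition op_cat :: "('o, 'a) cat \<Rightarrow> ('o, 'a) cat" where
  "op_cat C = C\<lparr>Dm := Cd C, Cd := Dm C, Cmp := (\<lambda>g f. f \<cdot>\<^bsub>C\<^esub> g)\<rparr>"

definition full_subcat :: "('o, 'a) cat \<Rightarrow> ('o \<Rightarrow> bool) \<Rightarrow> ('o, 'a) cat" where
  "full_subcat C P = C\<lparr>Ob := {A \<in> Ob C. P A}, Ar := {f \<in> Ar C. P (Dm C f) \<and> P (Cd C f)}\<rparr>"

record ('o, 'a, 'p, 'b) fctr =
  FOb :: "'o \<Rightarrow> 'p"
  FAr :: "'a \<Rightarrow> 'b"

text \<open>Functors are extensional, so that equality of the records is equality of functors.\<close>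

definition is_fctr :: "('o, 'a) cat \<Rightarrow> ('p, 'b) cat \<Rightarrow> ('o, 'a, 'p, 'b) fctr \<Rightarrow> bool" where
  "is_fctr C D F \<longleftrightarrow>
     FOb F \<in> Ob C \<rightarrow>\<^sub>E Ob D \<and> FAr F \<in> Ar C \<rightarrow>\<^sub>E Ar D \<and>
     (\<forall>f \<in> Ar C. FAr F f \<in> Hom D (FOb F (Dm C f)) (FOb F (Cd C f))) \<and>
     (\<forall>A \<in> Ob C. FAr F (One C A) = One D (FOb F A)) \<and>
     (\<forall>f \<in> Ar C. \<forall>g \<in> Ar C. Dm C g = Cd C f \<longrightarrow> FAr F (g \<cdot>\<^bsub>C\<^esub> f) = FAr F g \<cdot>\<^bsub>D\<^esub> FAr F f)"

definition id_fctr :: "('o, 'a) cat \<Rightarrow> ('o, 'a, 'o, 'a) fctr" where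
  "id_fctr C = \<lparr>FOb = (\<lambda>A\<in>Ob C. A), FAr = (\<lambda>f\<in>Ar C. f)\<rparr>"

definition comp_fctr ::
  "('o, 'a) cat \<Rightarrow> ('p, 'b, 'q, 'c) fctr \<Rightarrow> ('o, 'a, 'p, 'b) fctr \<Rightarrow> ('o, 'a, 'q, 'c) fctr" where
  "comp_fctr C G F =
     \<lparr>FOb = (\<lambda>A\<in>Ob C. FOb G (FOb F A)), FAr = (\<lambda>f\<in>Ar C. FAr G (FAr F f))\<rparr>"

record ('o, 'a, 'p, 'b) ntrans =
  NDm :: "('o, 'a, 'p, 'b) fctr"
  NCd :: "('o, 'a, 'p, 'b) fctr"
  NAt :: "'o \<Rightarrow> 'b"

definition is_ntrans :: "('o, 'a) cat \<Rightarrow> ('p, 'b) cat \<Rightarrow> ('o, 'a, 'p, 'b) ntrans \<Rightarrow> bool" where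
  "is_ntrans C D t \<longleftrightarrow>
     is_fctr C D (NDm t) \<and> is_fctr C D (NCd t) \<and> NAt t \<in> extensional (Ob C) \<and>
     (\<forall>A \<in> Ob C. NAt t A \<in> Hom D (FOb (NDm t) A) (FOb (NCd t) A)) \<and>
     (\<forall>f \<in> Ar C. NAt t (Cd C f) \<cdot>\<^bsub>D\<^esub> FAr (NDm t) f = FAr (NCd t) f \<cdot>\<^bsub>D\<^esub> NAt t (Dm C f))"

definition fctr_cat :: "('o, 'a) cat \<Rightarrow> ('p, 'b) cat \<Rightarrow>
    (('o, 'a, 'p, 'b) fctr, ('o, 'a, 'p, 'b) ntrans) cat" where
  "fctr_cat C D =
     \<lparr>Ob = {F. is_fctr C D F},
      Ar = {t. is_ntrans C D t},
      Dm = NDm,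
      Cd = NCd,
      One = (\<lambda>F. \<lparr>NDm = F, NCd = F, NAt = (\<lambda>A\<in>Ob C. One D (FOb F A))\<rparr>),
      Cmp = (\<lambda>t s. \<lparr>NDm = NDm s, NCd = NCd t, NAt = (\<lambda>A\<in>Ob C. NAt t A \<cdot>\<^bsub>D\<^esub> NAt s A)\<rparr>)\<rparr>"

definition is_coproduct ::
  "('o, 'a) cat \<Rightarrow> 'i set \<Rightarrow> ('i \<Rightarrow> 'o) \<Rightarrow> 'o \<Rightarrow> ('i \<Rightarrow> 'a) \<Rightarrow> bool" where
  "is_coproduct C I X P inc \<longleftrightarrow>
     P \<in> Ob C \<and> (\<forall>i\<in>I. X i \<in> Ob C \<and> inc i \<in> Hom C (X i) P) \<and>
     (\<forall>Q \<in> Ob C. \<forall>f. (\<forall>i\<in>I. f i \<in> Hom C (X i) Q) \<longrightarrow>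
        (\<exists>!u. u \<in> Hom C P Q \<and> (\<forall>i\<in>I. u \<cdot>\<^bsub>C\<^esub> inc i = f i)))"

definition preserves_finite_coproducts ::
  "('o, 'a) cat \<Rightarrow> ('p, 'b) cat \<Rightarrow> ('o, 'a, 'p, 'b) fctr \<Rightarrow> bool" where
  "preserves_finite_coproducts C D F \<longleftrightarrow>
     (\<forall>(n::nat) X P inc. is_coproduct C {..<n} X P inc \<longrightarrow>
        is_coproduct D {..<n} (\<lambda>i. FOb F (X i)) (FOb F P) (\<lambda>i. FAr F (inc i)))"


section \<open>Monoidal categories\<close>

record ('o, 'a) monoidal =
  TOb :: "'o \<Rightarrow> 'o \<Rightarrow> 'o"
  TAr :: "'a \<Rightarrow> 'a \<Rightarrow> 'a"
  Unit :: "'o"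
  Asc :: "'o \<Rightarrow> 'o \<Rightarrow> 'o \<Rightarrow> 'a"
  Lun :: "'o \<Rightarrow> 'a"
  Run :: "'o \<Rightarrow> 'a"

locale monoidal_category = category C
  for C :: "('o, 'a) cat" (structure) +
  fixes M :: "('o, 'a) monoidal"
  assumes tob: "A \<in> Ob C \<Longrightarrow> B \<in> Ob C \<Longrightarrow> TOb M A B \<in> Ob C"
    and tar: "f \<in> Hom C A A' \<Longrightarrow> g \<in> Hom C B B' \<Longrightarrow>
      TAr M f g \<in> Hom C (TOb M A B) (TOb M A' B')"
    and tar_one: "A \<in> Ob C \<Longrightarrow> B \<in> Ob C \<Longrightarrow>
      TAr M (One C A) (One C B) = One C (TOb M A B)"
    and tar_cmp: "f \<in> Hom C A A' \<Longrightarrow> f' \<in> Hom C A' A'' \<Longrightarrow>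
      g \<in> Hom C B B' \<Longrightarrow> g' \<in> Hom C B' B'' \<Longrightarrow>
      TAr M (f' \<cdot> f) (g' \<cdot> g) = TAr M f' g' \<cdot> TAr M f g"
    and unit_ob: "Unit M \<in> Ob C"
    and asc_hom: "A \<in> Ob C \<Longrightarrow> B \<in> Ob C \<Longrightarrow> D \<in> Ob C \<Longrightarrow>
      Asc M A B D \<in> Hom C (TOb M (TOb M A B) D) (TOb M A (TOb M B D))"
    and asc_iso: "A \<in> Ob C \<Longrightarrow> B \<in> Ob C \<Longrightarrow> D \<in> Ob C \<Longrightarrow> iso C (Asc M A B D)"
    and asc_natural: "f \<in> Hom C A A' \<Longrightarrow> g \<in> Hom C B B' \<Longrightarrow> h \<in> Hom C D D' \<Longrightarrow>
      Asc M A' B' D' \<cdot> TAr M (TAr M f g) h = TAr M f (TAr M g h) \<cdot> Asc M A B D"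
    and lun_hom: "A \<in> Ob C \<Longrightarrow> Lun M A \<in> Hom C (TOb M (Unit M) A) A"
    and lun_iso: "A \<in> Ob C \<Longrightarrow> iso C (Lun M A)"
    and lun_natural: "f \<in> Hom C A A' \<Longrightarrow>
      Lun M A' \<cdot> TAr M (One C (Unit M)) f = f \<cdot> Lun M A"
    and run_hom: "A \<in> Ob C \<Longrightarrow> Run M A \<in> Hom C (TOb M A (Unit M)) A"
    and run_iso: "A \<in> Ob C \<Longrightarrow> iso C (Run M A)"
    and run_natural: "f \<in> Hom C A A' \<Longrightarrow>
      Run M A' \<cdot> TAr M f (One C (Unit M)) = f \<cdot> Run M A"
    and pentagon: "A \<in> Ob C \<Longrightarrow> B \<in> Ob C \<Longrightarrow> D \<in> Ob C \<Longrightarrow> E \<in> Ob C \<Longrightarrow>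
      TAr M (One C A) (Asc M B D E) \<cdot> Asc M A (TOb M B D) E \<cdot> TAr M (Asc M A B D) (One C E) =
      Asc M A B (TOb M D E) \<cdot> Asc M (TOb M A B) D E"
    and triangle: "A \<in> Ob C \<Longrightarrow> B \<in> Ob C \<Longrightarrow>
      TAr M (One C A) (Lun M B) \<cdot> Asc M A (Unit M) B = TAr M (Run M A) (One C B)"

definition op_monoidal :: "('o, 'a) cat \<Rightarrow> ('o, 'a) monoidal \<Rightarrow> ('o, 'a) monoidal" where
  "op_monoidal C M =
     M\<lparr>Asc := (\<lambda>A B D. inv_ar C (Asc M A B D)),
       Lun := (\<lambda>A. inv_ar C (Lun M A)),
       Run := (\<lambda>A. inv_ar C (Run M A))\<rparr>"

definition monoidal_constraints ::
  "('o, 'a) cat \<Rightarrow> ('o, 'a) monoidal \<Rightarrow> ('p, 'b) cat \<Rightarrow> ('p, 'b) monoidal \<Rightarrow>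
    ('o, 'a, 'p, 'b) fctr \<Rightarrow> 'b \<Rightarrow> ('o \<Rightarrow> 'o \<Rightarrow> 'b) \<Rightarrow> bool" where
  "monoidal_constraints C M D N F e m \<longleftrightarrow>
     e \<in> Hom D (Unit N) (FOb F (Unit M)) \<and> iso D e \<and>
     (\<forall>A \<in> Ob C. \<forall>B \<in> Ob C.
        m A B \<in> Hom D (TOb N (FOb F A) (FOb F B)) (FOb F (TOb M A B)) \<and> iso D (m A B)) \<and>
     (\<forall>f \<in> Ar C. \<forall>g \<in> Ar C.
        m (Cd C f) (Cd C g) \<cdot>\<^bsub>D\<^esub> TAr N (FAr F f) (FAr F g) =
        FAr F (TAr M f g) \<cdot>\<^bsub>D\<^esub> m (Dm C f) (Dm C g)) \<and>
     (\<forall>A \<in> Ob C. \<forall>B \<in> Ob C. \<forall>E \<in> Ob C.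
        FAr F (Asc M A B E) \<cdot>\<^bsub>D\<^esub> m (TOb M A B) E \<cdot>\<^bsub>D\<^esub> TAr N (m A B) (One D (FOb F E)) =
        m A (TOb M B E) \<cdot>\<^bsub>D\<^esub> TAr N (One D (FOb F A)) (m B E) \<cdot>\<^bsub>D\<^esub>
          Asc N (FOb F A) (FOb F B) (FOb F E)) \<and>
     (\<forall>A \<in> Ob C.
        FAr F (Lun M A) \<cdot>\<^bsub>D\<^esub> m (Unit M) A \<cdot>\<^bsub>D\<^esub> TAr N e (One D (FOb F A)) = Lun N (FOb F A)) \<and>
     (\<forall>A \<in> Ob C.
        FAr F (Run M A) \<cdot>\<^bsub>D\<^esub> m A (Unit M) \<cdot>\<^bsub>D\<^esub> TAr N (One D (FOb F A)) e = Run N (FOb F A))"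

definition strong_monoidal ::
  "('o, 'a) cat \<Rightarrow> ('o, 'a) monoidal \<Rightarrow> ('p, 'b) cat \<Rightarrow> ('p, 'b) monoidal \<Rightarrow>
    ('o, 'a, 'p, 'b) fctr \<Rightarrow> bool" where
  "strong_monoidal C M D N F \<longleftrightarrow>
     monoidal_category C M \<and> monoidal_category D N \<and> is_fctr C D F \<and>
     (\<exists>e m. monoidal_constraints C M D N F e m)"

text \<open>Endofunctors of \<open>C\<close> under composition; strict, and the tensor of transformations is
  horizontal composition.\<close>

definition composition_monoidal :: "('o, 'a) cat \<Rightarrow>
    (('o, 'a, 'o, 'a) fctr, ('o, 'a, 'o, 'a) ntrans) monoidal" where
  "composition_monoidal C =
     \<lparr>TOb = comp_fctr C,
      TAr = (\<lambda>s t. \<lparr>NDm = comp_fctr C (NDm s) (NDm t),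
                    NCd = comp_fctr C (NCd s) (NCd t),
                    NAt = (\<lambda>A\<in>Ob C. NAt s (FOb (NCd t) A) \<cdot>\<^bsub>C\<^esub> FAr (NDm s) (NAt t A))\<rparr>),
      Unit = id_fctr C,
      Asc = (\<lambda>F G H. One (fctr_cat C C) (comp_fctr C F (comp_fctr C G H))),
      Lun = One (fctr_cat C C),
      Run = One (fctr_cat C C)\<rparr>"


section \<open>The categories of sets and of finite-coproduct-preserving endofunctors\<close>

record 'v set_ar =
  SDm :: 'v
  SCd :: 'v
  SFn :: "'v \<Rightarrow> 'v"

definition SET :: "('v::set_universe, 'v set_ar) cat" where
  "SET =
     \<lparr>Ob = UNIV,
      Ar = {f. SFn f \<in> elts (SDm f) \<rightarrow>\<^sub>E elts (SCd f)},
      Dm = SDm,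
      Cd = SCd,
      One = (\<lambda>X. \<lparr>SDm = X, SCd = X, SFn = (\<lambda>x\<in>elts X. x)\<rparr>),
      Cmp = (\<lambda>g f. \<lparr>SDm = SDm f, SCd = SCd g, SFn = compose (elts (SDm f)) (SFn g) (SFn f)\<rparr>)\<rparr>"

type_synonym 'v endo = "('v, 'v set_ar, 'v, 'v set_ar) fctr"
type_synonym 'v endo_trans = "('v, 'v set_ar, 'v, 'v set_ar) ntrans"

definition FC :: "('v::set_universe endo, 'v endo_trans) cat" where
  "FC = full_subcat (fctr_cat SET SET) (preserves_finite_coproducts SET SET)"


section \<open>The category of ultrafilters\<close>

definition ultrafilter_on :: "'a set \<Rightarrow> 'a set set \<Rightarrow> bool" where
  "ultrafilter_on X U \<longleftrightarrow>
     U \<subseteq> Pow X \<and> X \<in> U \<and>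
     (\<forall>A B. A \<subseteq> X \<longrightarrow> B \<subseteq> X \<longrightarrow> (A \<inter> B \<in> U \<longleftrightarrow> A \<in> U \<and> B \<in> U)) \<and>
     (\<forall>A. A \<subseteq> X \<longrightarrow> (A \<in> U \<longleftrightarrow> X - A \<notin> U))"

definition pushforward :: "'a set \<Rightarrow> 'b set \<Rightarrow> ('a \<Rightarrow> 'b) \<Rightarrow> 'a set set \<Rightarrow> 'b set set" where
  "pushforward X Y f U = {B. B \<subseteq> Y \<and> {x \<in> X. f x \<in> B} \<in> U}"

type_synonym 'v uf_ob = "'v \<times> 'v set set"

definition continuous_partial ::
  "'v::set_universe uf_ob \<Rightarrow> 'v uf_ob \<Rightarrow> ('v \<rightharpoonup> 'v) \<Rightarrow> bool" where
  "continuous_partial P Q f \<longleftrightarrow>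
     dom f \<in> snd P \<and> ran f \<subseteq> elts (fst Q) \<and>
     (\<forall>B. B \<subseteq> elts (fst Q) \<longrightarrow> (B \<in> snd Q \<longleftrightarrow> {x. \<exists>y\<in>B. f x = Some y} \<in> snd P))"

definition eq_mod :: "'v set set \<Rightarrow> ('v \<rightharpoonup> 'v) \<Rightarrow> ('v \<rightharpoonup> 'v) \<Rightarrow> bool" where
  "eq_mod U f g \<longleftrightarrow> {x. x \<in> dom f \<and> x \<in> dom g \<and> f x = g x} \<in> U"

record 'v uf_ar =
  UDm :: "'v uf_ob"
  UCd :: "'v uf_ob"
  UCl :: "('v \<rightharpoonup> 'v) set"

definition uf_mor :: "'v::set_universe uf_ob \<Rightarrow> 'v uf_ob \<Rightarrow> ('v \<rightharpoonup> 'v) \<Rightarrow> 'v uf_ar" where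
  "uf_mor P Q f =
     \<lparr>UDm = P, UCd = Q, UCl = {g. continuous_partial P Q g \<and> eq_mod (snd P) f g}\<rparr>"

definition uf_rep :: "'v uf_ar \<Rightarrow> ('v \<rightharpoonup> 'v)" where
  "uf_rep h = (SOME f. f \<in> UCl h)"

definition total_map :: "'v::set_universe \<Rightarrow> ('v \<Rightarrow> 'v) \<Rightarrow> ('v \<rightharpoonup> 'v)" where
  "total_map X f = (\<lambda>x. if x \<in> elts X then Some (f x) else None)"

definition UF :: "('v::set_universe uf_ob, 'v uf_ar) cat" where
  "UF =
     \<lparr>Ob = {P. ultrafilter_on (elts (fst P)) (snd P)},
      Ar = {uf_mor P Q f | P Q f.
              ultrafilter_on (elts (fst P)) (snd P) \<and> ultrafilter_on (elts (fst Q)) (snd Q) \<and>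
              continuous_partial P Q f},
      Dm = UDm,
      Cd = UCd,
      One = (\<lambda>P. uf_mor P P (total_map (fst P) (\<lambda>x. x))),
      Cmp = (\<lambda>h k. uf_mor (UDm k) (UCd h) (uf_rep h \<circ>\<^sub>m uf_rep k))\<rparr>"

definition uf_tensor :: "'v::set_universe uf_ob \<Rightarrow> 'v uf_ob \<Rightarrow> 'v uf_ob" where
  "uf_tensor P Q =
     (vtimes (fst P) (fst Q),
      {A. A \<subseteq> elts (vtimes (fst P) (fst Q)) \<and>
          {x \<in> elts (fst P). {y \<in> elts (fst Q). vpair x y \<in> A} \<in> snd Q} \<in> snd P})"

definition uf_unit :: "'v::set_universe uf_ob" where
  "uf_unit = (vset {vset {}}, {{vset {}}})"

definition prod_map :: "('v::set_universe \<rightharpoonup> 'v) \<Rightarrow> ('v \<rightharpoonup> 'v) \<Rightarrow> ('v \<rightharpoonup> 'v)" where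
  "prod_map f g = (\<lambda>p. if \<exists>x\<in>dom f. \<exists>y\<in>dom g. p = vpair x y
     then Some (vpair (the (f (vfst p))) (the (g (vsnd p)))) else None)"

definition UF_monoidal :: "('v::set_universe uf_ob, 'v uf_ar) monoidal" where
  "UF_monoidal =
     \<lparr>TOb = uf_tensor,
      TAr = (\<lambda>h k. uf_mor (uf_tensor (UDm h) (UDm k)) (uf_tensor (UCd h) (UCd k))
                     (prod_map (uf_rep h) (uf_rep k))),
      Unit = uf_unit,
      Asc = (\<lambda>P Q R. uf_mor (uf_tensor (uf_tensor P Q) R) (uf_tensor P (uf_tensor Q R))
                       (total_map (fst (uf_tensor (uf_tensor P Q) R))
                          (\<lambda>p. vpair (vfst (vfst p)) (vpair (vsnd (vfst p)) (vsnd p))))),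
      Lun = (\<lambda>P. uf_mor (uf_tensor uf_unit P) P (total_map (fst (uf_tensor uf_unit P)) vsnd)),
      Run = (\<lambda>P. uf_mor (uf_tensor P uf_unit) P (total_map (fst (uf_tensor P uf_unit)) vfst))\<rparr>"


section \<open>Set-valued functors on the category of ultrafilters\<close>

type_synonym 'v uf_fctr = "('v uf_ob, 'v uf_ar, 'v, 'v set_ar) fctr"
type_synonym 'v uf_trans = "('v uf_ob, 'v uf_ar, 'v, 'v set_ar) ntrans"

definition UF_SET :: "('v::set_universe uf_fctr, 'v uf_trans) cat" where
  "UF_SET = fctr_cat UF SET"

text \<open>Morphisms of ultrafilters are coded (injectively on each hom-set, as sets of graphs) by
  elements of the universe, so that hom-sets become objects of \<^term>\<open>SET\<close>.\<close>

definition hom_code :: "'v::set_universe uf_ar \<Rightarrow> 'v" where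
  "hom_code h = vset ((\<lambda>f. vset {vpair x y | x y. f x = Some y}) ` UCl h)"

definition hom_decode :: "'v::set_universe uf_ob \<Rightarrow> 'v uf_ob \<Rightarrow> 'v \<Rightarrow> 'v uf_ar" where
  "hom_decode P Q = inv_into (Hom UF P Q) hom_code"

definition hom_set :: "'v::set_universe uf_ob \<Rightarrow> 'v uf_ob \<Rightarrow> 'v" where
  "hom_set P Q = vset (hom_code ` Hom UF P Q)"

definition hom_fctr :: "'v::set_universe uf_ob \<Rightarrow> 'v uf_fctr" where
  "hom_fctr P =
     \<lparr>FOb = (\<lambda>Q\<in>Ob UF. hom_set P Q),
      FAr = (\<lambda>k\<in>Ar UF.
        \<lparr>SDm = hom_set P (UDm k), SCd = hom_set P (UCd k),
         SFn = (\<lambda>a\<in>elts (hom_set P (UDm k)).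
                  hom_code (k \<cdot>\<^bsub>UF\<^esub> hom_decode P (UDm k) a))\<rparr>)\<rparr>"

text \<open>The domain of this functor is \<^term>\<open>op_cat UF\<close>, whence the order of domain and codomain.\<close>

definition yoneda ::
  "('v::set_universe uf_ob, 'v uf_ar, 'v uf_fctr, 'v uf_trans) fctr" where
  "yoneda =
     \<lparr>FOb = (\<lambda>P\<in>Ob UF. hom_fctr P),
      FAr = (\<lambda>h\<in>Ar UF.
        \<lparr>NDm = hom_fctr (UCd h), NCd = hom_fctr (UDm h),
         NAt = (\<lambda>R\<in>Ob UF.
           \<lparr>SDm = hom_set (UCd h) R, SCd = hom_set (UDm h) R,
            SFn = (\<lambda>a\<in>elts (hom_set (UCd h) R).
                     hom_code (hom_decode (UCd h) R a \<cdot>\<^bsub>UF\<^esub> h))\<rparr>)\<rparr>)\<rparr>"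

definition representable :: "'v::set_universe uf_fctr \<Rightarrow> bool" where
  "representable A \<longleftrightarrow> A \<in> Ob UF_SET \<and> (\<exists>P \<in> Ob UF. isomorphic UF_SET A (hom_fctr P))"

text \<open>\<open>integral_fctr B\<close> is the functor sending \<open>Y\<close> to the sum of \<open>B (Y, V)\<close> over the ultrafilters \<open>V\<close> on \<open>Y\<close>;
  the summation index \<open>V\<close> is coded by an element of the universe, with \<open>uf_decode\<close> inverse to
  \<open>uf_code\<close>.\<close>

definition uf_code :: "'v::set_universe set set \<Rightarrow> 'v" where
  "uf_code U = vset (vset ` U)"

definition uf_decode :: "'v::set_universe \<Rightarrow> 'v set set" where
  "uf_decode u = elts ` elts u"

definition set_push :: "'v::set_universe set_ar \<Rightarrow> 'v set set \<Rightarrow> 'v set set" where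
  "set_push f U = pushforward (elts (SDm f)) (elts (SCd f)) (SFn f) U"

definition push_mor :: "'v::set_universe set_ar \<Rightarrow> 'v set set \<Rightarrow> 'v uf_ar" where
  "push_mor f U = uf_mor (SDm f, U) (SCd f, set_push f U) (total_map (SDm f) (SFn f))"

definition integral_set :: "'v::set_universe uf_fctr \<Rightarrow> 'v \<Rightarrow> 'v" where
  "integral_set B Y =
     vset {vpair (uf_code V) a | V a. ultrafilter_on (elts Y) V \<and> a \<in> elts (FOb B (Y, V))}"

definition integral_fctr :: "'v::set_universe uf_fctr \<Rightarrow> 'v endo" where
  "integral_fctr B =
     \<lparr>FOb = integral_set B,
      FAr = (\<lambda>f\<in>Ar SET.
        \<lparr>SDm = integral_set B (SDm f), SCd = integral_set B (SCd f),
         SFn = (\<lambda>p\<in>elts (integral_set B (SDm f)).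
                  let V = uf_decode (vfst p)
                  in vpair (uf_code (set_push f V)) (SFn (FAr B (push_mor f V)) (vsnd p)))\<rparr>)\<rparr>"

definition integral ::
  "('v::set_universe uf_fctr, 'v uf_trans, 'v endo, 'v endo_trans) fctr" where
  "integral =
     \<lparr>FOb = (\<lambda>B\<in>Ob UF_SET. integral_fctr B),
      FAr = (\<lambda>t\<in>Ar UF_SET.
        \<lparr>NDm = integral_fctr (NDm t), NCd = integral_fctr (NCd t),
         NAt = (\<lambda>Y.
           \<lparr>SDm = integral_set (NDm t) Y, SCd = integral_set (NCd t) Y,
            SFn = (\<lambda>p\<in>elts (integral_set (NDm t) Y).
                     vpair (vfst p) (SFn (NAt t (Y, uf_decode (vfst p))) (vsnd p)))\<rparr>)\<rparr>)\<rparr>"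

text \<open>A monoidal structure on set-valued functors is transported from the composition structure
  when the equivalence \<open>integral\<close> is strong monoidal for it; this determines it up to monoidal
  isomorphism over the identity functor. Likewise a structure on \<open>UF\<close> is induced by \<open>M\<close>
  when the Yoneda embedding is strong monoidal for it.\<close>

definition transported :: "('v::set_universe uf_fctr, 'v uf_trans) monoidal \<Rightarrow> bool" where
  "transported M \<longleftrightarrow> strong_monoidal UF_SET M FC (composition_monoidal SET) integral"

definition induced_on_UF :: "('v::set_universe uf_fctr, 'v uf_trans) monoidal \<Rightarrow>
    ('v uf_ob, 'v uf_ar) monoidal \<Rightarrow> bool" where
  "induced_on_UF M N \<longleftrightarrow>
     strong_monoidal (op_cat UF) (op_monoidal UF N) UF_SET M yoneda"

end

theory Submission
  imports Defs
begin

text \<open>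
  Underlying sets of ultrafilters are nonempty, so every morphism \<open>(X, U) \<rightarrow> (Y, V)\<close> is the class of a total
  map \<open>X \<rightarrow> Y\<close>. Hence the functor \<open>integral\<close> sends the representable at \<open>(X, U)\<close> to the ultrapower functor:
  an element of its value at \<open>Y\<close> is a map \<open>X \<rightarrow> Y\<close> up to equality \<open>U\<close>-almost everywhere, the ultrafilter
  on \<open>Y\<close> being its pushforward. By the definition of \<open>U \<otimes> V\<close>, currying identifies the ultrapower by
  \<open>U \<otimes> V\<close> with the \<open>U\<close>-power of the \<open>V\<close>-power, naturally and coherently, so the composite of \<open>integral\<close>
  with the Yoneda embedding is strong monoidal. Since \<open>integral\<close> is itself strong monoidal and fully
  faithful, the constraints of the composite lift to constraints for the Yoneda embedding.
\<close>


section \<open>Sets of the universe\<close>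

text \<open>Transport is a property here, not a construction: \<open>transported M\<close> supplies
  the functor \<open>integral\<close> into \<open>FC\<close>, the monoidal category
  \<open>FC\<close> and some coherent constraints, so the tensor of \<open>M\<close> is never
  computed. Ultrapowers are compared concretely in \<open>FC\<close>, where equations can be tested
  on elements, and the answer is pulled back: a constraint of the Yoneda embedding is the unique
  solution \<open>t\<close> of \<open>FAr F t \<cdot> i = j\<close>, with \<open>i\<close> a
  constraint of \<open>integral\<close> and \<open>j\<close> one of the composite functor. The
  axioms follow because \<open>integral\<close> is faithful and every such \<open>i\<close> is epi.

  Full faithfulness is the delicate input. A transformation between two integrals is natural only
  with respect to plain functions, while its values are split up according to ultrafilters, so it
  has to be shown to respect the splitting; maximality of ultrafilters achieves this.

  As the Yoneda embedding is contravariant, the monoidal axioms are verified on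
  \<open>op_cat UF\<close>, with inverse associators and unitors.\<close>

definition small :: "'v::set_universe set \<Rightarrow> bool" where
  "small A \<longleftrightarrow> (\<exists>z. elts z = A)"

lemma small_elts [simp]: "small (elts x)"
  by (auto simp: small_def)

lemma elts_vset [simp]: "small A \<Longrightarrow> elts (vset A) = A"
  unfolding small_def vset_def by (metis (mono_tags, lifting) elts_inject theI)

lemma small_subset: "small B \<Longrightarrow> A \<subseteq> B \<Longrightarrow> small A"
  unfolding small_def using ex_subset by blast

lemma small_doubleton [simp]: "small {x, y}"
  unfolding small_def by (rule ex_pair)

lemma small_singleton [simp]: "small {x}"
  using small_doubleton[of x x] by simp

lemma small_UN:
  fixes A :: "'v::set_universe set" and B :: "'v \<Rightarrow> 'v set"
  shows "small A \<Longrightarrow> (\<And>x. x \<in> A \<Longrightarrow> small (B x)) \<Longrightarrow> small (\<Union>x\<in>A. B x)"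
proof -
  assume A: "small A" and B: "\<And>x. x \<in> A \<Longrightarrow> small (B x)"
  obtain z where z: "elts z = A" using A by (auto simp: small_def)
  obtain w where "elts w = (\<Union>y\<in>elts z. elts (vset (B y)))"
    using ex_Union[where x = z and f = "\<lambda>y. vset (B y)"] ..
  with z B have "elts w = (\<Union>x\<in>A. B x)" by simp
  then show ?thesis unfolding small_def ..
qed

text \<open>Replacement follows from the union axiom, an image being a union of singletons.\<close>

lemma small_image:
  fixes f :: "'v::set_universe \<Rightarrow> 'v"
  shows "small A \<Longrightarrow> small (f ` A)"
  using small_UN[of A "\<lambda>x. {f x}"] by (simp add: UNION_singleton_eq_range)

lemma small_power: "small A \<Longrightarrow> small {y. elts y \<subseteq> A}"
  unfolding small_def using ex_power by blast

lemma vset_inject: "small A \<Longrightarrow> small B \<Longrightarrow> vset A = vset B \<longleftrightarrow> A = B"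
  by (metis elts_vset)

text \<open>This is Kuratowski's pair. Coding by \<open>vset\<close> is injective on small sets, so
  the usual argument about singletons and doubletons applies; \<open>s\<close> lists the
  coincidences that can occur.\<close>

lemma vpair_inject [simp]: "vpair x y = vpair x' y' \<longleftrightarrow> x = x' \<and> y = y'"
proof -
  have s: "vset {a} = vset {b} \<longleftrightarrow> a = b" "vset {a} = vset {b, c} \<longleftrightarrow> a = b \<and> a = c"
    "vset {b, c} = vset {a} \<longleftrightarrow> a = b \<and> a = c"
    "vset {a, b} = vset {c, d} \<longleftrightarrow> a = c \<and> b = d \<or> a = d \<and> b = c" for a b c d :: 'a
    by (subst vset_inject; force simp: doubleton_eq_iff)+
  have "vpair x y = vpair x' y' \<longleftrightarrow> {vset {x}, vset {x, y}} = {vset {x'}, vset {x', y'}}"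
    unfolding vpair_def by (rule vset_inject) simp_all
  also have "\<dots> \<longleftrightarrow> x = x' \<and> y = y'"
    unfolding doubleton_eq_iff s by blast
  finally show ?thesis .
qed

lemma vfst_vpair [simp]: "vfst (vpair x y) = x"
  by (simp add: vfst_def)

lemma vsnd_vpair [simp]: "vsnd (vpair x y) = y"
  by (simp add: vsnd_def)

lemma elts_vtimes [simp]: "elts (vtimes X Y) = {vpair x y | x y. x \<in> elts X \<and> y \<in> elts Y}"
proof -
  \<comment> \<open>The product is small as a union, over \<open>X\<close>, of images of
    \<open>Y\<close>.\<close>
  have "{vpair x y | x y. x \<in> elts X \<and> y \<in> elts Y} = (\<Union>x\<in>elts X. vpair x ` elts Y)"
    by auto
  then have "small {vpair x y | x y. x \<in> elts X \<and> y \<in> elts Y}"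
    by (simp add: small_UN small_image)
  then show ?thesis by (simp add: vtimes_def)
qed


section \<open>Ultrafilters and their morphisms\<close>

abbreviation pts :: "'v::set_universe uf_ob \<Rightarrow> 'v set" where
  "pts P \<equiv> elts (fst P)"

text \<open>The ultrafilter read as an almost-everywhere quantifier. It commutes with the Boolean
  connectives, so arguments about members of \<open>snd P\<close> become arguments about
  predicates.\<close>

definition uf_ae :: "'v::set_universe uf_ob \<Rightarrow> ('v \<Rightarrow> bool) \<Rightarrow> bool" where
  "uf_ae P \<phi> \<longleftrightarrow> {x \<in> pts P. \<phi> x} \<in> snd P"

lemma Ob_UF: "P \<in> Ob UF \<longleftrightarrow> ultrafilter_on (pts P) (snd P)"
  by (simp add: UF_def)

lemma snd_subset: "P \<in> Ob UF \<Longrightarrow> B \<in> snd P \<Longrightarrow> B \<subseteq> pts P"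
  by (auto simp: Ob_UF ultrafilter_on_def)

lemma mem_snd: "P \<in> Ob UF \<Longrightarrow> B \<subseteq> pts P \<Longrightarrow> B \<in> snd P \<longleftrightarrow> uf_ae P (\<lambda>x. x \<in> B)"
proof -
  assume "B \<subseteq> pts P"
  then have "{x \<in> pts P. x \<in> B} = B" by auto
  then show ?thesis by (simp add: uf_ae_def)
qed

lemma uf_ae_cong: "(\<And>x. x \<in> pts P \<Longrightarrow> \<phi> x = \<psi> x) \<Longrightarrow> uf_ae P \<phi> = uf_ae P \<psi>"
  unfolding uf_ae_def by (metis (mono_tags, lifting) Collect_cong)

lemma uf_ae_conj:
  assumes "P \<in> Ob UF"
  shows "uf_ae P (\<lambda>x. \<phi> x \<and> \<psi> x) \<longleftrightarrow> uf_ae P \<phi> \<and> uf_ae P \<psi>"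
proof -
  have "{x \<in> pts P. \<phi> x \<and> \<psi> x} = {x \<in> pts P. \<phi> x} \<inter> {x \<in> pts P. \<psi> x}" by auto
  moreover have "{x \<in> pts P. \<phi> x} \<subseteq> pts P" "{x \<in> pts P. \<psi> x} \<subseteq> pts P" by auto
  ultimately show ?thesis using assms unfolding uf_ae_def Ob_UF ultrafilter_on_def by presburger
qed

lemma uf_ae_not:
  assumes "P \<in> Ob UF"
  shows "uf_ae P (\<lambda>x. \<not> \<phi> x) \<longleftrightarrow> \<not> uf_ae P \<phi>"
proof -
  have "{x \<in> pts P. \<not> \<phi> x} = pts P - {x \<in> pts P. \<phi> x}" by auto
  moreover have "{x \<in> pts P. \<phi> x} \<in> snd P \<longleftrightarrow> pts P - {x \<in> pts P. \<phi> x} \<notin> snd P"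
  proof -
    have "\<forall>A. A \<subseteq> pts P \<longrightarrow> (A \<in> snd P \<longleftrightarrow> pts P - A \<notin> snd P)"
      using assms unfolding Ob_UF ultrafilter_on_def by (elim conjE) assumption
    then show ?thesis by (rule allE) (erule mp, auto)
  qed
  ultimately show ?thesis unfolding uf_ae_def by argo
qed

lemma uf_ae_True: "P \<in> Ob UF \<Longrightarrow> uf_ae P (\<lambda>x. True)"
  by (simp add: uf_ae_def Ob_UF ultrafilter_on_def)

lemma uf_ae_I: "P \<in> Ob UF \<Longrightarrow> (\<And>x. x \<in> pts P \<Longrightarrow> \<phi> x) \<Longrightarrow> uf_ae P \<phi>"
  using uf_ae_cong[of P \<phi> "\<lambda>x. True"] by (simp add: uf_ae_True)

lemma uf_ae_const [simp]: "P \<in> Ob UF \<Longrightarrow> uf_ae P (\<lambda>x. c) \<longleftrightarrow> c"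
  using uf_ae_True[of P] uf_ae_not[of P "\<lambda>x. True"] by (cases c) auto

lemma uf_ae_mono:
  "P \<in> Ob UF \<Longrightarrow> uf_ae P \<phi> \<Longrightarrow> (\<And>x. x \<in> pts P \<Longrightarrow> \<phi> x \<Longrightarrow> \<psi> x) \<Longrightarrow> uf_ae P \<psi>"
  using uf_ae_conj[of P \<phi> \<psi>] uf_ae_cong[of P "\<lambda>x. \<phi> x \<and> \<psi> x" \<phi>] by auto

lemma uf_ae_mono2:
  assumes "P \<in> Ob UF" "uf_ae P \<phi>" "uf_ae P \<psi>" "\<And>x. x \<in> pts P \<Longrightarrow> \<phi> x \<Longrightarrow> \<psi> x \<Longrightarrow> \<chi> x"
  shows "uf_ae P \<chi>"
  using uf_ae_mono[of P "\<lambda>x. \<phi> x \<and> \<psi> x" \<chi>] assms by (simp add: uf_ae_conj)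

text \<open>On an empty set \<open>True\<close> and \<open>False\<close> would agree at every point,
  yet the quantifier separates them. This supplies the default values that make partial maps
  total.\<close>

lemma pts_nonempty: "P \<in> Ob UF \<Longrightarrow> pts P \<noteq> {}"
  using uf_ae_cong[of P "\<lambda>x. True" "\<lambda>x. False"] by auto

text \<open>Subsets of \<open>pts P\<close> correspond to predicates on it, so an ultrafilter can be
  recognised by its quantifier; tensors and pushforwards are handled this way.\<close>

lemma Ob_UF_I:
  assumes "snd P \<subseteq> Pow (pts P)"
    and "uf_ae P (\<lambda>x. True)"
    and "\<And>\<phi> \<psi>. uf_ae P (\<lambda>x. \<phi> x \<and> \<psi> x) \<longleftrightarrow> uf_ae P \<phi> \<and> uf_ae P \<psi>"
    and "\<And>\<phi>. uf_ae P (\<lambda>x. \<not> \<phi> x) \<longleftrightarrow> \<not> uf_ae P \<phi>"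
  shows "P \<in> Ob UF"
  unfolding Ob_UF ultrafilter_on_def
proof (intro conjI allI impI)
  show "pts P \<in> snd P" using assms(2) by (simp add: uf_ae_def)
  fix A B assume A: "A \<subseteq> pts P"
  have eq: "{x \<in> pts P. x \<in> C} = C" if "C \<subseteq> pts P" for C using that by auto
  have "{x \<in> pts P. x \<notin> A} = pts P - A" by auto
  then show "A \<in> snd P \<longleftrightarrow> pts P - A \<notin> snd P"
    using assms(4)[of "\<lambda>x. x \<in> A"] A by (simp add: uf_ae_def eq)
  assume B: "B \<subseteq> pts P"
  have "{x \<in> pts P. x \<in> A \<and> x \<in> B} = A \<inter> B" using A by auto
  then show "A \<inter> B \<in> snd P \<longleftrightarrow> A \<in> snd P \<and> B \<in> snd P"
    using assms(3)[of "\<lambda>x. x \<in> A" "\<lambda>x. x \<in> B"] A B by (simp add: uf_ae_def eq)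
qed (use assms(1) in auto)

lemma uf_ob_eqI:
  assumes "P \<in> Ob UF" "Q \<in> Ob UF" "fst P = fst Q" "\<And>\<phi>. uf_ae P \<phi> \<longleftrightarrow> uf_ae Q \<phi>"
  shows "P = Q"
proof -
  have "B \<in> snd P \<longleftrightarrow> B \<in> snd Q" for B
  proof (cases "B \<subseteq> pts P")
    case True
    then have Q: "B \<subseteq> pts Q" using assms(3) by simp
    show ?thesis
      using mem_snd[OF assms(1) True] mem_snd[OF assms(2) Q] assms(4)[of "\<lambda>x. x \<in> B"] by argo
  next
    case False
    then have "\<not> B \<subseteq> pts Q" using assms(3) by simp
    with False show ?thesis using snd_subset assms(1,2) by blast
  qed
  then have "snd P = snd Q" by (rule set_eqI)
  then show ?thesis using assms(3) by (simp add: prod_eq_iff)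
qed

section \<open>Continuous maps and the classes of total maps\<close>

definition ucont :: "'v::set_universe uf_ob \<Rightarrow> 'v uf_ob \<Rightarrow> ('v \<Rightarrow> 'v) \<Rightarrow> bool" where
  "ucont P Q f \<longleftrightarrow> f \<in> pts P \<rightarrow> pts Q \<and> (\<forall>\<phi>. uf_ae Q \<phi> \<longleftrightarrow> uf_ae P (\<lambda>x. \<phi> (f x)))"

definition umor :: "'v::set_universe uf_ob \<Rightarrow> 'v uf_ob \<Rightarrow> ('v \<Rightarrow> 'v) \<Rightarrow> 'v uf_ar" where
  "umor P Q f = uf_mor P Q (total_map (fst P) f)"

lemma umor_sel [simp]: "UDm (umor P Q f) = P" "UCd (umor P Q f) = Q"
  by (simp_all add: umor_def uf_mor_def)

text \<open>The change-of-variables rule that replaces preimages of sets: the quantifier of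
  \<open>Q\<close> is that of \<open>P\<close> after substituting \<open>f\<close>.\<close>

lemma ucont_ae: "ucont P Q f \<Longrightarrow> uf_ae Q \<phi> \<longleftrightarrow> uf_ae P (\<lambda>x. \<phi> (f x))"
  by (simp add: ucont_def)

lemma ucont_app: "ucont P Q f \<Longrightarrow> x \<in> pts P \<Longrightarrow> f x \<in> pts Q"
  by (auto simp: ucont_def)

lemma ucont_id: "ucont P P id"
  by (simp add: ucont_def)

lemma ucont_comp: "ucont P Q f \<Longrightarrow> ucont Q R g \<Longrightarrow> ucont P R (g \<circ> f)"
  by (auto simp: ucont_def)

lemma eq_mod_total_map:
  "eq_mod (snd P) (total_map (fst P) f) r \<longleftrightarrow> uf_ae P (\<lambda>x. r x = Some (f x))"
proof -
  have "{x. x \<in> dom (total_map (fst P) f) \<and> x \<in> dom r \<and> total_map (fst P) f x = r x} =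
    {x \<in> pts P. r x = Some (f x)}"
    by (auto simp: total_map_def split: if_splits)
  then show ?thesis by (simp add: eq_mod_def uf_ae_def)
qed

lemma continuous_total_map:
  assumes "P \<in> Ob UF" "Q \<in> Ob UF"
  shows "continuous_partial P Q (total_map (fst P) f) \<longleftrightarrow> ucont P Q f"
proof -
  have dom: "dom (total_map (fst P) f) = pts P" by (auto simp: total_map_def split: if_splits)
  have "pts P \<in> snd P" using uf_ae_True[OF assms(1)] by (simp add: uf_ae_def)
  moreover have "ran (total_map (fst P) f) \<subseteq> pts Q \<longleftrightarrow> f \<in> pts P \<rightarrow> pts Q"
    by (auto simp: total_map_def ran_def)
  moreover have "{x. \<exists>y\<in>B. total_map (fst P) f x = Some y} = {x \<in> pts P. f x \<in> B}" for B
    by (auto simp: total_map_def)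
  moreover have "(\<forall>B\<subseteq>pts Q. B \<in> snd Q \<longleftrightarrow> {x \<in> pts P. f x \<in> B} \<in> snd P) \<longleftrightarrow>
      (\<forall>\<phi>. uf_ae Q \<phi> \<longleftrightarrow> uf_ae P (\<lambda>x. \<phi> (f x)))" (is "?L \<longleftrightarrow> ?R") if "f \<in> pts P \<rightarrow> pts Q"
  proof
    assume L: ?L
    show ?R
    proof
      fix \<phi>
      have "{x \<in> pts P. f x \<in> {y \<in> pts Q. \<phi> y}} = {x \<in> pts P. \<phi> (f x)}" using that by auto
      then show "uf_ae Q \<phi> \<longleftrightarrow> uf_ae P (\<lambda>x. \<phi> (f x))"
        using L[rule_format, of "{y \<in> pts Q. \<phi> y}"] by (simp add: uf_ae_def)
    qed
  next
    assume R: ?R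
    show ?L
    proof (intro allI impI)
      fix B assume "B \<subseteq> pts Q"
      then have "B \<in> snd Q \<longleftrightarrow> uf_ae P (\<lambda>x. f x \<in> B)"
        using mem_snd[OF assms(2), of B] R[rule_format, of "\<lambda>x. x \<in> B"] by simp
      then show "B \<in> snd Q \<longleftrightarrow> {x \<in> pts P. f x \<in> B} \<in> snd P"
        unfolding uf_ae_def .
    qed
  qed
  ultimately show ?thesis unfolding continuous_partial_def ucont_def dom by (simp cong: conj_cong)
qed

text \<open>A domain that belongs to the ultrafilter can be filled up arbitrarily: the extension
  stays continuous and agrees almost everywhere with the given partial map.\<close>

lemma continuous_partial_cong:
  assumes P: "P \<in> Ob UF" and Q: "Q \<in> Ob UF" and g: "continuous_partial P Q g"
  obtains f where "ucont P Q f" "uf_ae P (\<lambda>x. g x = Some (f x))"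
proof -
  obtain y0 where y0: "y0 \<in> pts Q" using pts_nonempty[OF Q] by auto
  \<comment> \<open>\<open>y0\<close> is the default off the domain of \<open>g\<close>; it only has
    to lie in \<open>pts Q\<close>.\<close>
  define f where "f x = (case g x of Some y \<Rightarrow> y | None \<Rightarrow> y0)" for x
  have dom: "dom g \<in> snd P" and ran: "ran g \<subseteq> pts Q"
    and c: "\<And>B. B \<subseteq> pts Q \<Longrightarrow> B \<in> snd Q \<longleftrightarrow> {x. \<exists>y\<in>B. g x = Some y} \<in> snd P"
    using g by (auto simp: continuous_partial_def)
  have "{x \<in> pts P. x \<in> dom g} = dom g" using snd_subset[OF P dom] by auto
  then have aed: "uf_ae P (\<lambda>x. x \<in> dom g)" using dom by (simp add: uf_ae_def)
  have ae: "uf_ae P (\<lambda>x. g x = Some (f x))"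
    by (rule uf_ae_mono[OF P aed]) (auto simp: f_def)
  have "f x \<in> pts Q" for x
    using y0 by (cases "g x") (auto simp: f_def intro: subsetD[OF ran] ranI)
  then have fm: "f \<in> pts P \<rightarrow> pts Q" by simp
  have g': "x \<in> pts P \<and> f x = y \<and> y \<in> pts Q" if "g x = Some y" for x y
    using domI[of g x y] that snd_subset[OF P dom] subsetD[OF ran ranI[of g x y]] by (simp add: f_def subset_iff)
  have "\<forall>\<phi>. uf_ae Q \<phi> \<longleftrightarrow> uf_ae P (\<lambda>x. \<phi> (f x))"
  proof
    fix \<phi>
    \<comment> \<open>The preimage under \<open>g\<close> is cut down to the domain of
      \<open>g\<close>. The conjunct \<open>g x = Some (f x)\<close> that expresses this holds
      almost everywhere and therefore drops out of the quantifier.\<close>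
    have "(\<exists>y\<in>{y \<in> pts Q. \<phi> y}. g x = Some y) \<longleftrightarrow> x \<in> pts P \<and> g x = Some (f x) \<and> \<phi> (f x)" for x
      using g'[of x] by (cases "g x") auto
    then have "{x. \<exists>y\<in>{y \<in> pts Q. \<phi> y}. g x = Some y} = {x \<in> pts P. g x = Some (f x) \<and> \<phi> (f x)}"
      by simp
    then have "uf_ae Q \<phi> \<longleftrightarrow> uf_ae P (\<lambda>x. g x = Some (f x) \<and> \<phi> (f x))"
      using c[of "{y \<in> pts Q. \<phi> y}"] by (simp add: uf_ae_def)
    then show "uf_ae Q \<phi> \<longleftrightarrow> uf_ae P (\<lambda>x. \<phi> (f x))" using ae by (simp add: uf_ae_conj[OF P])
  qed
  with fm have "ucont P Q f" unfolding ucont_def ..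
  then show ?thesis by (rule that) (rule ae)
qed

text \<open>The device for computing in \<open>UF\<close>, whose operations are defined through
  arbitrary representatives: to identify the resulting class it is enough that the representative
  agrees almost everywhere with a known total map.\<close>

lemma uf_mor_eq_umor:
  assumes "P \<in> Ob UF" "uf_ae P (\<lambda>x. r x = Some (f x))"
  shows "uf_mor P Q r = umor P Q f"
proof -
  have "eq_mod (snd P) r g \<longleftrightarrow> uf_ae P (\<lambda>x. g x = Some (f x))" if "continuous_partial P Q g" for g
  proof -
    have "dom g \<subseteq> pts P" using that snd_subset[OF assms(1)] by (auto simp: continuous_partial_def)
    then have "{x. x \<in> dom r \<and> x \<in> dom g \<and> r x = g x} = {x \<in> pts P. x \<in> dom r \<and> x \<in> dom g \<and> r x = g x}"
      by auto
    then have *: "eq_mod (snd P) r g \<longleftrightarrow> uf_ae P (\<lambda>x. x \<in> dom r \<and> x \<in> dom g \<and> r x = g x)"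
      by (simp add: eq_mod_def uf_ae_def)
    show ?thesis unfolding *
      using uf_ae_mono2[OF assms(1) assms(2), of "\<lambda>x. x \<in> dom r \<and> x \<in> dom g \<and> r x = g x" "\<lambda>x. g x = Some (f x)"]
        uf_ae_mono2[OF assms(1) assms(2), of  "\<lambda>x. g x = Some (f x)" "\<lambda>x. x \<in> dom r \<and> x \<in> dom g \<and> r x = g x"]
      by (auto simp: dom_def)
  qed
  then show ?thesis by (auto simp: umor_def uf_mor_def eq_mod_total_map)
qed

lemma total_map_mem_umor:
  assumes P: "P \<in> Ob UF" and Q: "Q \<in> Ob UF" and f: "ucont P Q f"
  shows "total_map (fst P) f \<in> UCl (umor P Q f)"
proof -
  have "uf_ae P (\<lambda>x. total_map (fst P) f x = Some (f x))"
    by (rule uf_ae_I[OF P]) (simp add: total_map_def)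
  then show ?thesis
    by (simp add: umor_def uf_mor_def eq_mod_total_map continuous_total_map[OF P Q] f)
qed

text \<open>From left to right: a total map belongs to its own class, so equal classes force it to
  be equivalent to the other map.\<close>

lemma umor_eq_iff:
  assumes P: "P \<in> Ob UF" and Q: "Q \<in> Ob UF" and f: "ucont P Q f" and g: "ucont P Q g"
  shows "umor P Q f = umor P Q g \<longleftrightarrow> uf_ae P (\<lambda>x. f x = g x)"
proof
  assume "umor P Q f = umor P Q g"
  with total_map_mem_umor[OF P Q g] have "total_map (fst P) g \<in> UCl (umor P Q f)" by simp
  then have "uf_ae P (\<lambda>x. total_map (fst P) g x = Some (f x))"
    by (simp add: umor_def uf_mor_def eq_mod_total_map)
  then show "uf_ae P (\<lambda>x. f x = g x)" by (rule uf_ae_mono[OF P]) (simp add: total_map_def)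
next
  assume "uf_ae P (\<lambda>x. f x = g x)"
  then have "uf_ae P (\<lambda>x. total_map (fst P) f x = Some (g x))"
    by (rule uf_ae_mono[OF P]) (simp add: total_map_def)
  then show "umor P Q f = umor P Q g" unfolding umor_def[of P Q f] by (rule uf_mor_eq_umor[OF P])
qed

lemma umor_cong: "P \<in> Ob UF \<Longrightarrow> (\<And>x. x \<in> pts P \<Longrightarrow> f x = g x) \<Longrightarrow> umor P Q f = umor P Q g"
  unfolding umor_def[of P Q f] by (rule uf_mor_eq_umor) (auto simp: total_map_def intro: uf_ae_I)

lemma Dm_UF [simp]: "Dm UF = UDm" and Cd_UF [simp]: "Cd UF = UCd"
  by (simp_all add: UF_def)

lemma Ar_UF_def: "Ar UF = {uf_mor P Q f | P Q f. ultrafilter_on (pts P) (snd P) \<and>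
    ultrafilter_on (pts Q) (snd Q) \<and> continuous_partial P Q f}"
  by (simp add: UF_def)

lemma Ar_UF: "h \<in> Ar UF \<longleftrightarrow> (\<exists>P Q f. P \<in> Ob UF \<and> Q \<in> Ob UF \<and> ucont P Q f \<and> h = umor P Q f)"
proof
  assume "h \<in> Ar UF"
  then obtain P Q g where *: "P \<in> Ob UF" "Q \<in> Ob UF" "continuous_partial P Q g"
    and h: "h = uf_mor P Q g"
    unfolding Ar_UF_def Ob_UF by blast
  from * obtain f where f: "ucont P Q f" "uf_ae P (\<lambda>x. g x = Some (f x))"
    by (rule continuous_partial_cong)
  from f(2) have "h = umor P Q f" unfolding h by (rule uf_mor_eq_umor[OF *(1)])
  with *(1,2) f(1) show "\<exists>P Q f. P \<in> Ob UF \<and> Q \<in> Ob UF \<and> ucont P Q f \<and> h = umor P Q f"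
    by blast
next
  assume "\<exists>P Q f. P \<in> Ob UF \<and> Q \<in> Ob UF \<and> ucont P Q f \<and> h = umor P Q f"
  then obtain P Q f where *: "P \<in> Ob UF" "Q \<in> Ob UF" "ucont P Q f" "h = umor P Q f" by blast
  then have "continuous_partial P Q (total_map (fst P) f)" by (simp add: continuous_total_map)
  with * show "h \<in> Ar UF" unfolding Ar_UF_def Ob_UF umor_def by blast
qed

lemma Hom_UF: "h \<in> Hom UF P Q \<longleftrightarrow> P \<in> Ob UF \<and> Q \<in> Ob UF \<and> (\<exists>f. ucont P Q f \<and> h = umor P Q f)"
  by (auto simp: Hom_def Ar_UF simp del: split_paired_Ex)

lemma umor_Hom: "P \<in> Ob UF \<Longrightarrow> Q \<in> Ob UF \<Longrightarrow> ucont P Q f \<Longrightarrow> umor P Q f \<in> Hom UF P Q"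
  by (auto simp: Hom_UF)

lemma One_UF: "One UF P = umor P P id"
  by (simp add: UF_def umor_def id_def)

lemma uf_rep_umor:
  assumes "P \<in> Ob UF" "Q \<in> Ob UF" "ucont P Q f"
  shows "uf_ae P (\<lambda>x. uf_rep (umor P Q f) x = Some (f x))"
proof -
  from total_map_mem_umor[OF assms] have "uf_rep (umor P Q f) \<in> UCl (umor P Q f)"
    unfolding uf_rep_def some_in_eq by blast
  then show ?thesis by (simp add: umor_def uf_mor_def eq_mod_total_map)
qed

text \<open>The chosen representative of \<open>g\<close> is controlled only almost everywhere on
  \<open>Q\<close>. Continuity of \<open>f\<close> pulls this back to almost all \<open>x\<close>,
  where the representative is evaluated at \<open>f x\<close>.\<close>

lemma umor_comp:
  assumes "P \<in> Ob UF" "Q \<in> Ob UF" "R \<in> Ob UF" and f: "ucont P Q f" and g: "ucont Q R g"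
  shows "umor Q R g \<cdot>\<^bsub>UF\<^esub> umor P Q f = umor P R (g \<circ> f)"
proof -
  have "uf_ae Q (\<lambda>y. uf_rep (umor Q R g) y = Some (g y))" by (rule uf_rep_umor) fact+
  then have "uf_ae P (\<lambda>x. uf_rep (umor Q R g) (f x) = Some (g (f x)))"
    by (simp add: ucont_ae[OF f])
  with uf_rep_umor[OF assms(1,2) f]
  have "uf_ae P (\<lambda>x. (uf_rep (umor Q R g) \<circ>\<^sub>m uf_rep (umor P Q f)) x = Some ((g \<circ> f) x))"
    by (rule uf_ae_mono2[OF assms(1)]) simp
  then have "uf_mor P R (uf_rep (umor Q R g) \<circ>\<^sub>m uf_rep (umor P Q f)) = umor P R (g \<circ> f)"
    by (rule uf_mor_eq_umor[OF assms(1)])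
  then show ?thesis by (simp add: UF_def)
qed

lemma Hom_UF_E:
  assumes "h \<in> Hom UF P Q"
  obtains f where "P \<in> Ob UF" "Q \<in> Ob UF" "ucont P Q f" "h = umor P Q f"
  using assms by (auto simp: Hom_UF)

lemma category_UF: "category UF"
proof
  fix f assume "f \<in> Ar (UF :: ('a uf_ob, _) cat)"
  then show "Dm UF f \<in> Ob UF \<and> Cd UF f \<in> Ob UF" by (auto simp: Ar_UF)
next
  fix P :: "'a uf_ob" assume "P \<in> Ob UF"
  then show "One UF P \<in> Hom UF P P" by (simp add: One_UF umor_Hom ucont_id)
next
  fix f g and P Q R :: "'a uf_ob"
  assume "f \<in> Hom UF P Q" "g \<in> Hom UF Q R"
  then show "g \<cdot>\<^bsub>UF\<^esub> f \<in> Hom UF P R"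
    by (elim Hom_UF_E) (simp add: umor_comp umor_Hom ucont_comp)
next
  fix f and P Q :: "'a uf_ob" assume f: "f \<in> Hom UF P Q"
  then show "f \<cdot>\<^bsub>UF\<^esub> One UF P = f"
    by (elim Hom_UF_E) (simp add: One_UF umor_comp ucont_id)
  from f show "One UF Q \<cdot>\<^bsub>UF\<^esub> f = f"
    by (elim Hom_UF_E) (simp add: One_UF umor_comp ucont_id)
next
  fix f g h and P Q R S :: "'a uf_ob"
  assume "f \<in> Hom UF P Q" "g \<in> Hom UF Q R" "h \<in> Hom UF R S"
  then show "(h \<cdot>\<^bsub>UF\<^esub> g) \<cdot>\<^bsub>UF\<^esub> f = h \<cdot>\<^bsub>UF\<^esub> g \<cdot>\<^bsub>UF\<^esub> f"
    by (elim Hom_UF_E) (simp add: umor_comp ucont_comp comp_assoc)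
qed


section \<open>The monoidal structure on ultrafilters\<close>

lemma op_cat_sel [simp]:
  "Ob (op_cat C) = Ob C" "Ar (op_cat C) = Ar C" "Dm (op_cat C) = Cd C" "Cd (op_cat C) = Dm C"
  "One (op_cat C) = One C" "g \<cdot>\<^bsub>op_cat C\<^esub> f = f \<cdot>\<^bsub>C\<^esub> g" "Hom (op_cat C) A B = Hom C B A"
  by (auto simp: op_cat_def Hom_def)

lemma category_op:
  assumes "category C"
  shows "category (op_cat C)"
proof -
  interpret category C by fact
  show ?thesis
    by unfold_locales (auto simp: dm_cd one_hom cmp_one one_cmp intro: cmp_hom cmp_assoc[symmetric])
qed

lemma inverse_pair_op [simp]: "inverse_pair (op_cat C) f g \<longleftrightarrow> inverse_pair C f g"
  by (auto simp: inverse_pair_def Hom_def)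

lemma (in category) inverse_pair_unique:
  assumes "inverse_pair C f g" "inverse_pair C f h"
  shows "g = h"
proof -
  have f: "f \<in> Hom C (Dm C f) (Cd C f)" using assms by (simp add: inverse_pair_def Hom_def)
  have g: "g \<in> Hom C (Cd C f) (Dm C f)" "f \<cdot> g = One C (Cd C f)"
    and h: "h \<in> Hom C (Cd C f) (Dm C f)" "h \<cdot> f = One C (Dm C f)"
    using assms by (simp_all add: inverse_pair_def)
  have "g = (h \<cdot> f) \<cdot> g" using one_cmp[OF g(1)] h(2) by simp
  also have "\<dots> = h" using cmp_assoc[OF g(1) f h(1)] g(2) cmp_one[OF h(1)] by simp
  finally show ?thesis .
qed

text \<open>Turns the definite description used in \<open>op_monoidal\<close> into an explicit
  inverse.\<close>

lemma (in category) inv_ar_eq: "inverse_pair C f g \<Longrightarrow> inv_ar C f = g"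
  unfolding inv_ar_def by (rule the_equality) (auto intro: inverse_pair_unique)

lemma pts_tensor: "pts (uf_tensor P Q) = {vpair x y | x y. x \<in> pts P \<and> y \<in> pts Q}"
  by (simp add: uf_tensor_def)

lemma pts_tensorE:
  assumes "p \<in> pts (uf_tensor P Q)"
  obtains x y where "x \<in> pts P" "y \<in> pts Q" "p = vpair x y"
  using assms by (auto simp: pts_tensor)

lemma vpair_pts_tensor [simp]: "vpair x y \<in> pts (uf_tensor P Q) \<longleftrightarrow> x \<in> pts P \<and> y \<in> pts Q"
  by (auto simp: pts_tensor)

text \<open>A Fubini rule: the quantifier of the tensor is iterated, with the variable of
  \<open>P\<close> outermost. Continuity of the structure maps and the comparison of ultrapowers
  both reduce to it.\<close>

lemma uf_ae_tensor: "uf_ae (uf_tensor P Q) \<phi> \<longleftrightarrow> uf_ae P (\<lambda>x. uf_ae Q (\<lambda>y. \<phi> (vpair x y)))"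
proof -
  have "{y \<in> pts Q. vpair x y \<in> {p \<in> pts (uf_tensor P Q). \<phi> p}} = {y \<in> pts Q. \<phi> (vpair x y)}"
    if "x \<in> pts P" for x using that by auto
  then have "{x \<in> pts P. {y \<in> pts Q. vpair x y \<in> {p \<in> pts (uf_tensor P Q). \<phi> p}} \<in> snd Q} =
    {x \<in> pts P. {y \<in> pts Q. \<phi> (vpair x y)} \<in> snd Q}"
    by auto
  moreover have "snd (uf_tensor P Q) = {A. A \<subseteq> pts (uf_tensor P Q) \<and>
      {x \<in> pts P. {y \<in> pts Q. vpair x y \<in> A} \<in> snd Q} \<in> snd P}"
    by (simp add: uf_tensor_def)
  ultimately show ?thesis unfolding uf_ae_def by auto
qed

lemma tensor_Ob [simp]:
  assumes P: "P \<in> Ob UF" and Q: "Q \<in> Ob UF"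
  shows "uf_tensor P Q \<in> Ob UF"
proof (rule Ob_UF_I)
  show "snd (uf_tensor P Q) \<subseteq> Pow (pts (uf_tensor P Q))"
    by (auto simp: uf_tensor_def)
qed (simp_all add: uf_ae_tensor P Q uf_ae_conj uf_ae_not)

lemma pts_unit [simp]: "pts uf_unit = {vset {}}"
  by (simp add: uf_unit_def)

lemma uf_ae_unit [simp]: "uf_ae uf_unit \<phi> \<longleftrightarrow> \<phi> (vset {})"
proof -
  have "{x \<in> {vset {}}. \<phi> x} = (if \<phi> (vset {}) then {vset {}} else {})" by auto
  then show ?thesis by (simp add: uf_ae_def) (simp add: uf_unit_def)
qed

lemma unit_Ob [simp]: "uf_unit \<in> Ob UF"
  by (rule Ob_UF_I) (simp_all, simp add: uf_unit_def)

definition tensor_map :: "('v::set_universe \<Rightarrow> 'v) \<Rightarrow> ('v \<Rightarrow> 'v) \<Rightarrow> 'v \<Rightarrow> 'v" where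
  "tensor_map f g p = vpair (f (vfst p)) (g (vsnd p))"

definition assoc_map :: "'v::set_universe \<Rightarrow> 'v" where
  "assoc_map p = vpair (vfst (vfst p)) (vpair (vsnd (vfst p)) (vsnd p))"

text \<open>Explicit because the opposite monoidal structure is built from inverses: this is the map
  behind its associator.\<close>

definition assoc_inv :: "'v::set_universe \<Rightarrow> 'v" where
  "assoc_inv p = vpair (vpair (vfst p) (vfst (vsnd p))) (vsnd (vsnd p))"

lemma structure_map_vpair [simp]:
  "tensor_map f g (vpair x y) = vpair (f x) (g y)"
  "assoc_map (vpair (vpair x y) z) = vpair x (vpair y z)"
  "assoc_inv (vpair x (vpair y z)) = vpair (vpair x y) z"
  by (simp_all add: tensor_map_def assoc_map_def assoc_inv_def)

lemma ucont_tensor_map: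
  assumes "ucont P P' f" "ucont Q Q' g"
  shows "ucont (uf_tensor P Q) (uf_tensor P' Q') (tensor_map f g)"
  using assms
  by (auto simp: ucont_def uf_ae_tensor pts_tensor)

lemma ucont_assoc_map:
  "ucont (uf_tensor (uf_tensor P Q) R) (uf_tensor P (uf_tensor Q R)) assoc_map"
  by (auto simp: ucont_def uf_ae_tensor pts_tensor)

lemma ucont_assoc_inv:
  "ucont (uf_tensor P (uf_tensor Q R)) (uf_tensor (uf_tensor P Q) R) assoc_inv"
  by (auto simp: ucont_def uf_ae_tensor pts_tensor)

lemma ucont_vsnd: "ucont (uf_tensor uf_unit P) P vsnd"
  by (auto simp: ucont_def uf_ae_tensor pts_tensor)

lemma ucont_vpair_unit_left: "ucont P (uf_tensor uf_unit P) (vpair (vset {}))"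
  by (auto simp: ucont_def uf_ae_tensor pts_tensor)

lemma ucont_vfst: "ucont (uf_tensor P uf_unit) P vfst"
  by (auto simp: ucont_def uf_ae_tensor pts_tensor)

lemma ucont_vpair_unit_right: "ucont P (uf_tensor P uf_unit) (\<lambda>x. vpair x (vset {}))"
  by (auto simp: ucont_def uf_ae_tensor pts_tensor)

lemmas ucont_structure = ucont_id ucont_comp ucont_tensor_map ucont_assoc_map ucont_assoc_inv
  ucont_vsnd ucont_vpair_unit_left ucont_vfst ucont_vpair_unit_right

text \<open>For almost all \<open>x\<close> the representative of the first class has value
  \<open>f x\<close>, and then for almost all \<open>y\<close> that of the second has value
  \<open>g y\<close>. This nested statement is almost-everywhere agreement for the tensor
  ultrafilter.\<close>

lemma tensor_umor:
  assumes P: "P \<in> Ob UF" and P': "P' \<in> Ob UF" and Q: "Q \<in> Ob UF" and Q': "Q' \<in> Ob UF"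
    and f: "ucont P P' f" and g: "ucont Q Q' g"
  shows "TAr UF_monoidal (umor P P' f) (umor Q Q' g) =
    umor (uf_tensor P Q) (uf_tensor P' Q') (tensor_map f g)"
proof -
  let ?f = "uf_rep (umor P P' f)" and ?g = "uf_rep (umor Q Q' g)"
  have "uf_ae P (\<lambda>x. uf_ae Q (\<lambda>y. prod_map ?f ?g (vpair x y) = Some (vpair (f x) (g y))))"
  proof (rule uf_ae_mono[OF P uf_rep_umor[OF P P' f]])
    fix x assume x: "?f x = Some (f x)"
    show "uf_ae Q (\<lambda>y. prod_map ?f ?g (vpair x y) = Some (vpair (f x) (g y)))"
      by (rule uf_ae_mono[OF Q uf_rep_umor[OF Q Q' g]]) (use x in \<open>auto simp: prod_map_def\<close>)
  qed
  then have "uf_ae (uf_tensor P Q) (\<lambda>p. prod_map ?f ?g p = Some (tensor_map f g p))"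
    by (simp add: uf_ae_tensor)
  with P Q have "uf_mor (uf_tensor P Q) (uf_tensor P' Q') (prod_map ?f ?g) =
    umor (uf_tensor P Q) (uf_tensor P' Q') (tensor_map f g)"
    by (intro uf_mor_eq_umor) simp_all
  then show ?thesis by (simp add: UF_monoidal_def)
qed

lemma inverse_pair_umor:
  assumes "P \<in> Ob UF" "Q \<in> Ob UF" "ucont P Q f" "ucont Q P g"
    and "\<And>x. x \<in> pts P \<Longrightarrow> g (f x) = x" "\<And>y. y \<in> pts Q \<Longrightarrow> f (g y) = y"
  shows "inverse_pair UF (umor P Q f) (umor Q P g)"
  using assms umor_Hom[OF assms(1-3)] umor_Hom[OF assms(2,1,4)]
  by (auto simp: inverse_pair_def Hom_def umor_comp One_UF intro!: umor_cong)

lemma op_UF_monoidal_sel: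
  "TOb (op_monoidal UF UF_monoidal) = uf_tensor"
  "TAr (op_monoidal UF UF_monoidal) = TAr UF_monoidal"
  "Unit (op_monoidal UF UF_monoidal) = uf_unit"
  by (simp_all add: op_monoidal_def UF_monoidal_def)

lemma inverse_pair_assoc:
  assumes "P \<in> Ob UF" "Q \<in> Ob UF" "R \<in> Ob UF"
  shows "inverse_pair UF (umor (uf_tensor (uf_tensor P Q) R) (uf_tensor P (uf_tensor Q R)) assoc_map)
     (umor (uf_tensor P (uf_tensor Q R)) (uf_tensor (uf_tensor P Q) R) assoc_inv)"
  using assms by (intro inverse_pair_umor) (auto simp: ucont_structure elim!: pts_tensorE)

lemma inverse_pair_unit_left:
  assumes "P \<in> Ob UF"
  shows "inverse_pair UF (umor (uf_tensor uf_unit P) P vsnd) (umor P (uf_tensor uf_unit P) (vpair (vset {})))"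
  using assms by (intro inverse_pair_umor) (auto simp: ucont_structure elim!: pts_tensorE)

lemma inverse_pair_unit_right:
  assumes "P \<in> Ob UF"
  shows "inverse_pair UF (umor (uf_tensor P uf_unit) P vfst)
    (umor P (uf_tensor P uf_unit) (\<lambda>x. vpair x (vset {})))"
  using assms by (intro inverse_pair_umor) (auto simp: ucont_structure elim!: pts_tensorE)

lemma op_UF_monoidal_constraints:
  shows "P \<in> Ob UF \<Longrightarrow> Q \<in> Ob UF \<Longrightarrow> R \<in> Ob UF \<Longrightarrow> Asc (op_monoidal UF UF_monoidal) P Q R =
      umor (uf_tensor P (uf_tensor Q R)) (uf_tensor (uf_tensor P Q) R) assoc_inv"
    and "P \<in> Ob UF \<Longrightarrow> Lun (op_monoidal UF UF_monoidal) P = umor P (uf_tensor uf_unit P) (vpair (vset {}))"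
    and "P \<in> Ob UF \<Longrightarrow> Run (op_monoidal UF UF_monoidal) P = umor P (uf_tensor P uf_unit) (\<lambda>x. vpair x (vset {}))"
  using category.inv_ar_eq[OF category_UF inverse_pair_assoc]
    category.inv_ar_eq[OF category_UF inverse_pair_unit_left]
    category.inv_ar_eq[OF category_UF inverse_pair_unit_right]
  by (simp_all add: op_monoidal_def UF_monoidal_def assoc_map_def[abs_def] flip: umor_def)

lemma inverse_pair_sym: "inverse_pair C f g \<Longrightarrow> inverse_pair C g f"
  by (auto simp: inverse_pair_def Hom_def)

text \<open>Once every arrow is written as the class of a total map, each equational axiom compares
  two maps on nested pairs that agree at every point. The inverse pairs above show that the
  constraints are isomorphisms.\<close>

lemma monoidal_category_op_UF:
  "monoidal_category (op_cat UF) (op_monoidal UF (UF_monoidal :: ('v::set_universe uf_ob, _) monoidal))"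
  (is "monoidal_category ?C ?M")
proof (intro monoidal_category.intro monoidal_category_axioms.intro, unfold op_cat_sel op_UF_monoidal_sel)
  note simps = op_UF_monoidal_constraints One_UF tensor_umor umor_comp ucont_structure umor_Hom
  show "category ?C" by (intro category_op category_UF)
  show "uf_unit \<in> Ob UF" by simp
  show "Lun ?M A \<in> Hom UF A (uf_tensor uf_unit A)" "Run ?M A \<in> Hom UF A (uf_tensor A uf_unit)"
    "iso ?C (Lun ?M A)" "iso ?C (Run ?M A)"
    if A: "A \<in> Ob UF" for A :: "'v uf_ob"
    using A inverse_pair_sym[OF inverse_pair_unit_left[OF A]] inverse_pair_sym[OF inverse_pair_unit_right[OF A]]
    by (auto simp: simps iso_def)
  show "uf_tensor A B \<in> Ob UF" "TAr UF_monoidal (One UF A) (One UF B) = One UF (uf_tensor A B)"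
    if "A \<in> Ob UF" "B \<in> Ob UF" for A B :: "'v uf_ob"
    using that by (auto simp: simps intro!: umor_cong elim!: pts_tensorE)
  show "Asc ?M A uf_unit B \<cdot>\<^bsub>UF\<^esub> TAr UF_monoidal (One UF A) (Lun ?M B) =
      TAr UF_monoidal (Run ?M A) (One UF B)"
    if "A \<in> Ob UF" "B \<in> Ob UF" for A B :: "'v uf_ob"
    using that by (auto simp: simps intro!: umor_cong elim!: pts_tensorE)
  show "TAr UF_monoidal f g \<in> Hom UF (uf_tensor A' B') (uf_tensor A B)"
    if "f \<in> Hom UF A' A" "g \<in> Hom UF B' B" for A A' B B' :: "'v uf_ob" and f g
    using that by (elim Hom_UF_E) (simp add: simps)
  show "TAr UF_monoidal (f \<cdot>\<^bsub>UF\<^esub> f') (g \<cdot>\<^bsub>UF\<^esub> g') =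
      TAr UF_monoidal f g \<cdot>\<^bsub>UF\<^esub> TAr UF_monoidal f' g'"
    if "f \<in> Hom UF A' A" "f' \<in> Hom UF A'' A'" "g \<in> Hom UF B' B" "g' \<in> Hom UF B'' B'"
    for A A' A'' B B' B'' :: "'v uf_ob" and f f' g g'
    using that by (elim Hom_UF_E) (auto simp: simps intro!: umor_cong elim!: pts_tensorE)
  show "Asc ?M A B D \<in> Hom UF (uf_tensor A (uf_tensor B D)) (uf_tensor (uf_tensor A B) D)"
    "iso ?C (Asc ?M A B D)"
    if "A \<in> Ob UF" "B \<in> Ob UF" "D \<in> Ob UF" for A B D :: "'v uf_ob"
    using that inverse_pair_sym[OF inverse_pair_assoc[OF that]] by (auto simp: simps iso_def)
  show "TAr UF_monoidal (TAr UF_monoidal f g) h \<cdot>\<^bsub>UF\<^esub> Asc ?M A' B' D' =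
      Asc ?M A B D \<cdot>\<^bsub>UF\<^esub> TAr UF_monoidal f (TAr UF_monoidal g h)"
    if "f \<in> Hom UF A' A" "g \<in> Hom UF B' B" "h \<in> Hom UF D' D"
    for A A' B B' D D' :: "'v uf_ob" and f g h
    using that by (elim Hom_UF_E) (auto simp: simps intro!: umor_cong elim!: pts_tensorE)
  show "TAr UF_monoidal (One UF uf_unit) f \<cdot>\<^bsub>UF\<^esub> Lun ?M A' = Lun ?M A \<cdot>\<^bsub>UF\<^esub> f"
    "TAr UF_monoidal f (One UF uf_unit) \<cdot>\<^bsub>UF\<^esub> Run ?M A' = Run ?M A \<cdot>\<^bsub>UF\<^esub> f"
    if "f \<in> Hom UF A' A" for A A' :: "'v uf_ob" and f
    using that by (elim Hom_UF_E; auto simp: simps intro!: umor_cong elim!: pts_tensorE)+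
  show "(TAr UF_monoidal (Asc ?M A B D) (One UF E) \<cdot>\<^bsub>UF\<^esub>
      Asc ?M A (uf_tensor B D) E) \<cdot>\<^bsub>UF\<^esub> TAr UF_monoidal (One UF A) (Asc ?M B D E) =
      Asc ?M (uf_tensor A B) D E \<cdot>\<^bsub>UF\<^esub> Asc ?M A B (uf_tensor D E)"
    if "A \<in> Ob UF" "B \<in> Ob UF" "D \<in> Ob UF" "E \<in> Ob UF" for A B D E :: "'v uf_ob"
    using that by (auto simp: simps ucont_comp[OF ucont_assoc_inv ucont_tensor_map[OF ucont_assoc_inv ucont_id]]
        intro!: umor_cong elim!: pts_tensorE)
qed


section \<open>The Yoneda embedding\<close>

lemma SET_sel [simp]:
  "Ob SET = UNIV" "Dm SET = SDm" "Cd SET = SCd"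
  "One SET X = \<lparr>SDm = X, SCd = X, SFn = (\<lambda>x\<in>elts X. x)\<rparr>"
  "SDm (g \<cdot>\<^bsub>SET\<^esub> f) = SDm f" "SCd (g \<cdot>\<^bsub>SET\<^esub> f) = SCd g"
  by (simp_all add: SET_def)

lemma Ar_SET: "f \<in> Ar SET \<longleftrightarrow> SFn f \<in> elts (SDm f) \<rightarrow>\<^sub>E elts (SCd f)"
  by (simp add: SET_def)

lemma Hom_SET: "f \<in> Hom SET X Y \<longleftrightarrow> SDm f = X \<and> SCd f = Y \<and> SFn f \<in> elts X \<rightarrow>\<^sub>E elts Y"
  by (auto simp: Hom_def Ar_SET)

lemma Hom_SET_I:
  "(\<And>x. x \<in> elts X \<Longrightarrow> f x \<in> elts Y) \<Longrightarrow> \<lparr>SDm = X, SCd = Y, SFn = (\<lambda>x\<in>elts X. f x)\<rparr> \<in> Hom SET X Y"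
  by (auto simp: Hom_SET)

lemma SFn_cmp: "x \<in> elts (SDm f) \<Longrightarrow> SFn (g \<cdot>\<^bsub>SET\<^esub> f) x = SFn g (SFn f x)"
  by (simp add: SET_def compose_eq)

lemma SFn_app: "f \<in> Hom SET X Y \<Longrightarrow> x \<in> elts X \<Longrightarrow> SFn f x \<in> elts Y"
  by (auto simp: Hom_SET)

lemma SET_cmp_Hom: "f \<in> Hom SET X Y \<Longrightarrow> g \<in> Hom SET Y Z \<Longrightarrow> g \<cdot>\<^bsub>SET\<^esub> f \<in> Hom SET X Z"
  by (auto simp: Hom_SET) (auto simp: SET_def compose_def)

lemma SET_eqI:
  assumes "f \<in> Hom SET X Y" "g \<in> Hom SET X Y" "\<And>x. x \<in> elts X \<Longrightarrow> SFn f x = SFn g x"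
  shows "f = g"
proof -
  have "SFn f = SFn g"
    using assms(1,2) by (intro extensionalityI[of _ "elts X"]) (auto simp: Hom_SET assms(3) PiE_def)
  with assms(1,2) show ?thesis by (simp add: Hom_SET)
qed

lemma category_SET: "category SET"
proof
  fix f assume "f \<in> Ar SET" then show "Dm SET f \<in> Ob SET \<and> Cd SET f \<in> Ob SET" by simp
next
  fix X :: 'a show "One SET X \<in> Hom SET X X" by (auto simp: Hom_SET)
next
  fix f g and X Y Z :: 'a
  assume "f \<in> Hom SET X Y" "g \<in> Hom SET Y Z"
  then show "g \<cdot>\<^bsub>SET\<^esub> f \<in> Hom SET X Z" by (rule SET_cmp_Hom)
next
  fix f and X Y :: 'a assume f: "f \<in> Hom SET X Y"
  have "One SET X \<in> Hom SET X X" "One SET Y \<in> Hom SET Y Y" by (auto simp: Hom_SET)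
  then show "f \<cdot>\<^bsub>SET\<^esub> One SET X = f" "One SET Y \<cdot>\<^bsub>SET\<^esub> f = f"
    using f SFn_app[OF f] by (auto intro!: SET_eqI[of _ X Y] SET_cmp_Hom simp: SFn_cmp Hom_SET simp del: SET_sel(4)) (auto simp: SFn_cmp)
next
  fix f g h and X Y Z W :: 'a
  assume f: "f \<in> Hom SET X Y" and g: "g \<in> Hom SET Y Z" and h: "h \<in> Hom SET Z W"
  show "(h \<cdot>\<^bsub>SET\<^esub> g) \<cdot>\<^bsub>SET\<^esub> f = h \<cdot>\<^bsub>SET\<^esub> g \<cdot>\<^bsub>SET\<^esub> f"
  proof (rule SET_eqI)
    show "(h \<cdot>\<^bsub>SET\<^esub> g) \<cdot>\<^bsub>SET\<^esub> f \<in> Hom SET X W" "h \<cdot>\<^bsub>SET\<^esub> g \<cdot>\<^bsub>SET\<^esub> f \<in> Hom SET X W"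
      using f g h by (blast intro: SET_cmp_Hom)+
    show "SFn ((h \<cdot>\<^bsub>SET\<^esub> g) \<cdot>\<^bsub>SET\<^esub> f) x = SFn (h \<cdot>\<^bsub>SET\<^esub> g \<cdot>\<^bsub>SET\<^esub> f) x" if "x \<in> elts X" for x
      using that f g SFn_app[OF f that] by (simp add: SFn_cmp Hom_SET)
  qed
qed

lemma ntrans_eqI:
  assumes "is_ntrans C D s" "is_ntrans C D t" "NDm s = NDm t" "NCd s = NCd t"
    and "\<And>A. A \<in> Ob C \<Longrightarrow> NAt s A = NAt t A"
  shows "s = t"
proof -
  have "NAt s = NAt t"
    using assms(1,2) by (intro extensionalityI[of _ "Ob C"]) (simp_all add: is_ntrans_def assms(5))
  with assms(3,4) show ?thesis by simp
qed

lemma Ar_UF_E: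
  assumes "k \<in> Ar UF"
  obtains P Q f where "P \<in> Ob UF" "Q \<in> Ob UF" "ucont P Q f" "k = umor P Q f"
  using assms unfolding Ar_UF by blast

lemma Ar_UF_cmp_E:
  assumes "k \<in> Ar UF" "l \<in> Ar UF" "UDm l = UCd k"
  obtains P Q R f g where "P \<in> Ob UF" "Q \<in> Ob UF" "R \<in> Ob UF" "ucont P Q f" "ucont Q R g"
    "k = umor P Q f" "l = umor Q R g"
proof -
  obtain P Q f where k: "P \<in> Ob UF" "Q \<in> Ob UF" "ucont P Q f" "k = umor P Q f"
    using assms(1) by (rule Ar_UF_E)
  obtain Q' R g where l: "R \<in> Ob UF" "ucont Q' R g" "l = umor Q' R g"
    using assms(2) by (rule Ar_UF_E)
  with assms(3) k(4) have "Q' = Q" by simp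
  with k l that show ?thesis by blast
qed

lemma fctr_Hom: "is_fctr C D F \<Longrightarrow> f \<in> Hom C A B \<Longrightarrow> FAr F f \<in> Hom D (FOb F A) (FOb F B)"
  by (auto simp: is_fctr_def Hom_def)

lemma fctr_Ob: "is_fctr C D F \<Longrightarrow> A \<in> Ob C \<Longrightarrow> FOb F A \<in> Ob D"
  by (auto simp: is_fctr_def)

lemma fctr_One: "is_fctr C D F \<Longrightarrow> A \<in> Ob C \<Longrightarrow> FAr F (One C A) = One D (FOb F A)"
  by (auto simp: is_fctr_def)

lemma fctr_cmp:
  "is_fctr C D F \<Longrightarrow> f \<in> Hom C A B \<Longrightarrow> g \<in> Hom C B E \<Longrightarrow> FAr F (g \<cdot>\<^bsub>C\<^esub> f) = FAr F g \<cdot>\<^bsub>D\<^esub> FAr F f"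
  by (auto simp: is_fctr_def Hom_def)

lemma UF_SET_sel [simp]:
  "Ob UF_SET = {F. is_fctr UF SET F}" "Ar UF_SET = {t. is_ntrans UF SET t}"
  "Dm UF_SET = NDm" "Cd UF_SET = NCd"
  "One UF_SET F = \<lparr>NDm = F, NCd = F, NAt = (\<lambda>A\<in>Ob UF. One SET (FOb F A))\<rparr>"
  "t \<cdot>\<^bsub>UF_SET\<^esub> s = \<lparr>NDm = NDm s, NCd = NCd t, NAt = (\<lambda>A\<in>Ob UF. NAt t A \<cdot>\<^bsub>SET\<^esub> NAt s A)\<rparr>"
  by (simp_all add: UF_SET_def fctr_cat_def)

section \<open>Hom-sets coded in the universe\<close>

definition graph_code :: "('v::set_universe \<rightharpoonup> 'v) \<Rightarrow> 'v" where
  "graph_code f = vset {vpair x y | x y. f x = Some y}"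

lemma hom_code_graph: "hom_code h = vset (graph_code ` UCl h)"
  by (simp add: hom_code_def graph_code_def[abs_def])

text \<open>Domain and range bound the graph by a product, so it is small and \<open>vset\<close>
  loses nothing.\<close>

lemma elts_graph_code:
  assumes P: "P \<in> Ob UF" and f: "continuous_partial P Q f"
  shows "elts (graph_code f) = {vpair x y | x y. f x = Some y}"
    and "elts (graph_code f) \<subseteq> elts (vtimes (fst P) (fst Q))"
proof -
  have "dom f \<subseteq> pts P" "ran f \<subseteq> pts Q"
    using f snd_subset[OF P, of "dom f"] by (auto simp: continuous_partial_def)
  then have sub: "{vpair x y | x y. f x = Some y} \<subseteq> elts (vtimes (fst P) (fst Q))"
    using domI[of f] ranI[of f] by (auto 0 4 simp: subset_iff)
  then show 1: "elts (graph_code f) = {vpair x y | x y. f x = Some y}"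
    unfolding graph_code_def by (intro elts_vset) (rule small_subset[OF small_elts])
  then show "elts (graph_code f) \<subseteq> elts (vtimes (fst P) (fst Q))" using sub by simp
qed

lemma graph_code_inject:
  assumes "P \<in> Ob UF" "continuous_partial P Q f" "continuous_partial P Q g" "graph_code f = graph_code g"
  shows "f = g"
proof -
  have "{vpair x y | x y. f x = Some y} = {vpair x y | x y. g x = Some y}"
    using assms(4) elts_graph_code(1)[OF assms(1,2)] elts_graph_code(1)[OF assms(1,3)] by simp
  then have "f x = Some y \<longleftrightarrow> g x = Some y" for x y
    by (auto simp: set_eq_iff) (metis vpair_inject)+
  then have "f x = g x" for x by (cases "f x"; cases "g x") (auto, metis option.distinct(1))
  then show ?thesis ..
qed

lemma UCl_continuous: "h \<in> Ar UF \<Longrightarrow> f \<in> UCl h \<Longrightarrow> continuous_partial (UDm h) (UCd h) f"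
  by (auto simp: Ar_UF umor_def uf_mor_def simp del: split_paired_Ex)

text \<open>Every graph is a subset of one fixed product, so the codes of the maps in a class lie in
  its power set; the hom-set itself lies one power set higher.\<close>

lemma elts_hom_code:
  assumes "h \<in> Hom UF P Q"
  shows "elts (hom_code h) = graph_code ` UCl h"
    and "elts (hom_code h) \<subseteq> {y. elts y \<subseteq> elts (vtimes (fst P) (fst Q))}"
proof -
  have "P \<in> Ob UF" using assms by (simp add: Hom_UF)
  then have sub: "graph_code ` UCl h \<subseteq> {y. elts y \<subseteq> elts (vtimes (fst P) (fst Q))}"
    using assms UCl_continuous[of h] elts_graph_code(2)[of P Q] by (auto simp: Hom_def simp del: elts_vtimes)
  moreover have "small {y. elts y \<subseteq> elts (vtimes (fst P) (fst Q))}"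
    by (intro small_power small_elts)
  ultimately show 1: "elts (hom_code h) = graph_code ` UCl h"
    unfolding hom_code_graph using small_subset elts_vset by blast
  with sub show "elts (hom_code h) \<subseteq> {y. elts y \<subseteq> elts (vtimes (fst P) (fst Q))}" by simp
qed

text \<open>Only the class \<open>UCl\<close> is coded, so domain and codomain have to be supplied
  by the common hom-set.\<close>

lemma hom_code_inject:
  assumes "h \<in> Hom UF P Q" "k \<in> Hom UF P Q" "hom_code h = hom_code k"
  shows "h = k"
proof -
  have P: "P \<in> Ob UF" using assms(1) by (simp add: Hom_UF)
  have hk: "h \<in> Ar UF" "UDm h = P" "UCd h = Q" "k \<in> Ar UF" "UDm k = P" "UCd k = Q"
    using assms(1,2) by (auto simp: Hom_def)
  have eq: "graph_code ` UCl h = graph_code ` UCl k"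
    using assms(3) elts_hom_code(1)[OF assms(1)] elts_hom_code(1)[OF assms(2)] by simp
  have "inj_on graph_code (UCl h \<union> UCl k)"
  proof (rule inj_onI)
    fix f g assume "f \<in> UCl h \<union> UCl k" "g \<in> UCl h \<union> UCl k" "graph_code f = graph_code g"
    then show "f = g"
      using UCl_continuous[OF hk(1)] UCl_continuous[OF hk(4)] hk
      by (intro graph_code_inject[OF P, of Q]) auto
  qed
  then have "UCl h = UCl k" using eq by (metis inj_on_image_eq_iff Un_upper1 Un_upper2)
  with hk show ?thesis by simp
qed

lemma elts_hom_set: "elts (hom_set P Q) = hom_code ` Hom UF P Q"
proof -
  have "hom_code ` Hom UF P Q \<subseteq> {z. elts z \<subseteq> {y. elts y \<subseteq> elts (vtimes (fst P) (fst Q))}}"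
    using elts_hom_code(2)[of _ P Q] by (auto simp del: elts_vtimes)
  then have "small (hom_code ` Hom UF P Q)"
    by (rule small_subset[rotated]) (intro small_power small_elts)
  then show ?thesis by (simp add: hom_set_def)
qed

lemma hom_decode_code: "h \<in> Hom UF P Q \<Longrightarrow> hom_decode P Q (hom_code h) = h"
  unfolding hom_decode_def by (rule inv_into_f_f) (auto intro!: inj_onI hom_code_inject)

text \<open>The germ of a map along the ultrafilter, as an element of a hom-set: by
  \<open>germ_code_eq_iff\<close>, continuous maps have the same code exactly when they agree almost
  everywhere.\<close>

definition germ_code :: "'v::set_universe uf_ob \<Rightarrow> 'v uf_ob \<Rightarrow> ('v \<Rightarrow> 'v) \<Rightarrow> 'v" where
  "germ_code P Q f = hom_code (umor P Q f)"

lemma hom_setE: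
  assumes "a \<in> elts (hom_set P Q)"
  obtains f where "P \<in> Ob UF" "Q \<in> Ob UF" "ucont P Q f" "a = germ_code P Q f"
  using assms by (auto simp: elts_hom_set germ_code_def elim: Hom_UF_E)

lemma germ_code_mem: "P \<in> Ob UF \<Longrightarrow> Q \<in> Ob UF \<Longrightarrow> ucont P Q f \<Longrightarrow> germ_code P Q f \<in> elts (hom_set P Q)"
  by (simp add: elts_hom_set germ_code_def umor_Hom)

lemma germ_code_eq_iff:
  assumes "P \<in> Ob UF" "Q \<in> Ob UF" "ucont P Q f" "ucont P Q g"
  shows "germ_code P Q f = germ_code P Q g \<longleftrightarrow> uf_ae P (\<lambda>x. f x = g x)"
  using hom_code_inject[OF umor_Hom[OF assms(1-3)] umor_Hom[OF assms(1,2,4)]] umor_eq_iff[OF assms]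
  by (auto simp: germ_code_def)

lemma hom_fctr_umor:
  assumes "P \<in> Ob UF" "Q \<in> Ob UF" "R \<in> Ob UF" "ucont P Q f" "ucont Q R g"
  shows "SFn (FAr (hom_fctr P) (umor Q R g)) (germ_code P Q f) = germ_code P R (g \<circ> f)"
proof -
  have "umor Q R g \<in> Ar UF" "hom_code (umor P Q f) \<in> elts (hom_set P Q)"
    using umor_Hom[OF assms(2,3,5)] umor_Hom[OF assms(1,2,4)] by (auto simp: Hom_def elts_hom_set)
  with umor_Hom[OF assms(1,2,4)] assms show ?thesis
    by (simp add: hom_fctr_def germ_code_def hom_decode_code umor_comp)
qed

section \<open>Hom functors and the Yoneda functor\<close>

lemma hom_fctr_sel:
  "Q \<in> Ob UF \<Longrightarrow> FOb (hom_fctr P) Q = hom_set P Q"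
  "k \<in> Ar UF \<Longrightarrow> SDm (FAr (hom_fctr P) k) = hom_set P (UDm k)"
  "k \<in> Ar UF \<Longrightarrow> SCd (FAr (hom_fctr P) k) = hom_set P (UCd k)"
  by (simp_all add: hom_fctr_def)

lemma hom_fctr_Hom:
  assumes P: "P \<in> Ob UF" and k: "k \<in> Hom UF Q R"
  shows "FAr (hom_fctr P) k \<in> Hom SET (hom_set P Q) (hom_set P R)"
proof -
  obtain g where Q: "Q \<in> Ob UF" and R: "R \<in> Ob UF" and g: "ucont Q R g" and kg: "k = umor Q R g"
    using k by (rule Hom_UF_E)
  have kA: "k \<in> Ar UF" "UDm k = Q" "UCd k = R" using k by (auto simp: Hom_def)
  have "SFn (FAr (hom_fctr P) k) \<in> extensional (elts (hom_set P Q))"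
    using kA by (simp add: hom_fctr_def)
  moreover have "SFn (FAr (hom_fctr P) k) a \<in> elts (hom_set P R)" if "a \<in> elts (hom_set P Q)" for a
    using that by (elim hom_setE) (simp add: kg hom_fctr_umor Q R g germ_code_mem ucont_comp[OF _ g])
  ultimately show ?thesis using kA by (auto simp: Hom_SET hom_fctr_sel PiE_def)
qed

lemma is_fctr_hom_fctr:
  assumes P: "P \<in> Ob UF"
  shows "is_fctr UF SET (hom_fctr P)"
  unfolding is_fctr_def
proof (intro conjI ballI impI)
  show "FOb (hom_fctr P) \<in> Ob UF \<rightarrow>\<^sub>E Ob SET" by (simp add: hom_fctr_def)
  have Ar: "k \<in> Hom UF (UDm k) (UCd k)" "UDm k \<in> Ob UF" "UCd k \<in> Ob UF" if "k \<in> Ar UF" for k :: "'a uf_ar"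
    using that category.dm_cd[OF category_UF that] by (auto simp: Hom_def)
  show H: "FAr (hom_fctr P) k \<in> Hom SET (FOb (hom_fctr P) (Dm UF k)) (FOb (hom_fctr P) (Cd UF k))"
    if "k \<in> Ar UF" for k
    using hom_fctr_Hom[OF P Ar(1)[OF that]] Ar(2,3)[OF that] by (simp add: hom_fctr_sel)
  have "FAr (hom_fctr P) \<in> extensional (Ar UF)" by (simp add: hom_fctr_def)
  with H show "FAr (hom_fctr P) \<in> Ar UF \<rightarrow>\<^sub>E Ar SET" by (auto simp: PiE_def Hom_def)
  show "FAr (hom_fctr P) (One UF Q) = One SET (FOb (hom_fctr P) Q)" if Q: "Q \<in> Ob UF" for Q
  proof (rule SET_eqI)
    show "FAr (hom_fctr P) (One UF Q) \<in> Hom SET (hom_set P Q) (hom_set P Q)"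
      by (intro hom_fctr_Hom[OF P] category.one_hom[OF category_UF] Q)
    show "One SET (FOb (hom_fctr P) Q) \<in> Hom SET (hom_set P Q) (hom_set P Q)"
      using category.one_hom[OF category_SET] Q by (simp add: hom_fctr_sel Hom_SET)
    show "SFn (FAr (hom_fctr P) (One UF Q)) a = SFn (One SET (FOb (hom_fctr P) Q)) a"
      if "a \<in> elts (hom_set P Q)" for a
      using that by (elim hom_setE) (simp add: One_UF hom_fctr_umor ucont_id hom_fctr_sel germ_code_mem)
  qed
  fix k l :: "'a uf_ar"
  assume k: "k \<in> Ar UF" and l: "l \<in> Ar UF" and lk: "Dm UF l = Cd UF k"
  have "UDm l = UCd k" using lk by simp
  with k l obtain Q R S u v where Q: "Q \<in> Ob UF" and R: "R \<in> Ob UF" and S: "S \<in> Ob UF"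
    and u: "ucont Q R u" and v: "ucont R S v" and ku: "k = umor Q R u" and lv: "l = umor R S v"
    by (rule Ar_UF_cmp_E)
  have kH: "k \<in> Hom UF Q R" and lH: "l \<in> Hom UF R S" using k l by (simp_all add: Hom_def ku lv)
  show "FAr (hom_fctr P) (l \<cdot>\<^bsub>UF\<^esub> k) = FAr (hom_fctr P) l \<cdot>\<^bsub>SET\<^esub> FAr (hom_fctr P) k"
  proof (rule SET_eqI)
    show "FAr (hom_fctr P) (l \<cdot>\<^bsub>UF\<^esub> k) \<in> Hom SET (hom_set P Q) (hom_set P S)"
      by (intro hom_fctr_Hom[OF P] category.cmp_hom[OF category_UF kH lH])
    show "FAr (hom_fctr P) l \<cdot>\<^bsub>SET\<^esub> FAr (hom_fctr P) k \<in> Hom SET (hom_set P Q) (hom_set P S)"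
      by (rule SET_cmp_Hom[OF hom_fctr_Hom[OF P kH] hom_fctr_Hom[OF P lH]])
    fix a assume a: "a \<in> elts (hom_set P Q)"
    obtain f where f: "ucont P Q f" and af: "a = germ_code P Q f" using a by (rule hom_setE)
    have "SDm (FAr (hom_fctr P) k) = hom_set P Q" using k by (simp add: hom_fctr_sel ku)
    with a show "SFn (FAr (hom_fctr P) (l \<cdot>\<^bsub>UF\<^esub> k)) a = SFn (FAr (hom_fctr P) l \<cdot>\<^bsub>SET\<^esub> FAr (hom_fctr P) k) a"
      by (simp add: SFn_cmp ku lv af umor_comp[OF Q R S u v] hom_fctr_umor[OF P Q R f u]
          hom_fctr_umor[OF P R S ucont_comp[OF f u] v] hom_fctr_umor[OF P Q S f ucont_comp[OF u v]] comp_assoc)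
  qed
qed

lemma yoneda_sel:
  "P \<in> Ob UF \<Longrightarrow> FOb yoneda P = hom_fctr P"
  "h \<in> Ar UF \<Longrightarrow> NDm (FAr yoneda h) = hom_fctr (UCd h)"
  "h \<in> Ar UF \<Longrightarrow> NCd (FAr yoneda h) = hom_fctr (UDm h)"
  by (simp_all add: yoneda_def)

lemma yoneda_umor:
  assumes "P \<in> Ob UF" "Q \<in> Ob UF" "R \<in> Ob UF" "ucont P Q f" "ucont Q R g"
  shows "SFn (NAt (FAr yoneda (umor P Q f)) R) (germ_code Q R g) = germ_code P R (g \<circ> f)"
proof -
  have "umor P Q f \<in> Ar UF" "hom_code (umor Q R g) \<in> elts (hom_set Q R)"
    using umor_Hom[OF assms(2,3,5)] umor_Hom[OF assms(1,2,4)] by (auto simp: Hom_def elts_hom_set)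
  with umor_Hom[OF assms(2,3,5)] assms show ?thesis
    by (simp add: yoneda_def germ_code_def hom_decode_code umor_comp)
qed

lemma yoneda_NAt_Hom:
  assumes h: "h \<in> Hom UF P Q" and R: "R \<in> Ob UF"
  shows "NAt (FAr yoneda h) R \<in> Hom SET (hom_set Q R) (hom_set P R)"
proof -
  obtain f where P: "P \<in> Ob UF" and Q: "Q \<in> Ob UF" and f: "ucont P Q f" and hf: "h = umor P Q f"
    using h by (rule Hom_UF_E)
  have hA: "h \<in> Ar UF" "UDm h = P" "UCd h = Q" using h by (auto simp: Hom_def)
  have "SFn (NAt (FAr yoneda h) R) \<in> extensional (elts (hom_set Q R))"
    using hA R by (simp add: yoneda_def)
  moreover have "SFn (NAt (FAr yoneda h) R) a \<in> elts (hom_set P R)" if "a \<in> elts (hom_set Q R)" for a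
    using that by (elim hom_setE) (simp add: hf yoneda_umor P Q f germ_code_mem ucont_comp[OF f])
  ultimately show ?thesis using hA R by (auto simp: Hom_SET yoneda_def PiE_def)
qed

lemma is_ntrans_yoneda:
  assumes h: "h \<in> Hom UF P Q"
  shows "is_ntrans UF SET (FAr yoneda h)"
  unfolding is_ntrans_def
proof (intro conjI ballI)
  obtain f where P: "P \<in> Ob UF" and Q: "Q \<in> Ob UF" and f: "ucont P Q f" and hf: "h = umor P Q f"
    using h by (rule Hom_UF_E)
  have hA: "h \<in> Ar UF" "UDm h = P" "UCd h = Q" using h by (auto simp: Hom_def)
  show "is_fctr UF SET (NDm (FAr yoneda h))" "is_fctr UF SET (NCd (FAr yoneda h))"
    using hA P Q by (simp_all add: yoneda_sel is_fctr_hom_fctr)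
  show "NAt (FAr yoneda h) \<in> extensional (Ob UF)" using hA by (simp add: yoneda_def)
  show "NAt (FAr yoneda h) R \<in> Hom SET (FOb (NDm (FAr yoneda h)) R) (FOb (NCd (FAr yoneda h)) R)"
    if "R \<in> Ob UF" for R
    using yoneda_NAt_Hom[OF h that] that hA by (simp add: yoneda_sel hom_fctr_sel)
  fix k :: "'a uf_ar" assume k: "k \<in> Ar UF"
  then obtain R S u where R: "R \<in> Ob UF" and S: "S \<in> Ob UF" and u: "ucont R S u" and ku: "k = umor R S u"
    by (rule Ar_UF_E)
  have kH: "k \<in> Hom UF R S" using k by (simp add: Hom_def ku)
  have "NAt (FAr yoneda h) S \<cdot>\<^bsub>SET\<^esub> FAr (hom_fctr Q) k = FAr (hom_fctr P) k \<cdot>\<^bsub>SET\<^esub> NAt (FAr yoneda h) R"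
  proof (rule SET_eqI[OF SET_cmp_Hom[OF hom_fctr_Hom[OF Q kH] yoneda_NAt_Hom[OF h S]]
        SET_cmp_Hom[OF yoneda_NAt_Hom[OF h R] hom_fctr_Hom[OF P kH]]])
    fix a assume a: "a \<in> elts (hom_set Q R)"
    obtain g where g: "ucont Q R g" and ag: "a = germ_code Q R g" using a by (rule hom_setE)
    have "SDm (FAr (hom_fctr Q) k) = hom_set Q R" "SDm (NAt (FAr yoneda h) R) = hom_set Q R"
      using hom_fctr_Hom[OF Q kH] yoneda_NAt_Hom[OF h R] by (simp_all add: Hom_SET)
    with a show "SFn (NAt (FAr yoneda h) S \<cdot>\<^bsub>SET\<^esub> FAr (hom_fctr Q) k) a =
        SFn (FAr (hom_fctr P) k \<cdot>\<^bsub>SET\<^esub> NAt (FAr yoneda h) R) a"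
      by (simp add: SFn_cmp ku hf ag hom_fctr_umor[OF Q R S g u] yoneda_umor[OF P Q S f ucont_comp[OF g u]]
          yoneda_umor[OF P Q R f g] hom_fctr_umor[OF P R S ucont_comp[OF f g] u] comp_assoc)
  qed
  then show "NAt (FAr yoneda h) (Cd UF k) \<cdot>\<^bsub>SET\<^esub> FAr (NDm (FAr yoneda h)) k =
      FAr (NCd (FAr yoneda h)) k \<cdot>\<^bsub>SET\<^esub> NAt (FAr yoneda h) (Dm UF k)"
    by (simp add: yoneda_sel hA ku)
qed

lemma yoneda_Hom:
  assumes "h \<in> Hom UF P Q"
  shows "FAr yoneda h \<in> Hom UF_SET (hom_fctr Q) (hom_fctr P)"
  using assms is_ntrans_yoneda[OF assms] by (auto simp: Hom_def yoneda_sel)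

text \<open>The category axioms of \<open>UF_SET\<close> guarantee that identities and composites of
  transformations are again natural. The equations themselves hold because precomposing germs is
  unital and associative.\<close>

lemma is_fctr_yoneda:
  assumes "category (UF_SET :: ('v::set_universe uf_fctr, 'v uf_trans) cat)"
  shows "is_fctr (op_cat UF) UF_SET (yoneda :: ('v::set_universe uf_ob, _, _, _) fctr)"
  unfolding is_fctr_def op_cat_sel
proof (intro conjI ballI impI)
  show "FOb yoneda \<in> (Ob UF :: 'v uf_ob set) \<rightarrow>\<^sub>E Ob UF_SET" by (auto simp: yoneda_def is_fctr_hom_fctr)
  have Ar: "k \<in> Hom UF (UDm k) (UCd k)" "UDm k \<in> Ob UF" "UCd k \<in> Ob UF" if "k \<in> Ar UF" for k :: "'v uf_ar"
    using that category.dm_cd[OF category_UF that] by (auto simp: Hom_def)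
  show H: "FAr yoneda h \<in> Hom UF_SET (FOb yoneda (Cd UF h)) (FOb yoneda (Dm UF h))"
    if "h \<in> Ar UF" for h :: "'v uf_ar"
    using yoneda_Hom[OF Ar(1)[OF that]] Ar[OF that] by (simp add: yoneda_sel)
  have "FAr yoneda \<in> extensional (Ar UF :: 'v uf_ar set)" by (simp add: yoneda_def)
  with H show "FAr yoneda \<in> (Ar UF :: 'v uf_ar set) \<rightarrow>\<^sub>E Ar UF_SET" by (simp only: PiE_def Hom_def) auto
  show "FAr yoneda (One UF P) = One UF_SET (FOb yoneda P)" if P: "P \<in> Ob UF" for P :: "'v uf_ob"
  proof (rule ntrans_eqI)
    have 1: "One UF P \<in> Hom UF P P" by (rule category.one_hom[OF category_UF P])
    then show "is_ntrans UF SET (FAr yoneda (One UF P))" by (rule is_ntrans_yoneda)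
    have "One UF_SET (FOb yoneda P) \<in> Ar UF_SET"
      using category.one_hom[OF assms, of "hom_fctr P"] P by (simp add: is_fctr_hom_fctr Hom_def yoneda_sel)
    then show "is_ntrans UF SET (One UF_SET (FOb yoneda P))" by simp
    show "NDm (FAr yoneda (One UF P)) = NDm (One UF_SET (FOb yoneda P))"
      "NCd (FAr yoneda (One UF P)) = NCd (One UF_SET (FOb yoneda P))"
      using 1 P by (simp_all add: Hom_def yoneda_sel)
    fix R :: "'v uf_ob" assume R: "R \<in> Ob UF"
    have "NAt (FAr yoneda (One UF P)) R = One SET (hom_set P R)"
    proof (rule SET_eqI[OF yoneda_NAt_Hom[OF 1 R] category.one_hom[OF category_SET]])
      fix a assume a: "a \<in> elts (hom_set P R)"
      then show "SFn (NAt (FAr yoneda (One UF P)) R) a = SFn (One SET (hom_set P R)) a"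
        by (elim hom_setE) (use a in \<open>simp add: One_UF yoneda_umor ucont_id\<close>)
    qed simp
    then show "NAt (FAr yoneda (One UF P)) R = NAt (One UF_SET (FOb yoneda P)) R"
      using P R by (simp add: yoneda_sel hom_fctr_sel)
  qed
  fix k h :: "'v uf_ar"
  assume k: "k \<in> Ar UF" and h: "h \<in> Ar UF" and hk: "Cd UF h = Dm UF k"
  have "UDm k = UCd h" using hk by simp
  with h k obtain P Q R u v where P: "P \<in> Ob UF" and Q: "Q \<in> Ob UF" and R: "R \<in> Ob UF"
    and u: "ucont P Q u" and v: "ucont Q R v" and hu: "h = umor P Q u" and kv: "k = umor Q R v"
    by (rule Ar_UF_cmp_E)
  have hH: "h \<in> Hom UF P Q" and kH: "k \<in> Hom UF Q R" using h k by (auto simp: Hom_def hu kv)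
  note khH = category.cmp_hom[OF category_UF hH kH]
  show "FAr yoneda (k \<cdot>\<^bsub>UF\<^esub> h) = FAr yoneda h \<cdot>\<^bsub>UF_SET\<^esub> FAr yoneda k"
  proof (rule ntrans_eqI)
    show "is_ntrans UF SET (FAr yoneda (k \<cdot>\<^bsub>UF\<^esub> h))" using khH by (rule is_ntrans_yoneda)
    have "FAr yoneda h \<cdot>\<^bsub>UF_SET\<^esub> FAr yoneda k \<in> Hom UF_SET (hom_fctr R) (hom_fctr P)"
      by (rule category.cmp_hom[OF assms yoneda_Hom[OF kH] yoneda_Hom[OF hH]])
    then show "is_ntrans UF SET (FAr yoneda h \<cdot>\<^bsub>UF_SET\<^esub> FAr yoneda k)"
      unfolding Hom_def UF_SET_sel(2) by blast
    show "NDm (FAr yoneda (k \<cdot>\<^bsub>UF\<^esub> h)) = NDm (FAr yoneda h \<cdot>\<^bsub>UF_SET\<^esub> FAr yoneda k)"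
      "NCd (FAr yoneda (k \<cdot>\<^bsub>UF\<^esub> h)) = NCd (FAr yoneda h \<cdot>\<^bsub>UF_SET\<^esub> FAr yoneda k)"
      using khH kH hH by (simp_all add: Hom_def yoneda_sel)
    fix S :: "'v uf_ob" assume S: "S \<in> Ob UF"
    have "NAt (FAr yoneda (k \<cdot>\<^bsub>UF\<^esub> h)) S = NAt (FAr yoneda h) S \<cdot>\<^bsub>SET\<^esub> NAt (FAr yoneda k) S"
    proof (rule SET_eqI[OF yoneda_NAt_Hom[OF khH S] SET_cmp_Hom[OF yoneda_NAt_Hom[OF kH S] yoneda_NAt_Hom[OF hH S]]])
      fix a assume a: "a \<in> elts (hom_set R S)"
      obtain g where g: "ucont R S g" and ag: "a = germ_code R S g" using a by (rule hom_setE)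
      have "SDm (NAt (FAr yoneda k) S) = hom_set R S"
        using yoneda_NAt_Hom[OF kH S] by (simp add: Hom_SET)
      with a show "SFn (NAt (FAr yoneda (k \<cdot>\<^bsub>UF\<^esub> h)) S) a =
          SFn (NAt (FAr yoneda h) S \<cdot>\<^bsub>SET\<^esub> NAt (FAr yoneda k) S) a"
        by (simp add: SFn_cmp kv hu ag umor_comp[OF P Q R u v] yoneda_umor[OF Q R S v g]
            yoneda_umor[OF P Q S u ucont_comp[OF v g]] yoneda_umor[OF P R S ucont_comp[OF u v] g] comp_assoc)
    qed
    then show "NAt (FAr yoneda (k \<cdot>\<^bsub>UF\<^esub> h)) S = NAt (FAr yoneda h \<cdot>\<^bsub>UF_SET\<^esub> FAr yoneda k) S"
      using S by simp
  qed
qed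


section \<open>The functor integral is fully faithful\<close>

lemma ntrans_fctr: "is_ntrans C D t \<Longrightarrow> is_fctr C D (NDm t)" "is_ntrans C D t \<Longrightarrow> is_fctr C D (NCd t)"
  by (auto simp: is_ntrans_def)

lemma ntrans_NAt: "is_ntrans C D t \<Longrightarrow> A \<in> Ob C \<Longrightarrow> NAt t A \<in> Hom D (FOb (NDm t) A) (FOb (NCd t) A)"
  by (auto simp: is_ntrans_def)

lemma SET_eq_app:
  assumes "g \<cdot>\<^bsub>SET\<^esub> f = g' \<cdot>\<^bsub>SET\<^esub> f'" "x \<in> elts (SDm f)" "SDm f' = SDm f"
  shows "SFn g (SFn f x) = SFn g' (SFn f' x)"
  using assms by (metis SFn_cmp)

lemma ntrans_natural_app:
  assumes t: "is_ntrans C SET t" and f: "f \<in> Hom C A B" and C: "A \<in> Ob C" and x: "x \<in> elts (FOb (NDm t) A)"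
  shows "SFn (NAt t B) (SFn (FAr (NDm t) f) x) = SFn (FAr (NCd t) f) (SFn (NAt t A) x)"
proof (rule SET_eq_app)
  show "NAt t B \<cdot>\<^bsub>SET\<^esub> FAr (NDm t) f = FAr (NCd t) f \<cdot>\<^bsub>SET\<^esub> NAt t A"
    using t f by (auto simp: is_ntrans_def Hom_def)
  have "SDm (FAr (NDm t) f) = FOb (NDm t) A" "SDm (NAt t A) = FOb (NDm t) A"
    using fctr_Hom[OF ntrans_fctr(1)[OF t] f] ntrans_NAt[OF t C] by (simp_all add: Hom_SET)
  with x show "x \<in> elts (SDm (FAr (NDm t) f))" "SDm (NAt t A) = SDm (FAr (NDm t) f)" by simp_all
qed

lemma FC_sel [simp]:
  "Ob FC = {F. is_fctr SET SET F \<and> preserves_finite_coproducts SET SET F}"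
  "Dm FC = NDm" "Cd FC = NCd"
  by (simp_all add: FC_def full_subcat_def fctr_cat_def)

lemma One_FC: "One FC F = \<lparr>NDm = F, NCd = F, NAt = (\<lambda>A\<in>UNIV. One SET (FOb F A))\<rparr>"
  and Cmp_FC: "t \<cdot>\<^bsub>FC\<^esub> s = \<lparr>NDm = NDm s, NCd = NCd t, NAt = (\<lambda>A\<in>UNIV. NAt t A \<cdot>\<^bsub>SET\<^esub> NAt s A)\<rparr>"
  by (simp_all add: FC_def full_subcat_def fctr_cat_def)

lemma Ar_FC: "t \<in> Ar FC \<longleftrightarrow> is_ntrans SET SET t \<and> NDm t \<in> Ob FC \<and> NCd t \<in> Ob FC"
  by (auto simp: FC_def full_subcat_def fctr_cat_def is_ntrans_def)

lemma Hom_FC: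
  "t \<in> Hom FC F G \<longleftrightarrow> is_ntrans SET SET t \<and> NDm t = F \<and> NCd t = G \<and> F \<in> Ob FC \<and> G \<in> Ob FC"
  by (auto simp: Hom_def Ar_FC)

section \<open>Pushforwards and the elements of an integral\<close>

definition push_ob :: "'v::set_universe uf_ob \<Rightarrow> 'v \<Rightarrow> ('v \<Rightarrow> 'v) \<Rightarrow> 'v uf_ob" where
  "push_ob P Y f = (Y, pushforward (pts P) (elts Y) f (snd P))"

lemma fst_push_ob [simp]: "fst (push_ob P Y f) = Y"
  by (simp add: push_ob_def)

lemma uf_ae_push_ob:
  assumes "f \<in> pts P \<rightarrow> elts Y"
  shows "uf_ae (push_ob P Y f) \<phi> \<longleftrightarrow> uf_ae P (\<lambda>x. \<phi> (f x))"
proof -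
  have "{x \<in> pts P. f x \<in> {y \<in> elts Y. \<phi> y}} = {x \<in> pts P. \<phi> (f x)}" using assms by auto
  then show ?thesis by (auto simp: uf_ae_def push_ob_def pushforward_def)
qed

lemma push_ob_Ob:
  assumes "P \<in> Ob UF" "f \<in> pts P \<rightarrow> elts Y"
  shows "push_ob P Y f \<in> Ob UF"
proof (rule Ob_UF_I)
  show "snd (push_ob P Y f) \<subseteq> Pow (pts (push_ob P Y f))"
    by (auto simp: push_ob_def pushforward_def)
qed (simp_all add: uf_ae_push_ob assms uf_ae_conj uf_ae_not)

lemma ucont_push_ob: "f \<in> pts P \<rightarrow> elts Y \<Longrightarrow> ucont P (push_ob P Y f) f"
  by (simp add: ucont_def uf_ae_push_ob)

text \<open>Together with \<open>ucont_push_ob\<close>, this says that a map into a set is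
  continuous for exactly one ultrafilter on that set.\<close>

lemma push_ob_ucont:
  assumes "P \<in> Ob UF" "Q \<in> Ob UF" "ucont P Q f"
  shows "push_ob P (fst Q) f = Q"
proof -
  have f: "f \<in> pts P \<rightarrow> pts Q" using assms(3) by (simp add: ucont_def)
  show ?thesis
    by (rule uf_ob_eqI[OF push_ob_Ob[OF assms(1) f] assms(2)])
      (simp_all add: uf_ae_push_ob[OF f] ucont_ae[OF assms(3)])
qed

lemma push_ob_cong:
  assumes "P \<in> Ob UF" "f \<in> pts P \<rightarrow> elts Y" "\<And>x. x \<in> pts P \<Longrightarrow> f x = g x"
  shows "push_ob P Y f = push_ob P Y g"
proof -
  have g: "g \<in> pts P \<rightarrow> elts Y" using assms(2) by (simp add: Pi_iff flip: assms(3))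
  have "uf_ae P (\<lambda>x. \<phi> (f x)) = uf_ae P (\<lambda>x. \<phi> (g x))" for \<phi>
    by (rule uf_ae_cong) (simp add: assms(3))
  then show ?thesis
    by (intro uf_ob_eqI push_ob_Ob assms(1,2) g) (simp_all add: uf_ae_push_ob assms(2) g)
qed

lemma small_ultrafilter: "V \<subseteq> Pow (elts Y) \<Longrightarrow> small (vset ` V)" "V \<subseteq> Pow (elts Y) \<Longrightarrow> A \<in> V \<Longrightarrow> small A"
proof -
  assume V: "V \<subseteq> Pow (elts Y)"
  then show "A \<in> V \<Longrightarrow> small A" by (auto intro: small_subset[OF small_elts])
  from V have "small A" if "A \<in> V" for A using that by (auto intro: small_subset[OF small_elts])
  then have "vset ` V \<subseteq> {z. elts z \<subseteq> elts Y}" using V by (simp add: image_subset_iff PowD subset_iff[of V])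
  then show "small (vset ` V)" by (rule small_subset[rotated]) (intro small_power small_elts)
qed

lemma uf_decode_code:
  assumes "V \<subseteq> Pow (elts Y)"
  shows "uf_decode (uf_code V) = V"
proof -
  have "elts ` vset ` V = id ` V"
    unfolding image_image by (rule image_cong) (use small_ultrafilter(2)[OF assms] in auto)
  then show ?thesis using small_ultrafilter(1)[OF assms] by (simp add: uf_decode_def uf_code_def)
qed

text \<open>The element \<open>a\<close> of the summand at \<open>P\<close>. Only the ultrafilter is
  stored, the set \<open>fst P\<close> being the argument of the functor; hence the side condition
  \<open>fst P = fst Q\<close> in \<open>ielt_inject\<close>.\<close>

definition ielt :: "'v::set_universe uf_ob \<Rightarrow> 'v \<Rightarrow> 'v" where
  "ielt P a = vpair (uf_code (snd P)) a"

lemma snd_Pow: "P \<in> Ob UF \<Longrightarrow> snd P \<subseteq> Pow (pts P)"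
  by (simp add: Ob_UF ultrafilter_on_def)

lemma vsnd_ielt [simp]: "vsnd (ielt P a) = a"
  by (simp add: ielt_def)

lemma uf_decode_ielt: "P \<in> Ob UF \<Longrightarrow> uf_decode (vfst (ielt P a)) = snd P"
  by (simp add: ielt_def uf_decode_code[OF snd_Pow])

lemma ielt_inject:
  assumes "P \<in> Ob UF" "Q \<in> Ob UF" "fst P = fst Q"
  shows "ielt P a = ielt Q b \<longleftrightarrow> P = Q \<and> a = b"
  using assms uf_decode_ielt[of P a] uf_decode_ielt[of Q b] by (metis prod_eqI vsnd_ielt)

lemma elts_integral_set:
  "elts (integral_set B Y) = {ielt P a | P a. P \<in> Ob UF \<and> fst P = Y \<and> a \<in> elts (FOb B P)}"
proof -
  let ?S = "{vpair (uf_code V) a | V a. ultrafilter_on (elts Y) V \<and> a \<in> elts (FOb B (Y, V))}"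
  let ?C = "uf_code ` {V. ultrafilter_on (elts Y) V}"
  \<comment> \<open>An ultrafilter is coded by a set of subsets of \<open>Y\<close>, so the codes
    lie in a double power set.\<close>
  have "?C \<subseteq> {w. elts w \<subseteq> {z. elts z \<subseteq> elts Y}}"
  proof (intro image_subsetI CollectI subsetI)
    fix V z x assume "V \<in> {V. ultrafilter_on (elts Y) V}" and z: "z \<in> elts (uf_code V)" and x: "x \<in> elts z"
    then have V: "V \<subseteq> Pow (elts Y)" by (simp add: ultrafilter_on_def)
    from z obtain A where "A \<in> V" "z = vset A"
      using small_ultrafilter(1)[OF V] by (auto simp: uf_code_def)
    with V x small_ultrafilter(2)[OF V] show "x \<in> elts Y" by auto
  qed
  then have "small ?C" by (rule small_subset[rotated]) (intro small_power small_elts)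
  \<comment> \<open>Decoding the index turns the sum into a union over a small set of codes, which
    is the form that \<open>small_UN\<close> accepts.\<close>
  then have "small (\<Union>c\<in>?C. vpair c ` elts (FOb B (Y, uf_decode c)))"
    by (intro small_UN small_image small_elts)
  moreover have "?S = (\<Union>c\<in>?C. vpair c ` elts (FOb B (Y, uf_decode c)))"
  proof -
    have "uf_decode (uf_code V) = V" if "ultrafilter_on (elts Y) V" for V
      using that by (intro uf_decode_code[of V Y]) (simp add: ultrafilter_on_def)
    then show ?thesis by (auto simp: image_iff Bex_def)
  qed
  ultimately have "elts (integral_set B Y) = ?S" by (simp add: integral_set_def)
  also have "\<dots> = {ielt P a | P a. P \<in> Ob UF \<and> fst P = Y \<and> a \<in> elts (FOb B P)}"
    by (auto simp: ielt_def Ob_UF)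
  finally show ?thesis .
qed

lemma integral_setE:
  assumes "p \<in> elts (integral_set B Y)"
  obtains P a where "P \<in> Ob UF" "fst P = Y" "a \<in> elts (FOb B P)" "p = ielt P a"
  using assms unfolding elts_integral_set by blast

lemma ielt_mem: "P \<in> Ob UF \<Longrightarrow> fst P = Y \<Longrightarrow> a \<in> elts (FOb B P) \<Longrightarrow> ielt P a \<in> elts (integral_set B Y)"
  unfolding elts_integral_set by blast

lemma integral_fctr_ielt:
  assumes f: "f \<in> Hom SET X Y" and P: "P \<in> Ob UF" "fst P = X" and a: "a \<in> elts (FOb B P)"
  shows "SFn (FAr (integral_fctr B) f) (ielt P a) =
    ielt (push_ob P Y (SFn f)) (SFn (FAr B (umor P (push_ob P Y (SFn f)) (SFn f))) a)"
proof -
  have fA: "f \<in> Ar SET" "SDm f = X" "SCd f = Y" using f by (auto simp: Hom_def)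
  have pm: "push_mor f (snd P) = umor P (push_ob P Y (SFn f)) (SFn f)"
    using fA P(2) by (simp add: push_mor_def umor_def push_ob_def set_push_def) (metis prod.collapse)
  have "set_push f (snd P) = snd (push_ob P Y (SFn f))"
    using fA P(2) by (simp add: push_ob_def set_push_def)
  then show ?thesis
    using fA ielt_mem[of P X a B] P a
    by (simp add: integral_fctr_def Let_def uf_decode_ielt pm) (simp add: ielt_def)
qed

text \<open>A function moves the summand at \<open>P\<close> to the summand at the pushforward. If
  it agrees on the points with a map continuous into \<open>Q\<close>, the pushforward is
  \<open>Q\<close>, and the result can be stated without mentioning it.\<close>

lemma integral_fctr_ielt':
  assumes f: "f \<in> Hom SET X Y" and P: "P \<in> Ob UF" "fst P = X" and Q: "Q \<in> Ob UF" "fst Q = Y"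
    and g: "ucont P Q g" "\<And>x. x \<in> elts X \<Longrightarrow> SFn f x = g x"
    and a: "a \<in> elts (FOb B P)"
  shows "SFn (FAr (integral_fctr B) f) (ielt P a) = ielt Q (SFn (FAr B (umor P Q g)) a)"
proof -
  have "SFn f \<in> pts P \<rightarrow> elts Y" using f P(2) by (auto simp: Hom_SET)
  then have "push_ob P Y (SFn f) = push_ob P Y g"
    by (rule push_ob_cong[OF P(1)]) (simp add: P g)
  also have "\<dots> = Q" using push_ob_ucont[OF P(1) Q(1) g(1)] Q(2) by simp
  finally have pQ: "push_ob P Y (SFn f) = Q" .
  have "umor P Q (SFn f) = umor P Q g" by (rule umor_cong[OF P(1)]) (simp add: P g)
  then show ?thesis by (simp add: integral_fctr_ielt[OF f P a] pQ)
qed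

lemma integral_sel:
  "is_fctr UF SET B \<Longrightarrow> FOb integral B = integral_fctr B"
  "is_ntrans UF SET t \<Longrightarrow> NDm (FAr integral t) = integral_fctr (NDm t)"
  "is_ntrans UF SET t \<Longrightarrow> NCd (FAr integral t) = integral_fctr (NCd t)"
  "FOb (integral_fctr B) Y = integral_set B Y"
  by (simp_all add: integral_def integral_fctr_def)

lemma integral_ielt:
  assumes "is_ntrans UF SET t" "P \<in> Ob UF" "fst P = Y" "a \<in> elts (FOb (NDm t) P)"
  shows "SFn (NAt (FAr integral t) Y) (ielt P a) = ielt P (SFn (NAt t P) a)"
proof -
  have "(Y, snd P) = P" using assms(3) by auto
  then show ?thesis
    using assms ielt_mem[of P Y a "NDm t"]
    by (simp add: integral_def uf_decode_ielt) (simp add: ielt_def)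
qed

text \<open>The image of a transformation acts summand by summand, so each component
  \<open>NAt t P\<close> can be recovered from the action on the summand at
  \<open>P\<close>.\<close>

lemma integral_faithful:
  assumes s: "s \<in> Hom UF_SET A B" and t: "t \<in> Hom UF_SET A B" and eq: "FAr integral s = FAr integral t"
  shows "s = t"
proof -
  have s': "is_ntrans UF SET s" "NDm s = A" "NCd s = B" and t': "is_ntrans UF SET t" "NDm t = A" "NCd t = B"
    using s t by (simp_all add: Hom_def)
  show ?thesis
  proof (rule ntrans_eqI[OF s'(1) t'(1)])
    fix P :: "'a uf_ob" assume P: "P \<in> Ob UF"
    show "NAt s P = NAt t P"
    proof (rule SET_eqI)
      show "NAt s P \<in> Hom SET (FOb A P) (FOb B P)" "NAt t P \<in> Hom SET (FOb A P) (FOb B P)"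
        using ntrans_NAt[OF s'(1) P] ntrans_NAt[OF t'(1) P] s' t' by simp_all
      fix a assume a: "a \<in> elts (FOb A P)"
      then have "ielt P (SFn (NAt s P) a) = ielt P (SFn (NAt t P) a)"
        using integral_ielt[OF s'(1) P refl, of a] integral_ielt[OF t'(1) P refl, of a] eq s' t' by simp
      then show "SFn (NAt s P) a = SFn (NAt t P) a" using P by (simp add: ielt_inject)
    qed
  qed (simp_all add: s' t')
qed

text \<open>If \<open>\<phi>\<close> fails for \<open>P\<close>, its negation holds for
  \<open>P\<close>, hence for \<open>Q\<close>, and so \<open>\<phi>\<close> fails for
  \<open>Q\<close>.\<close>

lemma ultrafilter_maximal:
  assumes P: "P \<in> Ob UF" and Q: "Q \<in> Ob UF" and fst: "fst P = fst Q" and sub: "snd P \<subseteq> snd Q"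
  shows "P = Q"
proof (rule uf_ob_eqI[OF P Q fst])
  have imp: "uf_ae Q \<psi>" if "uf_ae P \<psi>" for \<psi>
    using that sub fst by (auto simp: uf_ae_def)
  show "uf_ae P \<phi> \<longleftrightarrow> uf_ae Q \<phi>" for \<phi>
    using imp[of \<phi>] imp[of "\<lambda>x. \<not> \<phi> x"] uf_ae_not[OF P, of \<phi>] uf_ae_not[OF Q, of \<phi>] by argo
qed

text \<open>Every \<open>W \<in> V\<close> supports \<open>V\<close>, so an element over \<open>V\<close> comes from \<open>W\<close>; by naturality so does its image,
  which hence lies over an ultrafilter containing \<open>W\<close>.\<close>

lemma integral_ntrans_index:
  assumes s: "is_ntrans SET SET s" "NDm s = integral_fctr A" "NCd s = integral_fctr B"
    and A: "is_fctr UF SET A" and P: "P \<in> Ob UF" and a: "a \<in> elts (FOb A P)"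
  obtains b where "b \<in> elts (FOb B P)" "SFn (NAt s (fst P)) (ielt P a) = ielt P b"
proof -
  have sY: "SFn (NAt s Y) p \<in> elts (integral_set B Y)" if "p \<in> elts (integral_set A Y)" for Y p
    using SFn_app[OF ntrans_NAt[OF s(1), of Y], of p] that by (simp add: s integral_sel)
  obtain Q b where Q: "Q \<in> Ob UF" "fst Q = fst P" and b: "b \<in> elts (FOb B Q)"
    and sQ: "SFn (NAt s (fst P)) (ielt P a) = ielt Q b"
    using sY[OF ielt_mem[OF P refl a]] by (rule integral_setE)
  have "W \<in> snd Q" if W: "W \<in> snd P" for W
  proof -
    have Wsub: "W \<subseteq> pts P" by (rule snd_subset[OF P W])
    have aeW: "uf_ae P (\<lambda>x. x \<in> W)" using W mem_snd[OF P Wsub] by simp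
    then have "W \<noteq> {}" using P by auto
    then obtain w0 where w0: "w0 \<in> W" by auto
    define w where "w = vset W"
    have w: "elts w = W" unfolding w_def by (rule elts_vset[OF small_subset[OF small_elts Wsub]])
    \<comment> \<open>\<open>r\<close> retracts onto \<open>W\<close>, with \<open>w0\<close> as its
      value elsewhere. As \<open>W\<close> belongs to the ultrafilter, \<open>r\<close> is the
      identity almost everywhere, so passing to the pushforward \<open>?P'\<close> on
      \<open>W\<close> and back is the identity class.\<close>
    define r where "r x = (if x \<in> W then x else w0)" for x
    have r: "r \<in> pts P \<rightarrow> elts w" using w0 by (simp add: r_def w)
    let ?P' = "push_ob P w r"
    have P': "?P' \<in> Ob UF" by (rule push_ob_Ob[OF P r])
    have ur: "ucont P ?P' r" by (rule ucont_push_ob[OF r])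
    have aer: "uf_ae P (\<lambda>x. r x = x)" using aeW by (rule uf_ae_mono[OF P]) (simp add: r_def)
    have ui: "ucont ?P' P id"
      unfolding ucont_def
    proof (intro conjI allI)
      show "id \<in> pts ?P' \<rightarrow> pts P" using Wsub by (auto simp: w)
      fix \<phi>
      have "uf_ae P \<phi> \<longleftrightarrow> uf_ae P (\<lambda>x. \<phi> (r x))"
        using uf_ae_mono2[OF P aer, of \<phi> "\<lambda>x. \<phi> (r x)"] uf_ae_mono2[OF P aer, of "\<lambda>x. \<phi> (r x)" \<phi>] by auto
      then show "uf_ae P \<phi> \<longleftrightarrow> uf_ae ?P' (\<lambda>x. \<phi> (id x))" by (simp add: uf_ae_push_ob[OF r])
    qed
    define i where "i = \<lparr>SDm = w, SCd = fst P, SFn = (\<lambda>x\<in>elts w. x)\<rparr>"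
    have i: "i \<in> Hom SET w (fst P)" unfolding i_def by (rule Hom_SET_I) (use Wsub in \<open>auto simp: w\<close>)
    have rH: "umor P ?P' r \<in> Hom UF P ?P'" and iH: "umor ?P' P id \<in> Hom UF ?P' P"
      by (rule umor_Hom[OF P P' ur] umor_Hom[OF P' P ui])+
    define a' where "a' = SFn (FAr A (umor P ?P' r)) a"
    have a': "a' \<in> elts (FOb A ?P')" unfolding a'_def by (rule SFn_app[OF fctr_Hom[OF A rH] a])
    \<comment> \<open>\<open>a'\<close> plays the part of \<open>a\<close> restricted to
      \<open>W\<close>; including it back gives \<open>a\<close>, since \<open>id \<circ> r\<close>
      represents the identity class.\<close>
    have "SFn (FAr A (umor ?P' P id)) a' = SFn (FAr A (umor ?P' P id) \<cdot>\<^bsub>SET\<^esub> FAr A (umor P ?P' r)) a"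
      using fctr_Hom[OF A rH] a by (simp add: SFn_cmp Hom_SET a'_def)
    also have "\<dots> = SFn (FAr A (umor P P (id \<circ> r))) a"
      by (simp only: fctr_cmp[OF A rH iH, symmetric] umor_comp[OF P P' P ur ui])
    also have "umor P P (id \<circ> r) = One UF P"
      unfolding One_UF using umor_eq_iff[OF P P ucont_comp[OF ur ui] ucont_id] aer by simp
    also have "SFn (FAr A (One UF P)) a = a"
      using a by (simp add: fctr_One[OF A P])
    finally have "SFn (FAr (integral_fctr A) i) (ielt ?P' a') = ielt P a"
      by (subst integral_fctr_ielt'[OF i P' _ P refl ui _ a']) (simp_all add: i_def flip: id_def)
    moreover have "SFn (NAt s (fst P)) (SFn (FAr (integral_fctr A) i) (ielt ?P' a')) =
        SFn (FAr (integral_fctr B) i) (SFn (NAt s w) (ielt ?P' a'))"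
      using ntrans_natural_app[OF s(1) i, of "ielt ?P' a'"] ielt_mem[OF P' _ a', of w] by (simp add: s integral_sel)
    moreover obtain Q' b' where Q': "Q' \<in> Ob UF" "fst Q' = w" "b' \<in> elts (FOb B Q')"
      and "SFn (NAt s w) (ielt ?P' a') = ielt Q' b'"
      using sY[OF ielt_mem[OF P' _ a']] by (rule integral_setE) simp_all
    ultimately have "ielt Q b = ielt (push_ob Q' (fst P) (SFn i))
        (SFn (FAr B (umor Q' (push_ob Q' (fst P) (SFn i)) (SFn i))) b')"
      using integral_fctr_ielt[OF i Q'] sQ by simp
    moreover have im: "SFn i \<in> pts Q' \<rightarrow> pts P" using i Q'(2) by (auto simp: Hom_SET)
    ultimately have "Q = push_ob Q' (fst P) (SFn i)"
      using ielt_inject[OF Q(1) push_ob_Ob[OF Q'(1) im]] Q(2) by simp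
    moreover have "uf_ae Q' (\<lambda>x. SFn i x \<in> W)"
      by (rule uf_ae_I[OF Q'(1)]) (simp add: i_def Q'(2) w)
    ultimately have "uf_ae Q (\<lambda>x. x \<in> W)" by (simp add: uf_ae_push_ob[OF im])
    then show "W \<in> snd Q" using mem_snd[OF Q(1), of W] Wsub Q(2) by simp
  qed
  then have "P = Q" by (intro ultrafilter_maximal P Q(1)) (use Q(2) in auto)
  with b sQ that show ?thesis by blast
qed

text \<open>Since the index is preserved, \<open>s\<close> restricts to each summand, and this gives
  the candidate components. An arrow of \<open>UF\<close> is induced by a function on the underlying
  sets; naturality of \<open>s\<close> for that function, read on the summand at the domain, is
  naturality for the arrow.\<close>

lemma integral_full:
  fixes A B :: "'v::set_universe uf_fctr"
  assumes int: "is_fctr UF_SET FC (integral :: ('v uf_fctr, _, _, _) fctr)"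
    and A: "A \<in> Ob UF_SET" and B: "B \<in> Ob UF_SET"
    and s: "s \<in> Hom FC (FOb integral A) (FOb integral B)"
  obtains t where "t \<in> Hom UF_SET A B" "FAr integral t = s"
proof -
  have A': "is_fctr UF SET A" and B': "is_fctr UF SET B" using A B by simp_all
  have s': "is_ntrans SET SET s" "NDm s = integral_fctr A" "NCd s = integral_fctr B"
    using s A' B' by (simp_all add: Hom_FC integral_sel)
  \<comment> \<open>By \<open>integral_ntrans_index\<close> the value lies over \<open>P\<close>
    again, so its second component is the required element.\<close>
  define t where "t = \<lparr>NDm = A, NCd = B, NAt = (\<lambda>P\<in>Ob UF. \<lparr>SDm = FOb A P, SCd = FOb B P,
    SFn = (\<lambda>a\<in>elts (FOb A P). vsnd (SFn (NAt s (fst P)) (ielt P a)))\<rparr>)\<rparr>"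
  have key: "SFn (NAt t P) a \<in> elts (FOb B P)" "SFn (NAt s (fst P)) (ielt P a) = ielt P (SFn (NAt t P) a)"
    if P: "P \<in> Ob UF" and a: "a \<in> elts (FOb A P)" for P a
  proof -
    obtain b where "b \<in> elts (FOb B P)" "SFn (NAt s (fst P)) (ielt P a) = ielt P b"
      using integral_ntrans_index[OF s' A' P a] .
    then show "SFn (NAt t P) a \<in> elts (FOb B P)" "SFn (NAt s (fst P)) (ielt P a) = ielt P (SFn (NAt t P) a)"
      using P a by (simp_all add: t_def)
  qed
  have tsel: "NDm t = A" "NCd t = B" by (simp_all add: t_def)
  have tH: "NAt t P \<in> Hom SET (FOb A P) (FOb B P)" if P: "P \<in> Ob UF" for P
    using key(1)[OF P] P by (auto simp: t_def Hom_SET)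
  have t: "is_ntrans UF SET t"
    unfolding is_ntrans_def
  proof (intro conjI ballI)
    fix k :: "'v uf_ar" assume "k \<in> Ar UF"
    then obtain P Q f where P: "P \<in> Ob UF" and Q: "Q \<in> Ob UF" and f: "ucont P Q f" and kf: "k = umor P Q f"
      by (rule Ar_UF_E)
    have kH: "k \<in> Hom UF P Q" unfolding kf by (rule umor_Hom[OF P Q f])
    \<comment> \<open>Arrows of \<open>SET\<close> are extensional, so the total map
      \<open>f\<close> is restricted to the points of \<open>P\<close>.\<close>
    define f' where "f' = \<lparr>SDm = fst P, SCd = fst Q, SFn = (\<lambda>x\<in>pts P. f x)\<rparr>"
    have f': "f' \<in> Hom SET (fst P) (fst Q)"
      unfolding f'_def by (rule Hom_SET_I) (rule ucont_app[OF f])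
    have f'x: "SFn f' x = f x" if "x \<in> pts P" for x using that by (simp add: f'_def)
    have "NAt t Q \<cdot>\<^bsub>SET\<^esub> FAr A k = FAr B k \<cdot>\<^bsub>SET\<^esub> NAt t P"
    proof (rule SET_eqI[OF SET_cmp_Hom[OF fctr_Hom[OF A' kH] tH[OF Q]] SET_cmp_Hom[OF tH[OF P] fctr_Hom[OF B' kH]]])
      fix a assume a: "a \<in> elts (FOb A P)"
      have Aa: "SFn (FAr A k) a \<in> elts (FOb A Q)" by (rule SFn_app[OF fctr_Hom[OF A' kH] a])
      have "ielt Q (SFn (NAt t Q) (SFn (FAr A k) a)) = SFn (NAt s (fst Q)) (ielt Q (SFn (FAr A k) a))"
        using key(2)[OF Q Aa] by simp
      also have "\<dots> = SFn (NAt s (fst Q)) (SFn (FAr (integral_fctr A) f') (ielt P a))"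
        using integral_fctr_ielt'[OF f' P refl Q refl f f'x a] by (simp add: kf)
      also have "\<dots> = SFn (FAr (integral_fctr B) f') (SFn (NAt s (fst P)) (ielt P a))"
        using ntrans_natural_app[OF s'(1) f', of "ielt P a"] ielt_mem[OF P refl a] by (simp add: s' integral_sel)
      also have "\<dots> = ielt Q (SFn (FAr B k) (SFn (NAt t P) a))"
        using integral_fctr_ielt'[OF f' P refl Q refl f f'x key(1)[OF P a]] key(2)[OF P a] by (simp add: kf)
      finally have "SFn (NAt t Q) (SFn (FAr A k) a) = SFn (FAr B k) (SFn (NAt t P) a)"
        using Q by (simp add: ielt_inject)
      then show "SFn (NAt t Q \<cdot>\<^bsub>SET\<^esub> FAr A k) a = SFn (FAr B k \<cdot>\<^bsub>SET\<^esub> NAt t P) a"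
        using a fctr_Hom[OF A' kH] tH[OF P] by (simp add: SFn_cmp Hom_SET)
    qed
    then show "NAt t (Cd UF k) \<cdot>\<^bsub>SET\<^esub> FAr (NDm t) k = FAr (NCd t) k \<cdot>\<^bsub>SET\<^esub> NAt t (Dm UF k)"
      by (simp add: tsel kf)
  qed (use A' B' tH in \<open>simp_all add: tsel\<close>, simp add: t_def)
  have tHom: "t \<in> Hom UF_SET A B" using t by (simp add: Hom_def tsel)
  have "FAr integral t = s"
  proof (rule ntrans_eqI[OF _ s'(1)])
    have It: "FAr integral t \<in> Hom FC (integral_fctr A) (integral_fctr B)"
      using fctr_Hom[OF int tHom] A' B' by (simp add: integral_sel)
    then show It': "is_ntrans SET SET (FAr integral t)" by (simp add: Hom_FC)
    show "NDm (FAr integral t) = NDm s" "NCd (FAr integral t) = NCd s"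
      using It s' by (simp_all add: Hom_FC)
    fix Y :: 'v
    show "NAt (FAr integral t) Y = NAt s Y"
    proof (rule SET_eqI)
      show "NAt (FAr integral t) Y \<in> Hom SET (integral_set A Y) (integral_set B Y)"
        "NAt s Y \<in> Hom SET (integral_set A Y) (integral_set B Y)"
        using ntrans_NAt[OF It', of Y] ntrans_NAt[OF s'(1), of Y] It s' by (simp_all add: Hom_FC integral_sel)
      fix p assume "p \<in> elts (integral_set A Y)"
      then obtain P a where P: "P \<in> Ob UF" "fst P = Y" and a: "a \<in> elts (FOb A P)" and p: "p = ielt P a"
        by (rule integral_setE)
      show "SFn (NAt (FAr integral t) Y) p = SFn (NAt s Y) p"
        using integral_ielt[OF t P] key(2)[OF P(1) a] a P(2) by (simp add: p tsel)
    qed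
  qed
  with tHom that show ?thesis by blast
qed


section \<open>Ultrapowers\<close>

lemma Hom_FC_eqI:
  assumes s: "s \<in> Hom FC F G" and t: "t \<in> Hom FC F G"
    and eq: "\<And>Y p. p \<in> elts (FOb F Y) \<Longrightarrow> SFn (NAt s Y) p = SFn (NAt t Y) p"
  shows "s = t"
proof (rule ntrans_eqI)
  show s': "is_ntrans SET SET s" and t': "is_ntrans SET SET t" using s t by (simp_all add: Hom_FC)
  show "NDm s = NDm t" "NCd s = NCd t" using s t by (simp_all add: Hom_FC)
  show "NAt s Y = NAt t Y" for Y
  proof (rule SET_eqI)
    show "NAt s Y \<in> Hom SET (FOb F Y) (FOb G Y)" "NAt t Y \<in> Hom SET (FOb F Y) (FOb G Y)"
      using ntrans_NAt[OF s', of Y] ntrans_NAt[OF t', of Y] s t by (simp_all add: Hom_FC)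
  qed (rule eq)
qed

lemma Hom_FC_NAt: "t \<in> Hom FC F G \<Longrightarrow> NAt t Y \<in> Hom SET (FOb F Y) (FOb G Y)"
  using ntrans_NAt[of SET SET t Y] by (auto simp: Hom_FC)

lemma Hom_FC_app: "t \<in> Hom FC F G \<Longrightarrow> p \<in> elts (FOb F Y) \<Longrightarrow> SFn (NAt t Y) p \<in> elts (FOb G Y)"
  by (rule SFn_app[OF Hom_FC_NAt])

lemma FC_cmp_app:
  "s \<in> Hom FC F G \<Longrightarrow> p \<in> elts (FOb F Y) \<Longrightarrow> SFn (NAt (t \<cdot>\<^bsub>FC\<^esub> s) Y) p = SFn (NAt t Y) (SFn (NAt s Y) p)"
  using Hom_FC_NAt[of s F G Y] by (simp add: Cmp_FC SFn_cmp Hom_SET)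

lemma FC_one_app: "p \<in> elts (FOb F Y) \<Longrightarrow> SFn (NAt (One FC F) Y) p = p"
  by (simp add: One_FC)

lemma comp_fctr_SET_sel [simp]:
  "FOb (comp_fctr SET F G) Y = FOb F (FOb G Y)"
  "k \<in> Ar SET \<Longrightarrow> FAr (comp_fctr SET F G) k = FAr F (FAr G k)"
  by (simp_all add: comp_fctr_def)

lemma id_fctr_SET_sel [simp]: "FOb (id_fctr SET) Y = Y" "k \<in> Ar SET \<Longrightarrow> FAr (id_fctr SET) k = k"
  by (simp_all add: id_fctr_def)

lemma composition_monoidal_sel:
  "TOb (composition_monoidal SET) = comp_fctr SET"
  "Unit (composition_monoidal SET) = id_fctr SET"
  "Asc (composition_monoidal SET) F G H = One FC (comp_fctr SET F (comp_fctr SET G H))"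
  "Lun (composition_monoidal SET) = One FC"
  "Run (composition_monoidal SET) = One FC"
  by (simp_all add: composition_monoidal_def FC_def full_subcat_def)

lemma FC_tensor_app:
  assumes "s \<in> Hom FC F F'" "t \<in> Hom FC G G'" "p \<in> elts (FOb F (FOb G Y))"
  shows "SFn (NAt (TAr (composition_monoidal SET) s t) Y) p = SFn (NAt s (FOb G' Y)) (SFn (FAr F (NAt t Y)) p)"
proof -
  have "FAr F (NAt t Y) \<in> Hom SET (FOb F (FOb G Y)) (FOb F (FOb G' Y))"
    using assms(1) Hom_FC_NAt[OF assms(2), of Y] by (intro fctr_Hom[of SET SET]) (auto simp: Hom_FC)
  then show ?thesis using assms by (simp add: composition_monoidal_def SFn_cmp Hom_SET Hom_FC)
qed

lemma FC_tensor_one_right_app: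
  assumes "s \<in> Hom FC F F'" "G \<in> Ob FC" "p \<in> elts (FOb F (FOb G Y))"
  shows "SFn (NAt (TAr (composition_monoidal SET) s (One FC G)) Y) p = SFn (NAt s (FOb G Y)) p"
proof -
  have "FAr F (One SET (FOb G Y)) = One SET (FOb F (FOb G Y))"
    using assms(1) by (intro fctr_One[of SET SET]) (auto simp: Hom_FC)
  moreover have "FAr F (One SET (FOb G Y)) \<in> Hom SET (FOb F (FOb G Y)) (FOb F (FOb G Y))"
    using calculation category.one_hom[OF category_SET, of "FOb F (FOb G Y)"] by simp
  ultimately show ?thesis using assms
    by (simp add: composition_monoidal_def One_FC SFn_cmp Hom_SET Hom_FC)
qed

text \<open>The inverse bijections form a natural transformation: apply \<open>t\<close> to the
  square to be proved, use naturality of \<open>t\<close>, and cancel by injectivity.\<close>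

lemma FC_iso:
  assumes FC: "category (FC :: ('v::set_universe endo, 'v endo_trans) cat)"
    and t: "t \<in> Hom FC F (G :: 'v endo)"
    and bij: "\<And>Y. bij_betw (SFn (NAt t Y)) (elts (FOb F Y)) (elts (FOb G Y))"
  shows "iso FC t"
proof -
  have t': "is_ntrans SET SET t" "NDm t = F" "NCd t = G" "F \<in> Ob FC" "G \<in> Ob FC"
    using t by (simp_all add: Hom_FC)
  have FG: "is_fctr SET SET F" "is_fctr SET SET G" using t'(4,5) by simp_all
  let ?i = "\<lambda>Y. inv_into (elts (FOb F Y)) (SFn (NAt t Y))"
  define s where "s = \<lparr>NDm = G, NCd = F, NAt = (\<lambda>Y. \<lparr>SDm = FOb G Y, SCd = FOb F Y,
    SFn = (\<lambda>y\<in>elts (FOb G Y). ?i Y y)\<rparr>)\<rparr>"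
  have sapp: "SFn (NAt s Y) y = ?i Y y" if "y \<in> elts (FOb G Y)" for Y y
    using that by (simp add: s_def)
  have im: "?i Y y \<in> elts (FOb F Y)" "SFn (NAt t Y) (?i Y y) = y" if "y \<in> elts (FOb G Y)" for Y y
    using that bij[of Y] by (auto simp: bij_betw_def inv_into_into f_inv_into_f)
  have sel: "NDm s = G" "NCd s = F" by (simp_all add: s_def)
  have sH: "NAt s Y \<in> Hom SET (FOb G Y) (FOb F Y)" for Y
    unfolding s_def by (simp, rule Hom_SET_I) (rule im(1))
  have "is_ntrans SET SET s"
    unfolding is_ntrans_def
  proof (intro conjI ballI)
    fix k :: "'v set_ar" assume "k \<in> Ar SET"
    then have k: "k \<in> Hom SET (SDm k) (SCd k)" by (simp add: Hom_def)
    let ?Y = "SDm k" and ?Z = "SCd k"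
    have "NAt s ?Z \<cdot>\<^bsub>SET\<^esub> FAr G k = FAr F k \<cdot>\<^bsub>SET\<^esub> NAt s ?Y"
    proof (rule SET_eqI[OF SET_cmp_Hom[OF fctr_Hom[OF FG(2) k] sH] SET_cmp_Hom[OF sH fctr_Hom[OF FG(1) k]]])
      fix y assume y: "y \<in> elts (FOb G ?Y)"
      have Gy: "SFn (FAr G k) y \<in> elts (FOb G ?Z)" by (rule SFn_app[OF fctr_Hom[OF FG(2) k] y])
      have Fy: "SFn (FAr F k) (?i ?Y y) \<in> elts (FOb F ?Z)"
        by (rule SFn_app[OF fctr_Hom[OF FG(1) k] im(1)[OF y]])
      have "SFn (NAt t ?Z) (SFn (FAr F k) (?i ?Y y)) = SFn (FAr G k) y"
        using ntrans_natural_app[OF t'(1) k, of "?i ?Y y"] im[OF y] by (simp add: t')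
      then have "?i ?Z (SFn (FAr G k) y) = SFn (FAr F k) (?i ?Y y)"
        using Fy bij[of ?Z] by (metis bij_betw_inv_into_left)
      then show "SFn (NAt s ?Z \<cdot>\<^bsub>SET\<^esub> FAr G k) y = SFn (FAr F k \<cdot>\<^bsub>SET\<^esub> NAt s ?Y) y"
        using fctr_Hom[OF FG(2) k] sH[of ?Y] y Gy by (simp add: SFn_cmp Hom_SET sapp)
    qed
    then show "NAt s (Cd SET k) \<cdot>\<^bsub>SET\<^esub> FAr (NDm s) k = FAr (NCd s) k \<cdot>\<^bsub>SET\<^esub> NAt s (Dm SET k)"
      by (simp add: sel)
  qed (use FG sH in \<open>simp_all add: sel\<close>)
  then have s: "s \<in> Hom FC G F" using t'(4,5) by (simp add: Hom_FC sel)
  have "s \<cdot>\<^bsub>FC\<^esub> t = One FC F"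
  proof (rule Hom_FC_eqI[OF category.cmp_hom[OF FC t s] category.one_hom[OF FC t'(4)]])
    fix Y x assume x: "x \<in> elts (FOb F Y)"
    then show "SFn (NAt (s \<cdot>\<^bsub>FC\<^esub> t) Y) x = SFn (NAt (One FC F) Y) x"
      using Hom_FC_app[OF t x] bij_betw_inv_into_left[OF bij x] by (simp add: FC_cmp_app[OF t] FC_one_app sapp)
  qed
  moreover have "t \<cdot>\<^bsub>FC\<^esub> s = One FC G"
  proof (rule Hom_FC_eqI[OF category.cmp_hom[OF FC s t] category.one_hom[OF FC t'(5)]])
    fix Y x assume x: "x \<in> elts (FOb G Y)"
    then show "SFn (NAt (t \<cdot>\<^bsub>FC\<^esub> s) Y) x = SFn (NAt (One FC G) Y) x"
      using im(2)[OF x] by (simp add: FC_cmp_app[OF s] FC_one_app sapp)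
  qed
  ultimately have "inverse_pair FC t s"
    using s t by (simp add: inverse_pair_def Hom_def)
  then show ?thesis unfolding iso_def ..
qed

section \<open>Ultrapowers and their elements\<close>

definition upow :: "'v::set_universe uf_ob \<Rightarrow> 'v endo" where
  "upow P = integral_fctr (hom_fctr P)"

text \<open>The element of the ultrapower represented by \<open>f\<close>. The index is forced to be
  the pushforward of \<open>P\<close>, so a map into \<open>Y\<close> is all the data
  needed.\<close>

definition uelt :: "'v::set_universe uf_ob \<Rightarrow> 'v \<Rightarrow> ('v \<Rightarrow> 'v) \<Rightarrow> 'v" where
  "uelt P Y f = ielt (push_ob P Y f) (germ_code P (push_ob P Y f) f)"

lemma uelt_mem:
  assumes "P \<in> Ob UF" "f \<in> pts P \<rightarrow> elts Y"
  shows "uelt P Y f \<in> elts (FOb (upow P) Y)"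
  unfolding uelt_def upow_def integral_sel
  using push_ob_Ob[OF assms] by (intro ielt_mem) (simp_all add: hom_fctr_sel germ_code_mem assms ucont_push_ob)

lemma uelt_E:
  assumes "P \<in> Ob UF" "p \<in> elts (FOb (upow P) Y)"
  obtains f where "f \<in> pts P \<rightarrow> elts Y" "p = uelt P Y f"
proof -
  obtain Q a where Q: "Q \<in> Ob UF" "fst Q = Y" and a: "a \<in> elts (FOb (hom_fctr P) Q)" and p: "p = ielt Q a"
    using assms(2) unfolding upow_def integral_sel by (rule integral_setE)
  from a Q have "a \<in> elts (hom_set P Q)" by (simp add: hom_fctr_sel)
  then obtain f where f: "ucont P Q f" and a: "a = germ_code P Q f" by (rule hom_setE)
  have "push_ob P Y f = Q" using push_ob_ucont[OF assms(1) Q(1) f] Q(2) by simp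
  then have "p = uelt P Y f" by (simp add: uelt_def p a)
  moreover have "f \<in> pts P \<rightarrow> elts Y" using f Q(2) by (simp add: ucont_def)
  ultimately show ?thesis by (rule that[rotated])
qed

text \<open>Maps that agree almost everywhere have the same pushforward and so lie in the same
  summand; there equality of germs decides.\<close>

lemma uelt_eq_iff:
  assumes P: "P \<in> Ob UF" and f: "f \<in> pts P \<rightarrow> elts Y" and g: "g \<in> pts P \<rightarrow> elts Y"
  shows "uelt P Y f = uelt P Y g \<longleftrightarrow> uf_ae P (\<lambda>x. f x = g x)"
proof
  let ?Q = "push_ob P Y f"
  have Q: "?Q \<in> Ob UF" and Q': "push_ob P Y g \<in> Ob UF" by (rule push_ob_Ob[OF P f] push_ob_Ob[OF P g])+
  {
    assume "uelt P Y f = uelt P Y g"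
    then have "?Q = push_ob P Y g \<and> germ_code P ?Q f = germ_code P (push_ob P Y g) g"
      unfolding uelt_def by (rule iffD1[OF ielt_inject[OF Q Q'], rotated]) simp
    then have eq: "?Q = push_ob P Y g" and "germ_code P ?Q f = germ_code P (push_ob P Y g) g" by blast+
    then have eq2: "germ_code P ?Q f = germ_code P ?Q g" by (subst eq) (simp only: eq)
    have "ucont P ?Q g" unfolding eq by (rule ucont_push_ob[OF g])
    then show "uf_ae P (\<lambda>x. f x = g x)"
      using germ_code_eq_iff[OF P Q ucont_push_ob[OF f]] eq2 by blast
  next
    assume ae: "uf_ae P (\<lambda>x. f x = g x)"
    have "uf_ae P (\<lambda>x. \<phi> (f x)) \<longleftrightarrow> uf_ae P (\<lambda>x. \<phi> (g x))" for \<phi>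
      using uf_ae_mono2[OF P ae, of "\<lambda>x. \<phi> (f x)" "\<lambda>x. \<phi> (g x)"]
        uf_ae_mono2[OF P ae, of "\<lambda>x. \<phi> (g x)" "\<lambda>x. \<phi> (f x)"] by auto
    then have eq: "?Q = push_ob P Y g"
      by (intro uf_ob_eqI[OF Q Q']) (simp_all add: uf_ae_push_ob f g)
    have "germ_code P ?Q f = germ_code P ?Q g"
      using germ_code_eq_iff[OF P Q ucont_push_ob[OF f]] ucont_push_ob[OF g] eq ae by simp
    then show "uelt P Y f = uelt P Y g" by (simp add: uelt_def eq)
  }
qed

lemma uelt_cong:
  assumes "P \<in> Ob UF" "f \<in> pts P \<rightarrow> elts Y" "\<And>x. x \<in> pts P \<Longrightarrow> f x = g x"
  shows "uelt P Y f = uelt P Y g"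
proof -
  have "g \<in> pts P \<rightarrow> elts Y" using assms(2) by (simp add: Pi_iff flip: assms(3))
  then show ?thesis
    using uelt_eq_iff[OF assms(1,2)] uf_ae_I[OF assms(1), of "\<lambda>x. f x = g x"] assms(3) by simp
qed

lemma upow_app:
  assumes P: "P \<in> Ob UF" and k: "k \<in> Hom SET Y Z" and f: "f \<in> pts P \<rightarrow> elts Y"
  shows "SFn (FAr (upow P) k) (uelt P Y f) = uelt P Z (\<lambda>x. SFn k (f x))"
proof -
  let ?g = "SFn k \<circ> f"
  let ?Q = "push_ob P Y f" and ?R = "push_ob P Z ?g"
  have g: "?g \<in> pts P \<rightarrow> elts Z" using f k by (auto simp: Hom_SET)
  have Q: "?Q \<in> Ob UF" and R: "?R \<in> Ob UF" by (rule push_ob_Ob[OF P f] push_ob_Ob[OF P g])+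
  have k': "SFn k \<in> pts ?Q \<rightarrow> pts ?R" using k by (auto simp: Hom_SET)
  \<comment> \<open>Pushing forward along \<open>f\<close> and then along \<open>k\<close> is
    pushing forward along the composite, so \<open>k\<close> is continuous between the two
    pushforwards.\<close>
  have u: "ucont ?Q ?R (SFn k)"
    using k' by (simp add: ucont_def uf_ae_push_ob f) (simp add: uf_ae_push_ob[OF g])
  have "germ_code P ?Q f \<in> elts (FOb (hom_fctr P) ?Q)"
    using germ_code_mem[OF P Q ucont_push_ob[OF f]] Q by (simp add: hom_fctr_sel)
  then have "SFn (FAr (upow P) k) (uelt P Y f) = ielt ?R (SFn (FAr (hom_fctr P) (umor ?Q ?R (SFn k))) (germ_code P ?Q f))"
    unfolding upow_def uelt_def by (intro integral_fctr_ielt'[OF k Q _ R _ u]) simp_all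
  then show ?thesis
    using hom_fctr_umor[OF P Q R ucont_push_ob[OF f] u] by (simp add: uelt_def comp_def)
qed

text \<open>Reindexing along \<open>u\<close> is precomposition. It keeps the index, because
  continuity of \<open>u\<close> makes the pushforward of \<open>P\<close> along
  \<open>f \<circ> u\<close> equal to that of \<open>Q\<close> along \<open>f\<close>.\<close>

lemma upow_umor_app:
  assumes P: "P \<in> Ob UF" and Q: "Q \<in> Ob UF" and u: "ucont P Q u" and f: "f \<in> pts Q \<rightarrow> elts Y"
  shows "SFn (NAt (FAr integral (FAr yoneda (umor P Q u))) Y) (uelt Q Y f) = uelt P Y (\<lambda>x. f (u x))"
proof -
  let ?R = "push_ob Q Y f"
  have R: "?R \<in> Ob UF" by (rule push_ob_Ob[OF Q f])
  have fu: "f \<circ> u \<in> pts P \<rightarrow> elts Y" using f u by (auto simp: ucont_def)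
  have h: "umor P Q u \<in> Hom UF P Q" by (rule umor_Hom[OF P Q u])
  have eq: "push_ob P Y (f \<circ> u) = ?R"
    by (rule uf_ob_eqI[OF push_ob_Ob[OF P fu] R])
      (simp_all add: uf_ae_push_ob[OF f] uf_ae_push_ob[OF fu] ucont_ae[OF u])
  have "germ_code Q ?R f \<in> elts (FOb (NDm (FAr yoneda (umor P Q u))) ?R)"
    using germ_code_mem[OF Q R ucont_push_ob[OF f]] R h by (simp add: hom_fctr_sel yoneda_sel Hom_def)
  then have "SFn (NAt (FAr integral (FAr yoneda (umor P Q u))) Y) (uelt Q Y f) =
      ielt ?R (SFn (NAt (FAr yoneda (umor P Q u)) ?R) (germ_code Q ?R f))"
    unfolding uelt_def by (intro integral_ielt is_ntrans_yoneda[OF h] R) simp_all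
  also have "\<dots> = uelt P Y (f \<circ> u)"
    by (simp add: uelt_def eq yoneda_umor[OF P Q R u ucont_push_ob[OF f]])
  finally show ?thesis by (simp add: comp_def)
qed

section \<open>Comparison maps for composites of ultrapowers\<close>

definition upow_unit :: "'v::set_universe endo_trans" where
  "upow_unit = \<lparr>NDm = id_fctr SET, NCd = upow uf_unit, NAt = (\<lambda>Y.
     \<lparr>SDm = Y, SCd = FOb (upow uf_unit) Y, SFn = (\<lambda>y\<in>elts Y. uelt uf_unit Y (\<lambda>_. y))\<rparr>)\<rparr>"

text \<open>The choice of \<open>g\<close> is immaterial, by \<open>uelt2_eq_iff\<close> below.\<close>

definition upow_mult :: "'v::set_universe uf_ob \<Rightarrow> 'v uf_ob \<Rightarrow> 'v endo_trans" where
  "upow_mult P Q = \<lparr>NDm = comp_fctr SET (upow P) (upow Q), NCd = upow (uf_tensor P Q), NAt = (\<lambda>Y.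
     \<lparr>SDm = FOb (upow P) (FOb (upow Q) Y), SCd = FOb (upow (uf_tensor P Q)) Y,
      SFn = (\<lambda>p\<in>elts (FOb (upow P) (FOb (upow Q) Y)).
        let g = (SOME g. (\<forall>x\<in>pts P. g x \<in> pts Q \<rightarrow> elts Y) \<and>
                   p = uelt P (FOb (upow Q) Y) (\<lambda>x. uelt Q Y (g x)))
        in uelt (uf_tensor P Q) Y (\<lambda>q. g (vfst q) (vsnd q)))\<rparr>)\<rparr>"

lemma uelt2_mem:
  assumes "Q \<in> Ob UF" "\<And>x. x \<in> pts P \<Longrightarrow> g x \<in> pts Q \<rightarrow> elts Y"
  shows "(\<lambda>x. uelt Q Y (g x)) \<in> pts P \<rightarrow> elts (FOb (upow Q) Y)"
  by (intro Pi_I uelt_mem assms)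

text \<open>An element of the iterated ultrapower is represented by a family of classes. Choosing a
  representing map for each point of \<open>P\<close> yields a curried function of two
  variables.\<close>

lemma uelt2_E:
  assumes P: "P \<in> Ob UF" and Q: "Q \<in> Ob UF" and p: "p \<in> elts (FOb (upow P) (FOb (upow Q) Y))"
  obtains g where "\<And>x. x \<in> pts P \<Longrightarrow> g x \<in> pts Q \<rightarrow> elts Y"
    "p = uelt P (FOb (upow Q) Y) (\<lambda>x. uelt Q Y (g x))"
proof -
  obtain F where F: "F \<in> pts P \<rightarrow> elts (FOb (upow Q) Y)" and pF: "p = uelt P (FOb (upow Q) Y) F"
    by (rule uelt_E[OF P p])
  have "\<forall>x\<in>pts P. \<exists>f. f \<in> pts Q \<rightarrow> elts Y \<and> F x = uelt Q Y f"
  proof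
    fix x assume "x \<in> pts P"
    with F have "F x \<in> elts (FOb (upow Q) Y)" by auto
    then show "\<exists>f. f \<in> pts Q \<rightarrow> elts Y \<and> F x = uelt Q Y f" by (rule uelt_E[OF Q]) blast
  qed
  then obtain g where g: "\<forall>x\<in>pts P. g x \<in> pts Q \<rightarrow> elts Y \<and> F x = uelt Q Y (g x)"
    by (rule bchoice[THEN exE])
  have "p = uelt P (FOb (upow Q) Y) (\<lambda>x. uelt Q Y (g x))"
    unfolding pF by (rule uelt_cong[OF P F]) (use g in blast)
  then show ?thesis using g by (intro that[of g]) auto
qed

lemma tensor_PiI:
  assumes "\<And>x. x \<in> pts P \<Longrightarrow> g x \<in> pts Q \<rightarrow> Z"
  shows "(\<lambda>q. g (vfst q) (vsnd q)) \<in> pts (uf_tensor P Q) \<rightarrow> Z"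
  by (rule Pi_I, erule pts_tensorE) (simp add: funcset_mem[OF assms])

text \<open>Both equations say that, for almost all \<open>x\<close>, \<open>g x y = h x y\<close>
  for almost all \<open>y\<close>. One implication makes \<open>upow_mult\<close> well defined, the
  other makes it injective.\<close>

lemma uelt2_eq_iff:
  assumes P: "P \<in> Ob UF" and Q: "Q \<in> Ob UF"
    and g: "\<And>x. x \<in> pts P \<Longrightarrow> g x \<in> pts Q \<rightarrow> elts Y" and h: "\<And>x. x \<in> pts P \<Longrightarrow> h x \<in> pts Q \<rightarrow> elts Y"
  shows "uelt P (FOb (upow Q) Y) (\<lambda>x. uelt Q Y (g x)) = uelt P (FOb (upow Q) Y) (\<lambda>x. uelt Q Y (h x)) \<longleftrightarrow>
    uelt (uf_tensor P Q) Y (\<lambda>q. g (vfst q) (vsnd q)) = uelt (uf_tensor P Q) Y (\<lambda>q. h (vfst q) (vsnd q))"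
    (is "?L \<longleftrightarrow> ?R")
proof -
  have "?L \<longleftrightarrow> uf_ae P (\<lambda>x. uelt Q Y (g x) = uelt Q Y (h x))"
    by (rule uelt_eq_iff[OF P uelt2_mem[OF Q g] uelt2_mem[OF Q h]])
  also have "\<dots> \<longleftrightarrow> uf_ae P (\<lambda>x. uf_ae Q (\<lambda>y. g x y = h x y))"
    by (rule uf_ae_cong) (simp add: uelt_eq_iff[OF Q g h])
  also have "\<dots> \<longleftrightarrow> ?R"
  proof (subst uelt_eq_iff[OF tensor_Ob[OF P Q]])
    show "(\<lambda>q. g (vfst q) (vsnd q)) \<in> pts (uf_tensor P Q) \<rightarrow> elts Y"
      "(\<lambda>q. h (vfst q) (vsnd q)) \<in> pts (uf_tensor P Q) \<rightarrow> elts Y"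
      using tensor_PiI[of P g Q "elts Y"] tensor_PiI[of P h Q "elts Y"] g h by simp_all
  qed (simp add: uf_ae_tensor)
  finally show ?thesis .
qed

lemma upow_mult_app:
  assumes P: "P \<in> Ob UF" and Q: "Q \<in> Ob UF" and g: "\<And>x. x \<in> pts P \<Longrightarrow> g x \<in> pts Q \<rightarrow> elts Y"
  shows "SFn (NAt (upow_mult P Q) Y) (uelt P (FOb (upow Q) Y) (\<lambda>x. uelt Q Y (g x))) =
    uelt (uf_tensor P Q) Y (\<lambda>q. g (vfst q) (vsnd q))"
proof -
  let ?p = "uelt P (FOb (upow Q) Y) (\<lambda>x. uelt Q Y (g x))"
  let ?R = "\<lambda>h. (\<forall>x\<in>pts P. h x \<in> pts Q \<rightarrow> elts Y) \<and> ?p = uelt P (FOb (upow Q) Y) (\<lambda>x. uelt Q Y (h x))"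
  define h where "h = (SOME h. ?R h)"
  have "?R g" using g by simp
  then have h: "?R h" unfolding h_def by (rule someI[of ?R])
  have "?p \<in> elts (FOb (upow P) (FOb (upow Q) Y))" by (rule uelt_mem[OF P uelt2_mem[OF Q g]])
  then have "SFn (NAt (upow_mult P Q) Y) ?p = uelt (uf_tensor P Q) Y (\<lambda>q. h (vfst q) (vsnd q))"
    by (simp add: upow_mult_def Let_def h_def)
  also have "\<dots> = uelt (uf_tensor P Q) Y (\<lambda>q. g (vfst q) (vsnd q))"
    using uelt2_eq_iff[OF P Q, of h Y g] g h by simp
  finally show ?thesis .
qed


section \<open>Monoidal functors reflected along a fully faithful one\<close>

context category
begin

lemma cmp_assoc_eq:
  assumes "f \<in> Hom C A B" "g \<in> Hom C B D" "h \<in> Hom C D E" "h \<cdot> g = k"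
  shows "h \<cdot> (g \<cdot> f) = k \<cdot> f"
  using cmp_assoc[OF assms(1-3)] assms(4) by simp

lemma inverse_pair_Hom:
  assumes "inverse_pair C f g" "f \<in> Hom C A B"
  shows "g \<in> Hom C B A" "g \<cdot> f = One C A" "f \<cdot> g = One C B"
  using assms by (auto simp: inverse_pair_def Hom_def)

lemma inverse_pairI:
  assumes "f \<in> Hom C A B" "g \<in> Hom C B A" "g \<cdot> f = One C A" "f \<cdot> g = One C B"
  shows "inverse_pair C f g"
  using assms by (auto simp: inverse_pair_def Hom_def)

lemma iso_cmp:
  assumes f: "f \<in> Hom C A B" and g: "g \<in> Hom C B D" and "iso C f" "iso C g"
  shows "iso C (g \<cdot> f)"
proof -
  obtain f' g' where "inverse_pair C f f'" "inverse_pair C g g'" using assms(3,4) unfolding iso_def by blast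
  note f' = inverse_pair_Hom[OF this(1) f] and g' = inverse_pair_Hom[OF this(2) g]
  have "inverse_pair C (g \<cdot> f) (f' \<cdot> g')"
  proof (rule inverse_pairI[OF cmp_hom[OF f g] cmp_hom[OF g'(1) f'(1)]])
    have "(f' \<cdot> g') \<cdot> (g \<cdot> f) = f' \<cdot> (g' \<cdot> (g \<cdot> f))" by (rule cmp_assoc[OF cmp_hom[OF f g] g'(1) f'(1)])
    then show "(f' \<cdot> g') \<cdot> (g \<cdot> f) = One C A"
      by (simp add: cmp_assoc_eq[OF f g g'(1) g'(2)] one_cmp[OF f] f'(2))
    have "(g \<cdot> f) \<cdot> (f' \<cdot> g') = g \<cdot> (f \<cdot> (f' \<cdot> g'))" by (rule cmp_assoc[OF cmp_hom[OF g'(1) f'(1)] f g])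
    then show "(g \<cdot> f) \<cdot> (f' \<cdot> g') = One C D"
      by (simp add: cmp_assoc_eq[OF g'(1) f'(1) f f'(3)] one_cmp[OF g'(1)] g'(3))
  qed
  then show ?thesis unfolding iso_def ..
qed

lemma iso_epi:
  assumes i: "i \<in> Hom C X A" "iso C i" and s: "s \<in> Hom C A B" and t: "t \<in> Hom C A B" and eq: "s \<cdot> i = t \<cdot> i"
  shows "s = t"
proof -
  obtain j where "inverse_pair C i j" using i(2) unfolding iso_def by blast
  note j = inverse_pair_Hom[OF this i(1)]
  have "r = (r \<cdot> i) \<cdot> j" if "r \<in> Hom C A B" for r
    using cmp_assoc[OF j(1) i(1) that] j(3) cmp_one[OF that] by simp
  then show ?thesis using s t eq by metis
qed

end

lemma (in monoidal_category) iso_tensor: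
  assumes f: "f \<in> Hom C A B" and g: "g \<in> Hom C A' B'" and "iso C f" "iso C g"
  shows "iso C (TAr M f g)"
proof -
  obtain f' g' where "inverse_pair C f f'" "inverse_pair C g g'" using assms(3,4) unfolding iso_def by blast
  note f' = inverse_pair_Hom[OF this(1) f] and g' = inverse_pair_Hom[OF this(2) g]
  have obs: "A \<in> Ob C" "B \<in> Ob C" "A' \<in> Ob C" "B' \<in> Ob C"
    using dm_cd f g by (auto simp: Hom_def)
  have "inverse_pair C (TAr M f g) (TAr M f' g')"
    by (rule inverse_pairI[OF tar[OF f g] tar[OF f'(1) g'(1)]])
      (simp_all add: tar_cmp[OF f f'(1) g g'(1), symmetric] tar_cmp[OF f'(1) f g'(1) g, symmetric]
        f' g' tar_one obs)
  then show ?thesis unfolding iso_def ..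
qed

lemma (in category) one_iso: "A \<in> Ob C \<Longrightarrow> iso C (One C A)"
  using inverse_pairI[OF one_hom one_hom, of A] cmp_one[OF one_hom, of A] unfolding iso_def by blast

lemma comp_fctr_sel [simp]:
  "A \<in> Ob C \<Longrightarrow> FOb (comp_fctr C G F) A = FOb G (FOb F A)"
  "f \<in> Ar C \<Longrightarrow> FAr (comp_fctr C G F) f = FAr G (FAr F f)"
  by (simp_all add: comp_fctr_def)

locale full_faithful_strong_monoidal =
  D: monoidal_category D N + E: monoidal_category E L
  for D :: "('p, 'b) cat" and N :: "('p, 'b) monoidal" and E :: "('q, 'c) cat" and L :: "('q, 'c) monoidal" +
  fixes F :: "('p, 'b, 'q, 'c) fctr" and e :: 'c and m :: "'p \<Rightarrow> 'p \<Rightarrow> 'c"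
  assumes F: "is_fctr D E F"
    and constraints: "monoidal_constraints D N E L F e m"
    and faithful: "\<And>A B s t. s \<in> Hom D A B \<Longrightarrow> t \<in> Hom D A B \<Longrightarrow> FAr F s = FAr F t \<Longrightarrow> s = t"
    and full: "\<And>A B s. A \<in> Ob D \<Longrightarrow> B \<in> Ob D \<Longrightarrow> s \<in> Hom E (FOb F A) (FOb F B) \<Longrightarrow>
      \<exists>t \<in> Hom D A B. FAr F t = s"
begin

lemma reflects_iso:
  assumes t: "t \<in> Hom D A B" and "iso E (FAr F t)"
  shows "iso D t"
proof -
  have obs: "A \<in> Ob D" "B \<in> Ob D" using t D.dm_cd by (auto simp: Hom_def)
  have Ft: "FAr F t \<in> Hom E (FOb F A) (FOb F B)" by (rule fctr_Hom[OF F t])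
  obtain s' where "inverse_pair E (FAr F t) s'" using assms(2) unfolding iso_def by blast
  note s' = E.inverse_pair_Hom[OF this Ft]
  obtain s where s: "s \<in> Hom D B A" and Fs: "FAr F s = s'" using full[OF obs(2,1) s'(1)] by blast
  have "inverse_pair D t s"
  proof (rule D.inverse_pairI[OF t s])
    show "s \<cdot>\<^bsub>D\<^esub> t = One D A"
      by (rule faithful[OF D.cmp_hom[OF t s] D.one_hom[OF obs(1)]])
        (simp add: fctr_cmp[OF F t s] fctr_One[OF F obs(1)] Fs s')
    show "t \<cdot>\<^bsub>D\<^esub> s = One D B"
      by (rule faithful[OF D.cmp_hom[OF s t] D.one_hom[OF obs(2)]])
        (simp add: fctr_cmp[OF F s t] fctr_One[OF F obs(2)] Fs s')
  qed
  then show ?thesis unfolding iso_def ..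
qed

text \<open>The lift is the preimage under \<open>F\<close> of \<open>j\<close> composed with the
  inverse of \<open>i\<close>; it is invertible because \<open>F\<close> reflects
  isomorphisms.\<close>

lemma lift_iso:
  assumes obs: "A \<in> Ob D" "B \<in> Ob D"
    and i: "i \<in> Hom E X (FOb F A)" "iso E i" and j: "j \<in> Hom E X (FOb F B)" "iso E j"
  shows "\<exists>t \<in> Hom D A B. iso D t \<and> FAr F t \<cdot>\<^bsub>E\<^esub> i = j"
proof -
  obtain k where k: "inverse_pair E i k" using i(2) unfolding iso_def by blast
  note k' = E.inverse_pair_Hom[OF k i(1)]
  have "iso E k" using inverse_pair_sym[OF k] unfolding iso_def by blast
  then have jk: "iso E (j \<cdot>\<^bsub>E\<^esub> k)" by (rule E.iso_cmp[OF k'(1) j(1) _ j(2)])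
  obtain t where t: "t \<in> Hom D A B" and Ft: "FAr F t = j \<cdot>\<^bsub>E\<^esub> k"
    using full[OF obs E.cmp_hom[OF k'(1) j(1)]] by blast
  have "FAr F t \<cdot>\<^bsub>E\<^esub> i = j"
    unfolding Ft by (simp add: E.cmp_assoc[OF i(1) k'(1) j(1)] k'(2) E.cmp_one[OF j(1)])
  moreover have "iso D t" using reflects_iso[OF t] jk Ft by simp
  ultimately show ?thesis using t by blast
qed

text \<open>The form in which equations in \<open>D\<close> are tested. The isomorphism
  \<open>i\<close> is built from constraints of \<open>F\<close>, whose axioms then become
  applicable.\<close>

lemma faithful_epi:
  assumes s: "s \<in> Hom D A B" and t: "t \<in> Hom D A B" and i: "i \<in> Hom E X (FOb F A)" "iso E i"
    and eq: "FAr F s \<cdot>\<^bsub>E\<^esub> i = FAr F t \<cdot>\<^bsub>E\<^esub> i"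
  shows "s = t"
  by (rule faithful[OF s t E.iso_epi[OF i fctr_Hom[OF F s] fctr_Hom[OF F t] eq]])

lemma e_hom: "e \<in> Hom E (Unit L) (FOb F (Unit N))" and e_iso: "iso E e"
  and m_hom: "A \<in> Ob D \<Longrightarrow> B \<in> Ob D \<Longrightarrow> m A B \<in> Hom E (TOb L (FOb F A) (FOb F B)) (FOb F (TOb N A B))"
  and m_iso: "A \<in> Ob D \<Longrightarrow> B \<in> Ob D \<Longrightarrow> iso E (m A B)"
  and m_nat: "f \<in> Hom D A A' \<Longrightarrow> g \<in> Hom D B B' \<Longrightarrow>
    m A' B' \<cdot>\<^bsub>E\<^esub> TAr L (FAr F f) (FAr F g) = FAr F (TAr N f g) \<cdot>\<^bsub>E\<^esub> m A B"
  and m_assoc: "A \<in> Ob D \<Longrightarrow> B \<in> Ob D \<Longrightarrow> T \<in> Ob D \<Longrightarrow>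
    FAr F (Asc N A B T) \<cdot>\<^bsub>E\<^esub> m (TOb N A B) T \<cdot>\<^bsub>E\<^esub> TAr L (m A B) (One E (FOb F T)) =
    m A (TOb N B T) \<cdot>\<^bsub>E\<^esub> TAr L (One E (FOb F A)) (m B T) \<cdot>\<^bsub>E\<^esub> Asc L (FOb F A) (FOb F B) (FOb F T)"
  and m_left: "A \<in> Ob D \<Longrightarrow>
    FAr F (Lun N A) \<cdot>\<^bsub>E\<^esub> m (Unit N) A \<cdot>\<^bsub>E\<^esub> TAr L e (One E (FOb F A)) = Lun L (FOb F A)"
  and m_right: "A \<in> Ob D \<Longrightarrow>
    FAr F (Run N A) \<cdot>\<^bsub>E\<^esub> m A (Unit N) \<cdot>\<^bsub>E\<^esub> TAr L (One E (FOb F A)) e = Run L (FOb F A)"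
  using constraints by (auto simp: monoidal_constraints_def Hom_def)

lemma F_Ob: "A \<in> Ob D \<Longrightarrow> FOb F A \<in> Ob E"
  by (rule fctr_Ob[OF F])

lemma cmp3:
  assumes "f \<in> Hom D A B" "g \<in> Hom D B X" "h \<in> Hom D X Y" "q \<in> Hom E Z (FOb F A)"
  shows "FAr F (h \<cdot>\<^bsub>D\<^esub> g \<cdot>\<^bsub>D\<^esub> f) \<cdot>\<^bsub>E\<^esub> q = FAr F h \<cdot>\<^bsub>E\<^esub> FAr F g \<cdot>\<^bsub>E\<^esub> FAr F f \<cdot>\<^bsub>E\<^esub> q"
proof -
  note H = fctr_Hom[OF F assms(1)] fctr_Hom[OF F assms(2)] fctr_Hom[OF F assms(3)]
  show ?thesis
    by (simp add: fctr_cmp[OF F assms(1,2)] fctr_cmp[OF F D.cmp_hom[OF assms(1,2)] assms(3)]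
        E.cmp_assoc[OF assms(4) E.cmp_hom[OF H(1,2)] H(3)] E.cmp_assoc[OF assms(4) H(1,2)])
qed

text \<open>Requiring that the images of the new constraints, composed with those of
  \<open>F\<close>, give \<open>e'\<close> and \<open>m'\<close> determines \<open>e''\<close> and
  \<open>n\<close>. Each axiom is then checked under \<open>F\<close>, precomposed with a composite
  of \<open>e\<close> and \<open>m\<close>, where it reduces to the corresponding axiom of the
  composite functor.\<close>

theorem reflects_monoidal_constraints:
  assumes C: "monoidal_category C M" and G: "is_fctr C D G"
    and comp: "monoidal_constraints C M E L (comp_fctr C F G) e' m'"
  shows "\<exists>e'' m''. monoidal_constraints C M D N G e'' m''"
proof -
  interpret C: monoidal_category C M by (rule C)
  have obG [simp]: "FOb G A \<in> Ob D" if "A \<in> Ob C" for A by (rule fctr_Ob[OF G that])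
  note C.tob [simp] C.unit_ob [simp] D.tob [simp] D.unit_ob [simp] F_Ob [simp]
  have Ar_C [simp]: "A \<in> Ob C \<Longrightarrow> B \<in> Ob C \<Longrightarrow> T \<in> Ob C \<Longrightarrow> Asc M A B T \<in> Ar C"
    "A \<in> Ob C \<Longrightarrow> Lun M A \<in> Ar C" "A \<in> Ob C \<Longrightarrow> Run M A \<in> Ar C" for A B T
    using C.asc_hom C.lun_hom C.run_hom by (simp_all add: Hom_def)
  have e'_hom: "e' \<in> Hom E (Unit L) (FOb F (FOb G (Unit M)))" and e'_iso: "iso E e'"
    using comp by (auto simp: monoidal_constraints_def)
  have m'_hom: "m' A B \<in> Hom E (TOb L (FOb F (FOb G A)) (FOb F (FOb G B))) (FOb F (FOb G (TOb M A B)))"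
    and m'_iso: "iso E (m' A B)" if "A \<in> Ob C" "B \<in> Ob C" for A B
    using comp that by (auto simp: monoidal_constraints_def)
  have m'_nat: "m' A' B' \<cdot>\<^bsub>E\<^esub> TAr L (FAr F (FAr G f)) (FAr F (FAr G g)) = FAr F (FAr G (TAr M f g)) \<cdot>\<^bsub>E\<^esub> m' A B"
    if f: "f \<in> Hom C A A'" and g: "g \<in> Hom C B B'" for f g A A' B B'
    using comp that C.tar[OF f g] by (auto simp: monoidal_constraints_def Hom_def)
  have m'_assoc: "FAr F (FAr G (Asc M A B T)) \<cdot>\<^bsub>E\<^esub> m' (TOb M A B) T \<cdot>\<^bsub>E\<^esub> TAr L (m' A B) (One E (FOb F (FOb G T))) =
    m' A (TOb M B T) \<cdot>\<^bsub>E\<^esub> TAr L (One E (FOb F (FOb G A))) (m' B T) \<cdot>\<^bsub>E\<^esub>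
      Asc L (FOb F (FOb G A)) (FOb F (FOb G B)) (FOb F (FOb G T))"
    if "A \<in> Ob C" "B \<in> Ob C" "T \<in> Ob C" for A B T
    using comp that by (simp add: monoidal_constraints_def)
  have m'_left: "FAr F (FAr G (Lun M A)) \<cdot>\<^bsub>E\<^esub> m' (Unit M) A \<cdot>\<^bsub>E\<^esub> TAr L e' (One E (FOb F (FOb G A))) = Lun L (FOb F (FOb G A))"
    and m'_right: "FAr F (FAr G (Run M A)) \<cdot>\<^bsub>E\<^esub> m' A (Unit M) \<cdot>\<^bsub>E\<^esub> TAr L (One E (FOb F (FOb G A))) e' = Run L (FOb F (FOb G A))"
    if "A \<in> Ob C" for A
    using comp that by (simp_all add: monoidal_constraints_def)
  obtain e'' where e'': "e'' \<in> Hom D (Unit N) (FOb G (Unit M))" "iso D e''" and Fe: "FAr F e'' \<cdot>\<^bsub>E\<^esub> e = e'"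
    using lift_iso[OF D.unit_ob obG[OF C.unit_ob] e_hom e_iso e'_hom e'_iso] by blast
  \<comment> \<open>The choice function is to be defined on all pairs, so membership in
    \<open>Ob C\<close> becomes a premise inside the existential.\<close>
  have "\<forall>A B. \<exists>t. A \<in> Ob C \<longrightarrow> B \<in> Ob C \<longrightarrow> t \<in> Hom D (TOb N (FOb G A) (FOb G B)) (FOb G (TOb M A B)) \<and>
      iso D t \<and> FAr F t \<cdot>\<^bsub>E\<^esub> m (FOb G A) (FOb G B) = m' A B"
  proof (intro allI)
    fix A B
    show "\<exists>t. A \<in> Ob C \<longrightarrow> B \<in> Ob C \<longrightarrow> t \<in> Hom D (TOb N (FOb G A) (FOb G B)) (FOb G (TOb M A B)) \<and>
      iso D t \<and> FAr F t \<cdot>\<^bsub>E\<^esub> m (FOb G A) (FOb G B) = m' A B"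
    proof (cases "A \<in> Ob C \<and> B \<in> Ob C")
      case True
      then have obs: "A \<in> Ob C" "B \<in> Ob C" by simp_all
      have "\<exists>t \<in> Hom D (TOb N (FOb G A) (FOb G B)) (FOb G (TOb M A B)).
          iso D t \<and> FAr F t \<cdot>\<^bsub>E\<^esub> m (FOb G A) (FOb G B) = m' A B"
        by (rule lift_iso[OF _ _ m_hom m_iso m'_hom m'_iso]) (use obs in simp_all)
      then show ?thesis by blast
    qed blast
  qed
  then obtain n where n: "\<forall>A B. A \<in> Ob C \<longrightarrow> B \<in> Ob C \<longrightarrow>
      n A B \<in> Hom D (TOb N (FOb G A) (FOb G B)) (FOb G (TOb M A B)) \<and>
      iso D (n A B) \<and> FAr F (n A B) \<cdot>\<^bsub>E\<^esub> m (FOb G A) (FOb G B) = m' A B"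
    unfolding choice_iff by blast
  have n_hom: "n A B \<in> Hom D (TOb N (FOb G A) (FOb G B)) (FOb G (TOb M A B))"
    and n_iso: "iso D (n A B)" and Fn: "FAr F (n A B) \<cdot>\<^bsub>E\<^esub> m (FOb G A) (FOb G B) = m' A B"
    if "A \<in> Ob C" "B \<in> Ob C" for A B
    using n that by blast+
  have nat: "n A' B' \<cdot>\<^bsub>D\<^esub> TAr N (FAr G f) (FAr G g) = FAr G (TAr M f g) \<cdot>\<^bsub>D\<^esub> n A B"
    if f: "f \<in> Hom C A A'" and g: "g \<in> Hom C B B'" for f g A A' B B'
  proof -
    have obs [simp]: "A \<in> Ob C" "A' \<in> Ob C" "B \<in> Ob C" "B' \<in> Ob C"
      using f g C.dm_cd by (auto simp: Hom_def)
    note Gf = fctr_Hom[OF G f] and Gg = fctr_Hom[OF G g] and Gfg = fctr_Hom[OF G C.tar[OF f g]]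
    note Tfg = D.tar[OF Gf Gg]
    have mh: "m (FOb G A) (FOb G B) \<in> Hom E (TOb L (FOb F (FOb G A)) (FOb F (FOb G B))) (FOb F (TOb N (FOb G A) (FOb G B)))"
      by (simp add: m_hom)
    show ?thesis
    proof (rule faithful_epi[OF D.cmp_hom[OF Tfg n_hom] D.cmp_hom[OF n_hom Gfg] mh m_iso])
      have "FAr F (n A' B' \<cdot>\<^bsub>D\<^esub> TAr N (FAr G f) (FAr G g)) \<cdot>\<^bsub>E\<^esub> m (FOb G A) (FOb G B) =
          FAr F (n A' B') \<cdot>\<^bsub>E\<^esub> (FAr F (TAr N (FAr G f) (FAr G g)) \<cdot>\<^bsub>E\<^esub> m (FOb G A) (FOb G B))"
        by (simp add: fctr_cmp[OF F Tfg n_hom] E.cmp_assoc[OF mh fctr_Hom[OF F Tfg] fctr_Hom[OF F n_hom]])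
      also have "\<dots> = FAr F (n A' B') \<cdot>\<^bsub>E\<^esub> (m (FOb G A') (FOb G B') \<cdot>\<^bsub>E\<^esub> TAr L (FAr F (FAr G f)) (FAr F (FAr G g)))"
        by (simp add: m_nat[OF Gf Gg])
      also have "\<dots> = m' A' B' \<cdot>\<^bsub>E\<^esub> TAr L (FAr F (FAr G f)) (FAr F (FAr G g))"
        by (rule E.cmp_assoc_eq[OF E.tar[OF fctr_Hom[OF F Gf] fctr_Hom[OF F Gg]] m_hom fctr_Hom[OF F n_hom] Fn]) simp_all
      also have "\<dots> = FAr F (FAr G (TAr M f g)) \<cdot>\<^bsub>E\<^esub> (FAr F (n A B) \<cdot>\<^bsub>E\<^esub> m (FOb G A) (FOb G B))"
        by (simp add: m'_nat[OF f g] Fn)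
      also have "\<dots> = FAr F (FAr G (TAr M f g) \<cdot>\<^bsub>D\<^esub> n A B) \<cdot>\<^bsub>E\<^esub> m (FOb G A) (FOb G B)"
        by (simp add: fctr_cmp[OF F n_hom Gfg] E.cmp_assoc[OF mh fctr_Hom[OF F n_hom] fctr_Hom[OF F Gfg]])
      finally show "FAr F (n A' B' \<cdot>\<^bsub>D\<^esub> TAr N (FAr G f) (FAr G g)) \<cdot>\<^bsub>E\<^esub> m (FOb G A) (FOb G B) =
        FAr F (FAr G (TAr M f g) \<cdot>\<^bsub>D\<^esub> n A B) \<cdot>\<^bsub>E\<^esub> m (FOb G A) (FOb G B)" .
    qed simp_all
  qed

  \<comment> \<open>Naturality of \<open>m\<close> moves \<open>t\<close> to the inner side, where
    functoriality of the tensor merges it with \<open>i\<close> into \<open>j\<close>.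
    \<open>F_right\<close> is the mirror image.\<close>
  have F_left: "FAr F (TAr N t (One D Z)) \<cdot>\<^bsub>E\<^esub> (m X Z \<cdot>\<^bsub>E\<^esub> TAr L i (One E (FOb F Z))) =
      m Y Z \<cdot>\<^bsub>E\<^esub> TAr L j (One E (FOb F Z))"
    if t: "t \<in> Hom D X Y" and i: "i \<in> Hom E W (FOb F X)" and ti: "FAr F t \<cdot>\<^bsub>E\<^esub> i = j" and Z: "Z \<in> Ob D"
    for t X Y i W j Z
  proof -
    have obs [simp]: "X \<in> Ob D" "Y \<in> Ob D" "Z \<in> Ob D" using t Z D.dm_cd by (auto simp: Hom_def)
    note Ft = fctr_Hom[OF F t] and one = E.one_hom[OF F_Ob[OF Z]]
    have Fone: "FAr F (One D Z) = One E (FOb F Z)" by (rule fctr_One[OF F Z])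
    have "FAr F (TAr N t (One D Z)) \<cdot>\<^bsub>E\<^esub> (m X Z \<cdot>\<^bsub>E\<^esub> TAr L i (One E (FOb F Z))) =
        (m Y Z \<cdot>\<^bsub>E\<^esub> TAr L (FAr F t) (One E (FOb F Z))) \<cdot>\<^bsub>E\<^esub> TAr L i (One E (FOb F Z))"
      using m_nat[OF t D.one_hom[OF Z]]
      by (intro E.cmp_assoc_eq[OF E.tar[OF i one] m_hom fctr_Hom[OF F D.tar[OF t D.one_hom[OF Z]]]]) (simp_all add: Fone)
    also have "\<dots> = m Y Z \<cdot>\<^bsub>E\<^esub> (TAr L (FAr F t) (One E (FOb F Z)) \<cdot>\<^bsub>E\<^esub> TAr L i (One E (FOb F Z)))"
      by (rule E.cmp_assoc[OF E.tar[OF i one] E.tar[OF Ft one] m_hom]) simp_all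
    also have "TAr L (FAr F t) (One E (FOb F Z)) \<cdot>\<^bsub>E\<^esub> TAr L i (One E (FOb F Z)) = TAr L j (One E (FOb F Z))"
      using E.tar_cmp[OF i Ft one one] by (simp add: ti E.cmp_one[OF one])
    finally show ?thesis .
  qed

  have F_right: "FAr F (TAr N (One D Z) t) \<cdot>\<^bsub>E\<^esub> (m Z X \<cdot>\<^bsub>E\<^esub> TAr L (One E (FOb F Z)) i) =
      m Z Y \<cdot>\<^bsub>E\<^esub> TAr L (One E (FOb F Z)) j"
    if t: "t \<in> Hom D X Y" and i: "i \<in> Hom E W (FOb F X)" and ti: "FAr F t \<cdot>\<^bsub>E\<^esub> i = j" and Z: "Z \<in> Ob D"
    for t X Y i W j Z
  proof -
    have obs [simp]: "X \<in> Ob D" "Y \<in> Ob D" "Z \<in> Ob D" using t Z D.dm_cd by (auto simp: Hom_def)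
    note Ft = fctr_Hom[OF F t] and one = E.one_hom[OF F_Ob[OF Z]]
    have Fone: "FAr F (One D Z) = One E (FOb F Z)" by (rule fctr_One[OF F Z])
    have "FAr F (TAr N (One D Z) t) \<cdot>\<^bsub>E\<^esub> (m Z X \<cdot>\<^bsub>E\<^esub> TAr L (One E (FOb F Z)) i) =
        (m Z Y \<cdot>\<^bsub>E\<^esub> TAr L (One E (FOb F Z)) (FAr F t)) \<cdot>\<^bsub>E\<^esub> TAr L (One E (FOb F Z)) i"
      using m_nat[OF D.one_hom[OF Z] t]
      by (intro E.cmp_assoc_eq[OF E.tar[OF one i] m_hom fctr_Hom[OF F D.tar[OF D.one_hom[OF Z] t]]]) (simp_all add: Fone)
    also have "\<dots> = m Z Y \<cdot>\<^bsub>E\<^esub> (TAr L (One E (FOb F Z)) (FAr F t) \<cdot>\<^bsub>E\<^esub> TAr L (One E (FOb F Z)) i)"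
      by (rule E.cmp_assoc[OF E.tar[OF one i] E.tar[OF one Ft] m_hom]) simp_all
    also have "TAr L (One E (FOb F Z)) (FAr F t) \<cdot>\<^bsub>E\<^esub> TAr L (One E (FOb F Z)) i = TAr L (One E (FOb F Z)) j"
      using E.tar_cmp[OF one one i Ft] by (simp add: ti E.cmp_one[OF one])
    finally show ?thesis .
  qed

  have assoc: "FAr G (Asc M A B T) \<cdot>\<^bsub>D\<^esub> n (TOb M A B) T \<cdot>\<^bsub>D\<^esub> TAr N (n A B) (One D (FOb G T)) =
    n A (TOb M B T) \<cdot>\<^bsub>D\<^esub> TAr N (One D (FOb G A)) (n B T) \<cdot>\<^bsub>D\<^esub> Asc N (FOb G A) (FOb G B) (FOb G T)"
    if obs [simp]: "A \<in> Ob C" "B \<in> Ob C" "T \<in> Ob C" for A B T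
  proof -
    let ?A = "FOb G A" and ?B = "FOb G B" and ?T = "FOb G T"
    \<comment> \<open>The comparison from the threefold tensor of images to the image of the
      threefold tensor, both bracketed to the left.\<close>
    let ?i = "m (TOb N ?A ?B) ?T \<cdot>\<^bsub>E\<^esub> TAr L (m ?A ?B) (One E (FOb F ?T))"
    have one: "One D ?A \<in> Hom D ?A ?A" "One D ?T \<in> Hom D ?T ?T"
      "One E (FOb F ?A) \<in> Hom E (FOb F ?A) (FOb F ?A)" "One E (FOb F ?T) \<in> Hom E (FOb F ?T) (FOb F ?T)"
      by (simp_all add: D.one_hom E.one_hom)
    note x1 = D.tar[OF n_hom[OF obs(1,2)] one(2)] and x2 = n_hom[OF C.tob[OF obs(1,2)] obs(3)]
      and x3 = fctr_Hom[OF G C.asc_hom[OF obs]]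
    note y2 = D.tar[OF one(1) n_hom[OF obs(2,3)]] and y3 = n_hom[OF obs(1) C.tob[OF obs(2,3)]]
    have y1: "Asc N ?A ?B ?T \<in> Hom D (TOb N (TOb N ?A ?B) ?T) (TOb N ?A (TOb N ?B ?T))"
      by (simp add: D.asc_hom)
    have mAB: "m ?A ?B \<in> Hom E (TOb L (FOb F ?A) (FOb F ?B)) (FOb F (TOb N ?A ?B))" by (simp add: m_hom)
    have mBT: "m ?B ?T \<in> Hom E (TOb L (FOb F ?B) (FOb F ?T)) (FOb F (TOb N ?B ?T))" by (simp add: m_hom)
    have mABT: "m (TOb N ?A ?B) ?T \<in> Hom E (TOb L (FOb F (TOb N ?A ?B)) (FOb F ?T)) (FOb F (TOb N (TOb N ?A ?B) ?T))"
      by (simp add: m_hom)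
    have mABT': "m ?A (TOb N ?B ?T) \<in> Hom E (TOb L (FOb F ?A) (FOb F (TOb N ?B ?T))) (FOb F (TOb N ?A (TOb N ?B ?T)))"
      by (simp add: m_hom)
    have a: "Asc L (FOb F ?A) (FOb F ?B) (FOb F ?T) \<in> Hom E (TOb L (TOb L (FOb F ?A) (FOb F ?B)) (FOb F ?T))
        (TOb L (FOb F ?A) (TOb L (FOb F ?B) (FOb F ?T)))" by (simp add: E.asc_hom)
    have i: "?i \<in> Hom E (TOb L (TOb L (FOb F ?A) (FOb F ?B)) (FOb F ?T)) (FOb F (TOb N (TOb N ?A ?B) ?T))"
      by (rule E.cmp_hom[OF E.tar[OF mAB one(4)] mABT])
    have i_iso: "iso E ?i"
      by (rule E.iso_cmp[OF E.tar[OF mAB one(4)] mABT E.iso_tensor[OF mAB one(4)]])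
        (simp_all add: m_iso E.one_iso)
    show ?thesis
    proof (rule faithful_epi[OF D.cmp_hom[OF D.cmp_hom[OF x1 x2] x3] D.cmp_hom[OF D.cmp_hom[OF y1 y2] y3] i i_iso])
      \<comment> \<open>On this side the images of the lifts absorb the constraints \<open>m\<close>
        from the inside outwards, leaving the left side of \<open>m'_assoc\<close>.\<close>
      have "FAr F (FAr G (Asc M A B T) \<cdot>\<^bsub>D\<^esub> n (TOb M A B) T \<cdot>\<^bsub>D\<^esub> TAr N (n A B) (One D ?T)) \<cdot>\<^bsub>E\<^esub> ?i =
          FAr F (FAr G (Asc M A B T)) \<cdot>\<^bsub>E\<^esub> FAr F (n (TOb M A B) T) \<cdot>\<^bsub>E\<^esub> FAr F (TAr N (n A B) (One D ?T)) \<cdot>\<^bsub>E\<^esub> ?i"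
        by (rule cmp3[OF x1 x2 x3 i])
      also have "FAr F (TAr N (n A B) (One D ?T)) \<cdot>\<^bsub>E\<^esub> ?i =
          m (FOb G (TOb M A B)) ?T \<cdot>\<^bsub>E\<^esub> TAr L (m' A B) (One E (FOb F ?T))"
        by (rule F_left[OF n_hom[OF obs(1,2)] mAB Fn]) simp_all
      also have "FAr F (n (TOb M A B) T) \<cdot>\<^bsub>E\<^esub> \<dots> = m' (TOb M A B) T \<cdot>\<^bsub>E\<^esub> TAr L (m' A B) (One E (FOb F ?T))"
        by (rule E.cmp_assoc_eq[OF E.tar[OF m'_hom one(4)] m_hom fctr_Hom[OF F x2] Fn]) simp_all
      also have "FAr F (FAr G (Asc M A B T)) \<cdot>\<^bsub>E\<^esub> \<dots> =
          m' A (TOb M B T) \<cdot>\<^bsub>E\<^esub> TAr L (One E (FOb F ?A)) (m' B T) \<cdot>\<^bsub>E\<^esub> Asc L (FOb F ?A) (FOb F ?B) (FOb F ?T)"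
        by (rule m'_assoc[OF obs])
      finally have l: "FAr F (FAr G (Asc M A B T) \<cdot>\<^bsub>D\<^esub> n (TOb M A B) T \<cdot>\<^bsub>D\<^esub> TAr N (n A B) (One D ?T)) \<cdot>\<^bsub>E\<^esub> ?i =
          m' A (TOb M B T) \<cdot>\<^bsub>E\<^esub> TAr L (One E (FOb F ?A)) (m' B T) \<cdot>\<^bsub>E\<^esub> Asc L (FOb F ?A) (FOb F ?B) (FOb F ?T)" .
      let ?q = "TAr L (One E (FOb F ?A)) (m ?B ?T)" and ?q' = "TAr L (One E (FOb F ?A)) (m' B T)"
        and ?a = "Asc L (FOb F ?A) (FOb F ?B) (FOb F ?T)"
      note q = E.tar[OF one(3) mBT] and q' = E.tar[OF one(3) m'_hom[OF obs(2,3)]]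
      \<comment> \<open>Here the associativity axiom of \<open>F\<close> first exchanges
        \<open>?i\<close> for the comparison bracketed to the right; after that the lifts absorb the
        constraints as before.\<close>
      have "FAr F (n A (TOb M B T) \<cdot>\<^bsub>D\<^esub> TAr N (One D ?A) (n B T) \<cdot>\<^bsub>D\<^esub> Asc N ?A ?B ?T) \<cdot>\<^bsub>E\<^esub> ?i =
          FAr F (n A (TOb M B T)) \<cdot>\<^bsub>E\<^esub> FAr F (TAr N (One D ?A) (n B T)) \<cdot>\<^bsub>E\<^esub> FAr F (Asc N ?A ?B ?T) \<cdot>\<^bsub>E\<^esub> ?i"
        by (rule cmp3[OF y1 y2 y3 i])
      also have "FAr F (Asc N ?A ?B ?T) \<cdot>\<^bsub>E\<^esub> ?i = m ?A (TOb N ?B ?T) \<cdot>\<^bsub>E\<^esub> ?q \<cdot>\<^bsub>E\<^esub> ?a"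
        by (rule m_assoc) simp_all
      also have "\<dots> = (m ?A (TOb N ?B ?T) \<cdot>\<^bsub>E\<^esub> ?q) \<cdot>\<^bsub>E\<^esub> ?a"
        by (rule E.cmp_assoc[OF a q mABT', symmetric])
      also have "FAr F (TAr N (One D ?A) (n B T)) \<cdot>\<^bsub>E\<^esub> \<dots> = (m ?A (FOb G (TOb M B T)) \<cdot>\<^bsub>E\<^esub> ?q') \<cdot>\<^bsub>E\<^esub> ?a"
        by (rule E.cmp_assoc_eq[OF a E.cmp_hom[OF q mABT'] fctr_Hom[OF F y2]])
          (rule F_right[OF n_hom[OF obs(2,3)] mBT Fn], simp_all)
      also have "\<dots> = m ?A (FOb G (TOb M B T)) \<cdot>\<^bsub>E\<^esub> ?q' \<cdot>\<^bsub>E\<^esub> ?a"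
        by (rule E.cmp_assoc[OF a q' m_hom]) simp_all
      also have "FAr F (n A (TOb M B T)) \<cdot>\<^bsub>E\<^esub> \<dots> = m' A (TOb M B T) \<cdot>\<^bsub>E\<^esub> ?q' \<cdot>\<^bsub>E\<^esub> ?a"
        by (rule E.cmp_assoc_eq[OF E.cmp_hom[OF a q'] m_hom fctr_Hom[OF F y3] Fn]) simp_all
      finally show "FAr F (FAr G (Asc M A B T) \<cdot>\<^bsub>D\<^esub> n (TOb M A B) T \<cdot>\<^bsub>D\<^esub> TAr N (n A B) (One D ?T)) \<cdot>\<^bsub>E\<^esub> ?i =
          FAr F (n A (TOb M B T) \<cdot>\<^bsub>D\<^esub> TAr N (One D ?A) (n B T) \<cdot>\<^bsub>D\<^esub> Asc N ?A ?B ?T) \<cdot>\<^bsub>E\<^esub> ?i"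
        unfolding l by (rule sym)
    qed
  qed

  have left: "FAr G (Lun M A) \<cdot>\<^bsub>D\<^esub> n (Unit M) A \<cdot>\<^bsub>D\<^esub> TAr N e'' (One D (FOb G A)) = Lun N (FOb G A)"
    if obs [simp]: "A \<in> Ob C" for A
  proof -
    let ?A = "FOb G A"
    let ?i = "m (Unit N) ?A \<cdot>\<^bsub>E\<^esub> TAr L e (One E (FOb F ?A))"
    have one: "One D ?A \<in> Hom D ?A ?A" "One E (FOb F ?A) \<in> Hom E (FOb F ?A) (FOb F ?A)"
      by (simp_all add: D.one_hom E.one_hom)
    note x1 = D.tar[OF e''(1) one(1)] and x2 = n_hom[OF C.unit_ob obs] and x3 = fctr_Hom[OF G C.lun_hom[OF obs]]
    have mh: "m (Unit N) ?A \<in> Hom E (TOb L (FOb F (Unit N)) (FOb F ?A)) (FOb F (TOb N (Unit N) ?A))" by (simp add: m_hom)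
    note i = E.cmp_hom[OF E.tar[OF e_hom one(2)] mh]
    have i_iso: "iso E ?i"
      by (rule E.iso_cmp[OF E.tar[OF e_hom one(2)] mh E.iso_tensor[OF e_hom one(2)]])
        (simp_all add: m_iso e_iso E.one_iso)
    show ?thesis
    proof (rule faithful_epi[OF D.cmp_hom[OF D.cmp_hom[OF x1 x2] x3] D.lun_hom i i_iso])
      have "FAr F (FAr G (Lun M A) \<cdot>\<^bsub>D\<^esub> n (Unit M) A \<cdot>\<^bsub>D\<^esub> TAr N e'' (One D ?A)) \<cdot>\<^bsub>E\<^esub> ?i =
          FAr F (FAr G (Lun M A)) \<cdot>\<^bsub>E\<^esub> FAr F (n (Unit M) A) \<cdot>\<^bsub>E\<^esub> FAr F (TAr N e'' (One D ?A)) \<cdot>\<^bsub>E\<^esub> ?i"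
        by (rule cmp3[OF x1 x2 x3 i])
      also have "FAr F (TAr N e'' (One D ?A)) \<cdot>\<^bsub>E\<^esub> ?i = m (FOb G (Unit M)) ?A \<cdot>\<^bsub>E\<^esub> TAr L e' (One E (FOb F ?A))"
        by (rule F_left[OF e''(1) e_hom Fe]) simp
      also have "FAr F (n (Unit M) A) \<cdot>\<^bsub>E\<^esub> \<dots> = m' (Unit M) A \<cdot>\<^bsub>E\<^esub> TAr L e' (One E (FOb F ?A))"
        by (rule E.cmp_assoc_eq[OF E.tar[OF e'_hom one(2)] m_hom fctr_Hom[OF F x2] Fn]) simp_all
      also have "FAr F (FAr G (Lun M A)) \<cdot>\<^bsub>E\<^esub> \<dots> = Lun L (FOb F ?A)" by (rule m'_left[OF obs])
      also have "\<dots> = FAr F (Lun N ?A) \<cdot>\<^bsub>E\<^esub> ?i" by (rule m_left[symmetric]) simp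
      finally show "FAr F (FAr G (Lun M A) \<cdot>\<^bsub>D\<^esub> n (Unit M) A \<cdot>\<^bsub>D\<^esub> TAr N e'' (One D ?A)) \<cdot>\<^bsub>E\<^esub> ?i = FAr F (Lun N ?A) \<cdot>\<^bsub>E\<^esub> ?i" .
    qed simp
  qed

  have right: "FAr G (Run M A) \<cdot>\<^bsub>D\<^esub> n A (Unit M) \<cdot>\<^bsub>D\<^esub> TAr N (One D (FOb G A)) e'' = Run N (FOb G A)"
    if obs [simp]: "A \<in> Ob C" for A
  proof -
    let ?A = "FOb G A"
    let ?i = "m ?A (Unit N) \<cdot>\<^bsub>E\<^esub> TAr L (One E (FOb F ?A)) e"
    have one: "One D ?A \<in> Hom D ?A ?A" "One E (FOb F ?A) \<in> Hom E (FOb F ?A) (FOb F ?A)"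
      by (simp_all add: D.one_hom E.one_hom)
    note x1 = D.tar[OF one(1) e''(1)] and x2 = n_hom[OF obs C.unit_ob] and x3 = fctr_Hom[OF G C.run_hom[OF obs]]
    have mh: "m ?A (Unit N) \<in> Hom E (TOb L (FOb F ?A) (FOb F (Unit N))) (FOb F (TOb N ?A (Unit N)))" by (simp add: m_hom)
    note i = E.cmp_hom[OF E.tar[OF one(2) e_hom] mh]
    have i_iso: "iso E ?i"
      by (rule E.iso_cmp[OF E.tar[OF one(2) e_hom] mh E.iso_tensor[OF one(2) e_hom]])
        (simp_all add: m_iso e_iso E.one_iso)
    show ?thesis
    proof (rule faithful_epi[OF D.cmp_hom[OF D.cmp_hom[OF x1 x2] x3] D.run_hom i i_iso])
      have "FAr F (FAr G (Run M A) \<cdot>\<^bsub>D\<^esub> n A (Unit M) \<cdot>\<^bsub>D\<^esub> TAr N (One D ?A) e'') \<cdot>\<^bsub>E\<^esub> ?i =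
          FAr F (FAr G (Run M A)) \<cdot>\<^bsub>E\<^esub> FAr F (n A (Unit M)) \<cdot>\<^bsub>E\<^esub> FAr F (TAr N (One D ?A) e'') \<cdot>\<^bsub>E\<^esub> ?i"
        by (rule cmp3[OF x1 x2 x3 i])
      also have "FAr F (TAr N (One D ?A) e'') \<cdot>\<^bsub>E\<^esub> ?i = m ?A (FOb G (Unit M)) \<cdot>\<^bsub>E\<^esub> TAr L (One E (FOb F ?A)) e'"
        by (rule F_right[OF e''(1) e_hom Fe]) simp
      also have "FAr F (n A (Unit M)) \<cdot>\<^bsub>E\<^esub> \<dots> = m' A (Unit M) \<cdot>\<^bsub>E\<^esub> TAr L (One E (FOb F ?A)) e'"
        by (rule E.cmp_assoc_eq[OF E.tar[OF one(2) e'_hom] m_hom fctr_Hom[OF F x2] Fn]) simp_all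
      also have "FAr F (FAr G (Run M A)) \<cdot>\<^bsub>E\<^esub> \<dots> = Run L (FOb F ?A)" by (rule m'_right[OF obs])
      also have "\<dots> = FAr F (Run N ?A) \<cdot>\<^bsub>E\<^esub> ?i" by (rule m_right[symmetric]) simp
      finally show "FAr F (FAr G (Run M A) \<cdot>\<^bsub>D\<^esub> n A (Unit M) \<cdot>\<^bsub>D\<^esub> TAr N (One D ?A) e'') \<cdot>\<^bsub>E\<^esub> ?i = FAr F (Run N ?A) \<cdot>\<^bsub>E\<^esub> ?i" .
    qed simp
  qed

  have "n (Cd C f) (Cd C g) \<cdot>\<^bsub>D\<^esub> TAr N (FAr G f) (FAr G g) = FAr G (TAr M f g) \<cdot>\<^bsub>D\<^esub> n (Dm C f) (Dm C g)"
    if "f \<in> Ar C" "g \<in> Ar C" for f g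
    by (rule nat) (use that in \<open>simp_all add: Hom_def\<close>)
  then have "monoidal_constraints C M D N G e'' n"
    unfolding monoidal_constraints_def
    using e'' n_hom n_iso assoc left right by blast
  then show ?thesis by blast
qed

end


section \<open>Composition of ultrapowers\<close>

context
  assumes integral: "is_fctr UF_SET FC (integral :: ('v::set_universe uf_fctr, 'v uf_trans, 'v endo, 'v endo_trans) fctr)"
    and FC: "monoidal_category FC (composition_monoidal SET :: ('v endo, 'v endo_trans) monoidal)"
begin

interpretation FC: monoidal_category FC "composition_monoidal SET :: ('v endo, 'v endo_trans) monoidal"
  by (rule FC)

text \<open>That ultrapowers preserve finite coproducts is read off from the assumption that
  \<open>integral\<close> takes its values in \<open>FC\<close>.\<close>

lemma upow_Ob: "P \<in> Ob UF \<Longrightarrow> upow (P :: 'v uf_ob) \<in> Ob FC"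
  using fctr_Ob[OF integral, of "hom_fctr P"] by (simp add: is_fctr_hom_fctr integral_sel upow_def del: FC_sel)

lemma upow_fctr: "P \<in> Ob UF \<Longrightarrow> is_fctr SET SET (upow (P :: 'v uf_ob))"
  using upow_Ob by simp

lemma comp_Ob: "F \<in> Ob FC \<Longrightarrow> G \<in> Ob FC \<Longrightarrow> comp_fctr SET F (G :: 'v endo) \<in> Ob FC"
  using FC.tob[of F G] by (simp add: composition_monoidal_sel del: FC_sel)

lemma upow_umor_Hom:
  assumes "h \<in> Hom UF P (Q :: 'v uf_ob)"
  shows "FAr integral (FAr yoneda h) \<in> Hom FC (upow Q) (upow P)"
proof -
  have "P \<in> Ob UF" "Q \<in> Ob UF" using assms by (simp_all add: Hom_UF)
  then show ?thesis
    using fctr_Hom[OF integral yoneda_Hom[OF assms]] by (simp add: is_fctr_hom_fctr integral_sel upow_def)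
qed

lemma upow_unit_app: "y \<in> elts Y \<Longrightarrow> SFn (NAt upow_unit Y) y = uelt uf_unit Y (\<lambda>_. y)"
  by (simp add: upow_unit_def)

lemma upow_unit_Hom: "upow_unit \<in> Hom FC (id_fctr SET) (upow (uf_unit :: 'v uf_ob))"
proof -
  have id: "id_fctr SET \<in> Ob (FC :: ('v endo, 'v endo_trans) cat)"
    using FC.unit_ob by (simp only: composition_monoidal_sel)
  have sel: "NDm upow_unit = id_fctr SET" "NCd upow_unit = upow uf_unit" by (simp_all add: upow_unit_def)
  have H: "NAt upow_unit Y \<in> Hom SET Y (FOb (upow uf_unit) Y)" for Y :: 'v
    unfolding upow_unit_def by (simp, rule Hom_SET_I, rule uelt_mem) auto
  have "is_ntrans SET SET (upow_unit :: 'v endo_trans)"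
    unfolding is_ntrans_def
  proof (intro conjI ballI)
    fix k :: "'v set_ar" assume kA: "k \<in> Ar SET"
    let ?Y = "SDm k" and ?Z = "SCd k"
    have k: "k \<in> Hom SET ?Y ?Z" using kA by (simp add: Hom_def)
    have "NAt upow_unit ?Z \<cdot>\<^bsub>SET\<^esub> k = FAr (upow uf_unit) k \<cdot>\<^bsub>SET\<^esub> NAt upow_unit ?Y"
    proof (rule SET_eqI[OF SET_cmp_Hom[OF k H] SET_cmp_Hom[OF H fctr_Hom[OF upow_fctr[OF unit_Ob] k]]])
      fix y assume y: "y \<in> elts ?Y"
      then have "SFn k y \<in> elts ?Z" by (rule SFn_app[OF k])
      with y H[of ?Y] show "SFn (NAt upow_unit ?Z \<cdot>\<^bsub>SET\<^esub> k) y = SFn (FAr (upow uf_unit) k \<cdot>\<^bsub>SET\<^esub> NAt upow_unit ?Y) y"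
        by (simp add: SFn_cmp Hom_SET upow_unit_app upow_app[OF unit_Ob k])
    qed
    then show "NAt upow_unit (Cd SET k) \<cdot>\<^bsub>SET\<^esub> FAr (NDm upow_unit) k =
        FAr (NCd upow_unit) k \<cdot>\<^bsub>SET\<^esub> NAt upow_unit (Dm SET k)"
      using kA by (simp add: sel)
  qed (use id upow_fctr[OF unit_Ob] H in \<open>simp_all add: sel\<close>)
  then show ?thesis using id upow_Ob[OF unit_Ob] by (simp add: Hom_FC sel)
qed

text \<open>A map from a one-point set is constant, and its class determines the value because the
  quantifier of \<open>uf_unit\<close> is evaluation at the point.\<close>

lemma upow_unit_iso: "iso FC (upow_unit :: 'v endo_trans)"
proof (rule FC_iso[OF FC.category_axioms upow_unit_Hom])
  fix Y :: 'v
  have "bij_betw (\<lambda>y. uelt uf_unit Y (\<lambda>_. y)) (elts Y) (elts (FOb (upow uf_unit) Y))"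
    unfolding bij_betw_def
  proof (intro conjI inj_onI subset_antisym image_subsetI subsetI)
    fix y z assume "y \<in> elts Y" "z \<in> elts Y" "uelt uf_unit Y (\<lambda>_. y) = uelt uf_unit Y (\<lambda>_. z)"
    then show "y = z" by (subst (asm) uelt_eq_iff) auto
  next
    fix y assume "y \<in> elts Y"
    then show "uelt uf_unit Y (\<lambda>_. y) \<in> elts (FOb (upow uf_unit) Y)" by (intro uelt_mem) auto
  next
    fix p assume "p \<in> elts (FOb (upow uf_unit) Y)"
    then obtain f where f: "f \<in> pts uf_unit \<rightarrow> elts Y" and p: "p = uelt uf_unit Y f" by (rule uelt_E[OF unit_Ob])
    have "p = uelt uf_unit Y (\<lambda>_. f (vset {}))"
      unfolding p by (rule uelt_cong[OF unit_Ob f]) simp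
    with f show "p \<in> (\<lambda>y. uelt uf_unit Y (\<lambda>_. y)) ` elts Y" by auto
  qed
  then show "bij_betw (SFn (NAt upow_unit Y)) (elts (FOb (id_fctr SET) Y)) (elts (FOb (upow uf_unit) Y))"
    by (subst bij_betw_cong[of _ _ "\<lambda>y. uelt uf_unit Y (\<lambda>_. y)"]) (simp_all add: upow_unit_app)
qed

text \<open>Naturality holds because \<open>k\<close> acts by postcomposition, which commutes with
  uncurrying; in the composite functor it acts on the inner classes, one for each
  \<open>x\<close>.\<close>

lemma upow_mult_Hom:
  fixes P Q :: "'v uf_ob"
  assumes P: "P \<in> Ob UF" and Q: "Q \<in> Ob UF"
  shows "upow_mult P Q \<in> Hom FC (comp_fctr SET (upow P) (upow Q)) (upow (uf_tensor P Q))"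
proof -
  note obs = comp_Ob[OF upow_Ob[OF P] upow_Ob[OF Q]] upow_Ob[OF tensor_Ob[OF P Q]]
  have fctrs: "is_fctr SET SET (comp_fctr SET (upow P) (upow Q))" "is_fctr SET SET (upow (uf_tensor P Q))"
    using obs by simp_all
  have sel: "NDm (upow_mult P Q) = comp_fctr SET (upow P) (upow Q)" "NCd (upow_mult P Q) = upow (uf_tensor P Q)"
    by (simp_all add: upow_mult_def)
  have H: "NAt (upow_mult P Q) Y \<in> Hom SET (FOb (upow P) (FOb (upow Q) Y)) (FOb (upow (uf_tensor P Q)) Y)" for Y
  proof -
    have "SFn (NAt (upow_mult P Q) Y) p \<in> elts (FOb (upow (uf_tensor P Q)) Y)"
      if p: "p \<in> elts (FOb (upow P) (FOb (upow Q) Y))" for p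
    proof -
      obtain g where g: "\<And>x. x \<in> pts P \<Longrightarrow> g x \<in> pts Q \<rightarrow> elts Y"
        and pg: "p = uelt P (FOb (upow Q) Y) (\<lambda>x. uelt Q Y (g x))" by (rule uelt2_E[OF P Q p]) blast
      have "SFn (NAt (upow_mult P Q) Y) p = uelt (uf_tensor P Q) Y (\<lambda>q. g (vfst q) (vsnd q))"
        unfolding pg by (rule upow_mult_app[OF P Q g])
      also have "\<dots> \<in> elts (FOb (upow (uf_tensor P Q)) Y)"
        by (rule uelt_mem[OF tensor_Ob[OF P Q] tensor_PiI[OF g]])
      finally show ?thesis .
    qed
    then show ?thesis by (simp add: Hom_SET PiE_def) (simp add: upow_mult_def)
  qed
  have "is_ntrans SET SET (upow_mult P Q)"
    unfolding is_ntrans_def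
  proof (intro conjI ballI)
    fix k :: "'v set_ar" assume kA: "k \<in> Ar SET"
    let ?Y = "SDm k" and ?Z = "SCd k"
    have k: "k \<in> Hom SET ?Y ?Z" using kA by (simp add: Hom_def)
    note Qk = fctr_Hom[OF upow_fctr[OF Q] k]
    note PQk = fctr_Hom[OF upow_fctr[OF P] Qk]
    have "NAt (upow_mult P Q) ?Z \<cdot>\<^bsub>SET\<^esub> FAr (upow P) (FAr (upow Q) k) =
        FAr (upow (uf_tensor P Q)) k \<cdot>\<^bsub>SET\<^esub> NAt (upow_mult P Q) ?Y"
    proof (rule SET_eqI[OF SET_cmp_Hom[OF PQk H] SET_cmp_Hom[OF H fctr_Hom[OF fctrs(2) k]]])
      fix p assume p: "p \<in> elts (FOb (upow P) (FOb (upow Q) ?Y))"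
      obtain g where g: "\<And>x. x \<in> pts P \<Longrightarrow> g x \<in> pts Q \<rightarrow> elts ?Y"
        and pg: "p = uelt P (FOb (upow Q) ?Y) (\<lambda>x. uelt Q ?Y (g x))" by (rule uelt2_E[OF P Q p]) blast
      have kg: "(\<lambda>y. SFn k (g x y)) \<in> pts Q \<rightarrow> elts ?Z" if "x \<in> pts P" for x
        using g[OF that] SFn_app[OF k] by auto
      have "SFn (FAr (upow P) (FAr (upow Q) k)) p = uelt P (FOb (upow Q) ?Z) (\<lambda>x. SFn (FAr (upow Q) k) (uelt Q ?Y (g x)))"
        unfolding pg by (rule upow_app[OF P Qk uelt2_mem[OF Q g]])
      also have "\<dots> = uelt P (FOb (upow Q) ?Z) (\<lambda>x. uelt Q ?Z (\<lambda>y. SFn k (g x y)))"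
        by (rule uelt_cong[OF P, symmetric, OF uelt2_mem[OF Q kg]]) (simp_all add: upow_app[OF Q k g])
      finally have "SFn (NAt (upow_mult P Q) ?Z) (SFn (FAr (upow P) (FAr (upow Q) k)) p) =
          uelt (uf_tensor P Q) ?Z (\<lambda>q. SFn k (g (vfst q) (vsnd q)))"
        by (simp add: upow_mult_app[OF P Q kg])
      moreover have "SFn (FAr (upow (uf_tensor P Q)) k) (SFn (NAt (upow_mult P Q) ?Y) p) =
          uelt (uf_tensor P Q) ?Z (\<lambda>q. SFn k (g (vfst q) (vsnd q)))"
        by (simp add: pg upow_mult_app[OF P Q g]) (rule upow_app[OF tensor_Ob[OF P Q] k tensor_PiI[OF g]])
      ultimately show "SFn (NAt (upow_mult P Q) ?Z \<cdot>\<^bsub>SET\<^esub> FAr (upow P) (FAr (upow Q) k)) p =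
          SFn (FAr (upow (uf_tensor P Q)) k \<cdot>\<^bsub>SET\<^esub> NAt (upow_mult P Q) ?Y) p"
        using p PQk H[of ?Y] by (simp add: SFn_cmp Hom_SET)
    qed
    then show "NAt (upow_mult P Q) (Cd SET k) \<cdot>\<^bsub>SET\<^esub> FAr (NDm (upow_mult P Q)) k =
        FAr (NCd (upow_mult P Q)) k \<cdot>\<^bsub>SET\<^esub> NAt (upow_mult P Q) (Dm SET k)"
      using kA by (simp add: sel)
  qed (use fctrs H in \<open>simp_all add: sel\<close>)
  then show ?thesis using obs by (simp add: Hom_FC sel)
qed

text \<open>Injectivity is one half of \<open>uelt2_eq_iff\<close>; a preimage is found by currying
  a map on the product.\<close>

lemma upow_mult_iso:
  fixes P Q :: "'v uf_ob"
  assumes P: "P \<in> Ob UF" and Q: "Q \<in> Ob UF"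
  shows "iso FC (upow_mult P Q)"
proof (rule FC_iso[OF FC.category_axioms upow_mult_Hom[OF P Q]])
  fix Y :: 'v
  show "bij_betw (SFn (NAt (upow_mult P Q) Y)) (elts (FOb (comp_fctr SET (upow P) (upow Q)) Y))
      (elts (FOb (upow (uf_tensor P Q)) Y))"
    unfolding bij_betw_def comp_fctr_SET_sel
  proof (intro conjI inj_onI subset_antisym image_subsetI subsetI)
    fix p p' assume p: "p \<in> elts (FOb (upow P) (FOb (upow Q) Y))" and p': "p' \<in> elts (FOb (upow P) (FOb (upow Q) Y))"
      and eq: "SFn (NAt (upow_mult P Q) Y) p = SFn (NAt (upow_mult P Q) Y) p'"
    obtain g where g: "\<And>x. x \<in> pts P \<Longrightarrow> g x \<in> pts Q \<rightarrow> elts Y"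
      and pg: "p = uelt P (FOb (upow Q) Y) (\<lambda>x. uelt Q Y (g x))" by (rule uelt2_E[OF P Q p]) blast
    obtain g' where g': "\<And>x. x \<in> pts P \<Longrightarrow> g' x \<in> pts Q \<rightarrow> elts Y"
      and pg': "p' = uelt P (FOb (upow Q) Y) (\<lambda>x. uelt Q Y (g' x))" by (rule uelt2_E[OF P Q p']) blast
    show "p = p'"
      using eq by (simp add: pg pg' upow_mult_app[OF P Q g] upow_mult_app[OF P Q g'] uelt2_eq_iff[OF P Q g g'])
  next
    fix p assume "p \<in> elts (FOb (upow P) (FOb (upow Q) Y))"
    then show "SFn (NAt (upow_mult P Q) Y) p \<in> elts (FOb (upow (uf_tensor P Q)) Y)"
      using Hom_FC_app[OF upow_mult_Hom[OF P Q], of p Y] by simp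
  next
    fix p assume "p \<in> elts (FOb (upow (uf_tensor P Q)) Y)"
    then obtain f where f: "f \<in> pts (uf_tensor P Q) \<rightarrow> elts Y" and p: "p = uelt (uf_tensor P Q) Y f"
      by (rule uelt_E[OF tensor_Ob[OF P Q]])
    define g where "g x y = f (vpair x y)" for x y
    have g: "g x \<in> pts Q \<rightarrow> elts Y" if "x \<in> pts P" for x
      using f that by (auto simp: g_def)
    have "p = uelt (uf_tensor P Q) Y (\<lambda>q. g (vfst q) (vsnd q))"
      unfolding p by (rule uelt_cong[OF tensor_Ob[OF P Q] f]) (auto simp: g_def elim!: pts_tensorE)
    also have "\<dots> = SFn (NAt (upow_mult P Q) Y) (uelt P (FOb (upow Q) Y) (\<lambda>x. uelt Q Y (g x)))"
      by (rule upow_mult_app[OF P Q g, symmetric])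
    finally show "p \<in> SFn (NAt (upow_mult P Q) Y) ` elts (FOb (upow P) (FOb (upow Q) Y))"
      using uelt_mem[OF P uelt2_mem[OF Q g]] by simp
  qed
qed

text \<open>Reindexing is precomposition in both variables, so both ways around the square produce
  the class of \<open>h (u x) (v y)\<close>.\<close>

lemma upow_mult_natural:
  fixes f g :: "'v uf_ar"
  assumes f: "f \<in> Hom UF P' P" and g: "g \<in> Hom UF Q' Q"
  shows "upow_mult P' Q' \<cdot>\<^bsub>FC\<^esub> TAr (composition_monoidal SET) (FAr integral (FAr yoneda f)) (FAr integral (FAr yoneda g)) =
    FAr integral (FAr yoneda (TAr UF_monoidal f g)) \<cdot>\<^bsub>FC\<^esub> upow_mult P Q"
proof -
  obtain u where P': "P' \<in> Ob UF" and P: "P \<in> Ob UF" and u: "ucont P' P u" and fu: "f = umor P' P u"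
    using f by (rule Hom_UF_E)
  obtain v where Q': "Q' \<in> Ob UF" and Q: "Q \<in> Ob UF" and v: "ucont Q' Q v" and gv: "g = umor Q' Q v"
    using g by (rule Hom_UF_E)
  note tens = tensor_umor[OF P' P Q' Q u v]
  have uv: "ucont (uf_tensor P' Q') (uf_tensor P Q) (tensor_map u v)" by (rule ucont_tensor_map[OF u v])
  note fH = upow_umor_Hom[OF f] and gH = upow_umor_Hom[OF g]
  note PQ = tensor_Ob[OF P Q] and PQ' = tensor_Ob[OF P' Q']
  have fgH: "FAr integral (FAr yoneda (TAr UF_monoidal f g)) \<in> Hom FC (upow (uf_tensor P Q)) (upow (uf_tensor P' Q'))"
    unfolding fu gv tens by (rule upow_umor_Hom[OF umor_Hom[OF PQ' PQ uv]])
  note tH = FC.tar[OF fH gH, unfolded composition_monoidal_sel]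
  show ?thesis
  proof (rule Hom_FC_eqI[OF FC.cmp_hom[OF tH upow_mult_Hom[OF P' Q']] FC.cmp_hom[OF upow_mult_Hom[OF P Q] fgH]])
    fix Y p assume p: "p \<in> elts (FOb (comp_fctr SET (upow P) (upow Q)) Y)"
    then have p': "p \<in> elts (FOb (upow P) (FOb (upow Q) Y))" by simp
    obtain h where h: "\<And>x. x \<in> pts P \<Longrightarrow> h x \<in> pts Q \<rightarrow> elts Y"
      and ph: "p = uelt P (FOb (upow Q) Y) (\<lambda>x. uelt Q Y (h x))" by (rule uelt2_E[OF P Q p']) blast
    have hv: "(\<lambda>y. h x (v y)) \<in> pts Q' \<rightarrow> elts Y" if "x \<in> pts P" for x
      using h[OF that] ucont_app[OF v] by auto
    have huv: "(\<lambda>y. h (u x) (v y)) \<in> pts Q' \<rightarrow> elts Y" if "x \<in> pts P'" for x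
      by (rule hv[OF ucont_app[OF u that]])
    \<comment> \<open>In the horizontal composite the inner variable is reindexed first, at each
      value of the outer family.\<close>
    have "SFn (FAr (upow P) (NAt (FAr integral (FAr yoneda g)) Y)) p =
        uelt P (FOb (upow Q') Y) (\<lambda>x. SFn (NAt (FAr integral (FAr yoneda g)) Y) (uelt Q Y (h x)))"
      unfolding ph by (rule upow_app[OF P Hom_FC_NAt[OF gH] uelt2_mem[OF Q h]])
    also have "\<dots> = uelt P (FOb (upow Q') Y) (\<lambda>x. uelt Q' Y (\<lambda>y. h x (v y)))"
      by (rule uelt_cong[OF P, symmetric, OF uelt2_mem[OF Q' hv]])
        (simp_all only: gv upow_umor_app[OF Q' Q v h])
    finally have "SFn (NAt (TAr (composition_monoidal SET) (FAr integral (FAr yoneda f)) (FAr integral (FAr yoneda g))) Y) p =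
        uelt P' (FOb (upow Q') Y) (\<lambda>x. uelt Q' Y (\<lambda>y. h (u x) (v y)))"
      by (simp add: FC_tensor_app[OF fH gH p'])
        (simp add: fu upow_umor_app[OF P' P u uelt2_mem[OF Q' hv]])
    then have "SFn (NAt (upow_mult P' Q' \<cdot>\<^bsub>FC\<^esub> TAr (composition_monoidal SET) (FAr integral (FAr yoneda f)) (FAr integral (FAr yoneda g))) Y) p =
        uelt (uf_tensor P' Q') Y (\<lambda>q. h (u (vfst q)) (v (vsnd q)))"
      using FC_cmp_app[OF tH p, of "upow_mult P' Q'"] by (simp add: upow_mult_app[OF P' Q' huv])
    also have "\<dots> = uelt (uf_tensor P' Q') Y (\<lambda>q. h (vfst (tensor_map u v q)) (vsnd (tensor_map u v q)))"
      by (simp add: tensor_map_def)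
    also have "\<dots> = SFn (NAt (FAr integral (FAr yoneda (TAr UF_monoidal f g))) Y)
        (uelt (uf_tensor P Q) Y (\<lambda>q. h (vfst q) (vsnd q)))"
      unfolding fu gv tens by (rule upow_umor_app[OF PQ' PQ uv tensor_PiI[OF h], symmetric])
    also have "\<dots> = SFn (NAt (FAr integral (FAr yoneda (TAr UF_monoidal f g)) \<cdot>\<^bsub>FC\<^esub> upow_mult P Q) Y) p"
      unfolding FC_cmp_app[OF upow_mult_Hom[OF P Q] p] by (simp add: ph upow_mult_app[OF P Q h])
    finally show "SFn (NAt (upow_mult P' Q' \<cdot>\<^bsub>FC\<^esub> TAr (composition_monoidal SET) (FAr integral (FAr yoneda f)) (FAr integral (FAr yoneda g))) Y) p =
        SFn (NAt (FAr integral (FAr yoneda (TAr UF_monoidal f g)) \<cdot>\<^bsub>FC\<^esub> upow_mult P Q) Y) p" .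
  qed
qed

text \<open>An element is represented by a function \<open>g\<close> of three variables, and both
  composites uncurry it to the class of \<open>g x y z\<close> on
  \<open>uf_tensor A (uf_tensor B T)\<close>. The associator of the opposite structure acts by
  reindexing along \<open>assoc_inv\<close>.\<close>

lemma upow_mult_assoc:
  fixes A B T :: "'v uf_ob"
  assumes A: "A \<in> Ob UF" and B: "B \<in> Ob UF" and T: "T \<in> Ob UF"
  shows "FAr integral (FAr yoneda (Asc (op_monoidal UF UF_monoidal) A B T)) \<cdot>\<^bsub>FC\<^esub> upow_mult (uf_tensor A B) T \<cdot>\<^bsub>FC\<^esub>
      TAr (composition_monoidal SET) (upow_mult A B) (One FC (upow T)) =
    upow_mult A (uf_tensor B T) \<cdot>\<^bsub>FC\<^esub> TAr (composition_monoidal SET) (One FC (upow A)) (upow_mult B T) \<cdot>\<^bsub>FC\<^esub>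
      Asc (composition_monoidal SET) (upow A) (upow B) (upow T)"
    (is "?a \<cdot>\<^bsub>FC\<^esub> ?m1 \<cdot>\<^bsub>FC\<^esub> ?t1 = ?m2 \<cdot>\<^bsub>FC\<^esub> ?t2 \<cdot>\<^bsub>FC\<^esub> ?b")
proof -
  note AB = tensor_Ob[OF A B] and BT = tensor_Ob[OF B T]
  note ABT = tensor_Ob[OF AB T] and ABT' = tensor_Ob[OF A BT]
  note uA = upow_Ob[OF A] and uB = upow_Ob[OF B] and uT = upow_Ob[OF T]
  note a = op_UF_monoidal_constraints(1)[OF A B T]
  have aH: "?a \<in> Hom FC (upow (uf_tensor (uf_tensor A B) T)) (upow (uf_tensor A (uf_tensor B T)))"
    unfolding a by (rule upow_umor_Hom[OF umor_Hom[OF ABT' ABT ucont_assoc_inv]])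
  note m1 = upow_mult_Hom[OF AB T] and m2 = upow_mult_Hom[OF A BT]
  note t1 = FC.tar[OF upow_mult_Hom[OF A B] FC.one_hom[OF uT], unfolded composition_monoidal_sel]
  note t2 = FC.tar[OF FC.one_hom[OF uA] upow_mult_Hom[OF B T], unfolded composition_monoidal_sel]
  note b = FC.asc_hom[OF uA uB uT, unfolded composition_monoidal_sel(1)]
  show ?thesis
  proof (rule Hom_FC_eqI[OF FC.cmp_hom[OF FC.cmp_hom[OF t1 m1] aH] FC.cmp_hom[OF FC.cmp_hom[OF b t2] m2]])
    fix Y p assume p: "p \<in> elts (FOb (comp_fctr SET (comp_fctr SET (upow A) (upow B)) (upow T)) Y)"
    then have p1: "p \<in> elts (FOb (comp_fctr SET (upow A) (upow B)) (FOb (upow T) Y))"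
      and p2: "p \<in> elts (FOb (upow A) (FOb (upow B) (FOb (upow T) Y)))"
      and p3: "p \<in> elts (FOb (comp_fctr SET (upow A) (comp_fctr SET (upow B) (upow T))) Y)"
      and p4: "p \<in> elts (FOb (upow A) (FOb (comp_fctr SET (upow B) (upow T)) Y))" by simp_all
    obtain h where h: "\<And>x. x \<in> pts A \<Longrightarrow> h x \<in> pts B \<rightarrow> elts (FOb (upow T) Y)"
      and ph: "p = uelt A (FOb (upow B) (FOb (upow T) Y)) (\<lambda>x. uelt B (FOb (upow T) Y) (h x))"
      by (rule uelt2_E[OF A B p2]) blast
    \<comment> \<open>The values \<open>h x y\<close> are still classes in the ultrapower by
      \<open>T\<close>, so a second round of choices is made.\<close>
    have "\<forall>x\<in>pts A. \<exists>g. (\<forall>y\<in>pts B. g y \<in> pts T \<rightarrow> elts Y \<and> h x y = uelt T Y (g y))"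
    proof
      fix x assume x: "x \<in> pts A"
      have "\<forall>y\<in>pts B. \<exists>f. f \<in> pts T \<rightarrow> elts Y \<and> h x y = uelt T Y f"
      proof
        fix y assume "y \<in> pts B"
        with h[OF x] have "h x y \<in> elts (FOb (upow T) Y)" by auto
        then show "\<exists>f. f \<in> pts T \<rightarrow> elts Y \<and> h x y = uelt T Y f" by (rule uelt_E[OF T]) blast
      qed
      then show "\<exists>g. (\<forall>y\<in>pts B. g y \<in> pts T \<rightarrow> elts Y \<and> h x y = uelt T Y (g y))" by (rule bchoice)
    qed
    then obtain g where g': "\<forall>x\<in>pts A. \<forall>y\<in>pts B. g x y \<in> pts T \<rightarrow> elts Y \<and> h x y = uelt T Y (g x y)"
      by (rule bchoice[THEN exE])
    have g: "g x y \<in> pts T \<rightarrow> elts Y" if "x \<in> pts A" "y \<in> pts B" for x y using g' that by blast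
    have gT: "(\<lambda>y. uelt T Y (g x y)) \<in> pts B \<rightarrow> elts (FOb (upow T) Y)" if "x \<in> pts A" for x
      by (rule uelt2_mem[OF T g[OF that]])
    have pg: "p = uelt A (FOb (upow B) (FOb (upow T) Y)) (\<lambda>x. uelt B (FOb (upow T) Y) (\<lambda>y. uelt T Y (g x y)))"
      unfolding ph
    proof (rule uelt_cong[OF A uelt2_mem[OF B h]])
      fix x assume x: "x \<in> pts A"
      show "uelt B (FOb (upow T) Y) (h x) = uelt B (FOb (upow T) Y) (\<lambda>y. uelt T Y (g x y))"
        by (rule uelt_cong[OF B h[OF x]]) (use g' x in blast)
    qed
    have g1: "g (vfst q) (vsnd q) \<in> pts T \<rightarrow> elts Y" if "q \<in> pts (uf_tensor A B)" for q
      using that by (elim pts_tensorE) (simp add: g)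
    have g2: "(\<lambda>q. g x (vfst q) (vsnd q)) \<in> pts (uf_tensor B T) \<rightarrow> elts Y" if "x \<in> pts A" for x
      by (rule tensor_PiI[OF g[OF that]])
    have "SFn (NAt (?a \<cdot>\<^bsub>FC\<^esub> ?m1 \<cdot>\<^bsub>FC\<^esub> ?t1) Y) p = SFn (NAt ?a Y) (SFn (NAt ?m1 Y) (SFn (NAt (upow_mult A B) (FOb (upow T) Y)) p))"
      unfolding FC_cmp_app[OF FC.cmp_hom[OF t1 m1] p] FC_cmp_app[OF t1 p]
        FC_tensor_one_right_app[OF upow_mult_Hom[OF A B] uT p1] ..
    also have "SFn (NAt (upow_mult A B) (FOb (upow T) Y)) p =
        uelt (uf_tensor A B) (FOb (upow T) Y) (\<lambda>q. uelt T Y (g (vfst q) (vsnd q)))"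
      unfolding pg by (rule upow_mult_app[OF A B gT])
    also have "SFn (NAt ?m1 Y) \<dots> = uelt (uf_tensor (uf_tensor A B) T) Y (\<lambda>r. g (vfst (vfst r)) (vsnd (vfst r)) (vsnd r))"
      by (rule upow_mult_app[OF AB T g1])
    also have "SFn (NAt ?a Y) \<dots> = uelt (uf_tensor A (uf_tensor B T)) Y
        (\<lambda>r. g (vfst (vfst (assoc_inv r))) (vsnd (vfst (assoc_inv r))) (vsnd (assoc_inv r)))"
      unfolding a by (rule upow_umor_app[OF ABT' ABT ucont_assoc_inv tensor_PiI[OF g1]])
    also have "\<dots> = uelt (uf_tensor A (uf_tensor B T)) Y (\<lambda>r. g (vfst r) (vfst (vsnd r)) (vsnd (vsnd r)))"
      by (simp add: assoc_inv_def)
    also have "\<dots> = SFn (NAt ?m2 Y) (uelt A (FOb (upow (uf_tensor B T)) Y) (\<lambda>x. uelt (uf_tensor B T) Y (\<lambda>q. g x (vfst q) (vsnd q))))"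
      by (rule upow_mult_app[OF A BT g2, symmetric])
    \<comment> \<open>Going backwards, the comparison for \<open>B\<close> and \<open>T\<close> is
      recognised inside the outer ultrapower, at the class attached to each
      \<open>x\<close>.\<close>
    also have "uelt A (FOb (upow (uf_tensor B T)) Y) (\<lambda>x. uelt (uf_tensor B T) Y (\<lambda>q. g x (vfst q) (vsnd q))) =
        uelt A (FOb (upow (uf_tensor B T)) Y) (\<lambda>x. SFn (NAt (upow_mult B T) Y) (uelt B (FOb (upow T) Y) (\<lambda>y. uelt T Y (g x y))))"
      by (rule uelt_cong[OF A uelt2_mem[OF BT g2]]) (simp_all add: upow_mult_app[OF B T g])
    also have "\<dots> = SFn (FAr (upow A) (NAt (upow_mult B T) Y)) p"
      unfolding pg
      by (rule upow_app[OF A Hom_FC_NAt[OF upow_mult_Hom[OF B T], unfolded comp_fctr_SET_sel] uelt2_mem[OF B gT], symmetric])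
    also have "\<dots> = SFn (NAt (One FC (upow A)) (FOb (upow (uf_tensor B T)) Y)) (SFn (FAr (upow A) (NAt (upow_mult B T) Y)) p)"
      by (rule FC_one_app[symmetric], rule SFn_app[OF fctr_Hom[OF upow_fctr[OF A] Hom_FC_NAt[OF upow_mult_Hom[OF B T]]] p4])
    also have "\<dots> = SFn (NAt ?t2 Y) p"
      by (rule FC_tensor_app[OF FC.one_hom[OF uA] upow_mult_Hom[OF B T] p4, symmetric])
    also have "\<dots> = SFn (NAt ?t2 Y) (SFn (NAt ?b Y) p)"
      using FC_one_app[OF p3] by (simp add: composition_monoidal_sel)
    also have "SFn (NAt ?m2 Y) \<dots> = SFn (NAt (?m2 \<cdot>\<^bsub>FC\<^esub> ?t2 \<cdot>\<^bsub>FC\<^esub> ?b) Y) p"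
      unfolding FC_cmp_app[OF FC.cmp_hom[OF b t2] p] FC_cmp_app[OF b p] ..
    finally show "SFn (NAt (?a \<cdot>\<^bsub>FC\<^esub> ?m1 \<cdot>\<^bsub>FC\<^esub> ?t1) Y) p = SFn (NAt (?m2 \<cdot>\<^bsub>FC\<^esub> ?t2 \<cdot>\<^bsub>FC\<^esub> ?b) Y) p" .
  qed
qed

text \<open>The unit occupies the outer variable: the constant family with value \<open>f\<close>
  uncurries to a map that ignores the first coordinate, and reindexing along
  \<open>vpair (vset {})\<close> restores \<open>f\<close>.\<close>

lemma upow_mult_left_unit:
  fixes A :: "'v uf_ob"
  assumes A: "A \<in> Ob UF"
  shows "FAr integral (FAr yoneda (Lun (op_monoidal UF UF_monoidal) A)) \<cdot>\<^bsub>FC\<^esub> upow_mult uf_unit A \<cdot>\<^bsub>FC\<^esub>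
      TAr (composition_monoidal SET) upow_unit (One FC (upow A)) = Lun (composition_monoidal SET) (upow A)"
    (is "?l \<cdot>\<^bsub>FC\<^esub> ?m \<cdot>\<^bsub>FC\<^esub> ?t = ?u")
proof -
  note UA = tensor_Ob[OF unit_Ob A] and uA = upow_Ob[OF A]
  note l = op_UF_monoidal_constraints(2)[OF A]
  have lH: "?l \<in> Hom FC (upow (uf_tensor uf_unit A)) (upow A)"
    unfolding l by (rule upow_umor_Hom[OF umor_Hom[OF A UA ucont_vpair_unit_left]])
  note m = upow_mult_Hom[OF unit_Ob A]
  note t = FC.tar[OF upow_unit_Hom FC.one_hom[OF uA], unfolded composition_monoidal_sel]
  note u = FC.lun_hom[OF uA, unfolded composition_monoidal_sel(1,2)]
  show ?thesis
  proof (rule Hom_FC_eqI[OF FC.cmp_hom[OF FC.cmp_hom[OF t m] lH] u])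
    fix Y p assume p: "p \<in> elts (FOb (comp_fctr SET (id_fctr SET) (upow A)) Y)"
    then have p1: "p \<in> elts (FOb (id_fctr SET) (FOb (upow A) Y))" and p2: "p \<in> elts (FOb (upow A) Y)" by simp_all
    obtain f where f: "f \<in> pts A \<rightarrow> elts Y" and pf: "p = uelt A Y f" using p2 by (rule uelt_E[OF A])
    have "SFn (NAt (?l \<cdot>\<^bsub>FC\<^esub> ?m \<cdot>\<^bsub>FC\<^esub> ?t) Y) p = SFn (NAt ?l Y) (SFn (NAt ?m Y) (SFn (NAt upow_unit (FOb (upow A) Y)) p))"
      unfolding FC_cmp_app[OF FC.cmp_hom[OF t m] p] FC_cmp_app[OF t p]
        FC_tensor_one_right_app[OF upow_unit_Hom uA p1] ..
    also have "SFn (NAt upow_unit (FOb (upow A) Y)) p = uelt uf_unit (FOb (upow A) Y) (\<lambda>_. uelt A Y f)"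
      using p2 by (simp add: upow_unit_app pf)
    also have "SFn (NAt ?m Y) \<dots> = uelt (uf_tensor uf_unit A) Y (\<lambda>q. f (vsnd q))"
      by (rule upow_mult_app[OF unit_Ob A, of "\<lambda>_. f"]) (rule f)
    also have "SFn (NAt ?l Y) \<dots> = uelt A Y (\<lambda>y. f (vsnd (vpair (vset {}) y)))"
      unfolding l by (rule upow_umor_app[OF A UA ucont_vpair_unit_left tensor_PiI[of _ "\<lambda>_. f"]]) (rule f)
    also have "\<dots> = SFn (NAt ?u Y) p"
      using FC_one_app[OF p2] by (simp add: pf composition_monoidal_sel)
    finally show "SFn (NAt (?l \<cdot>\<^bsub>FC\<^esub> ?m \<cdot>\<^bsub>FC\<^esub> ?t) Y) p = SFn (NAt ?u Y) p" .
  qed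
qed

text \<open>Here the unit is the inner variable: each value \<open>f x\<close> is replaced by a
  constant family before uncurrying.\<close>

lemma upow_mult_right_unit:
  fixes A :: "'v uf_ob"
  assumes A: "A \<in> Ob UF"
  shows "FAr integral (FAr yoneda (Run (op_monoidal UF UF_monoidal) A)) \<cdot>\<^bsub>FC\<^esub> upow_mult A uf_unit \<cdot>\<^bsub>FC\<^esub>
      TAr (composition_monoidal SET) (One FC (upow A)) upow_unit = Run (composition_monoidal SET) (upow A)"
    (is "?r \<cdot>\<^bsub>FC\<^esub> ?m \<cdot>\<^bsub>FC\<^esub> ?t = ?u")
proof -
  note AU = tensor_Ob[OF A unit_Ob] and uA = upow_Ob[OF A]
  note r = op_UF_monoidal_constraints(3)[OF A]
  have rH: "?r \<in> Hom FC (upow (uf_tensor A uf_unit)) (upow A)"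
    unfolding r by (rule upow_umor_Hom[OF umor_Hom[OF A AU ucont_vpair_unit_right]])
  note m = upow_mult_Hom[OF A unit_Ob]
  note t = FC.tar[OF FC.one_hom[OF uA] upow_unit_Hom, unfolded composition_monoidal_sel]
  note u = FC.run_hom[OF uA, unfolded composition_monoidal_sel(1,2)]
  show ?thesis
  proof (rule Hom_FC_eqI[OF FC.cmp_hom[OF FC.cmp_hom[OF t m] rH] u])
    fix Y p assume p: "p \<in> elts (FOb (comp_fctr SET (upow A) (id_fctr SET)) Y)"
    then have p1: "p \<in> elts (FOb (upow A) (FOb (id_fctr SET) Y))" and p2: "p \<in> elts (FOb (upow A) Y)" by simp_all
    obtain f where f: "f \<in> pts A \<rightarrow> elts Y" and pf: "p = uelt A Y f" using p2 by (rule uelt_E[OF A])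
    have cf: "(\<lambda>_. f x) \<in> pts uf_unit \<rightarrow> elts Y" if "x \<in> pts A" for x using f that by auto
    note uH = Hom_FC_NAt[OF upow_unit_Hom]
    have "SFn (FAr (upow A) (NAt upow_unit Y)) p = uelt A (FOb (upow uf_unit) Y) (\<lambda>x. SFn (NAt upow_unit Y) (f x))"
      unfolding pf by (rule upow_app[OF A uH[of Y, unfolded id_fctr_SET_sel] f])
    also have "\<dots> = uelt A (FOb (upow uf_unit) Y) (\<lambda>x. uelt uf_unit Y (\<lambda>_. f x))"
      by (rule uelt_cong[OF A, symmetric, OF uelt2_mem[OF unit_Ob cf]]) (simp_all add: upow_unit_app funcset_mem[OF f])
    finally have *: "SFn (FAr (upow A) (NAt upow_unit Y)) p = uelt A (FOb (upow uf_unit) Y) (\<lambda>x. uelt uf_unit Y (\<lambda>_. f x))" .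
    have "SFn (NAt (?r \<cdot>\<^bsub>FC\<^esub> ?m \<cdot>\<^bsub>FC\<^esub> ?t) Y) p = SFn (NAt ?r Y) (SFn (NAt ?m Y)
        (SFn (NAt (One FC (upow A)) (FOb (upow uf_unit) Y)) (SFn (FAr (upow A) (NAt upow_unit Y)) p)))"
      unfolding FC_cmp_app[OF FC.cmp_hom[OF t m] p] FC_cmp_app[OF t p]
        FC_tensor_app[OF FC.one_hom[OF uA] upow_unit_Hom p1] ..
    also have "SFn (NAt (One FC (upow A)) (FOb (upow uf_unit) Y)) (SFn (FAr (upow A) (NAt upow_unit Y)) p) =
        SFn (FAr (upow A) (NAt upow_unit Y)) p"
      by (rule FC_one_app, rule SFn_app[OF fctr_Hom[OF upow_fctr[OF A] uH] p1])
    also have "SFn (NAt ?m Y) \<dots> = uelt (uf_tensor A uf_unit) Y (\<lambda>q. f (vfst q))"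
      unfolding * by (rule upow_mult_app[OF A unit_Ob cf])
    also have "SFn (NAt ?r Y) \<dots> = uelt A Y (\<lambda>x. f (vfst (vpair x (vset {}))))"
      unfolding r by (rule upow_umor_app[OF A AU ucont_vpair_unit_right tensor_PiI[OF cf]])
    also have "\<dots> = SFn (NAt ?u Y) p"
      using FC_one_app[OF p2] by (simp add: pf composition_monoidal_sel)
    finally show "SFn (NAt (?r \<cdot>\<^bsub>FC\<^esub> ?m \<cdot>\<^bsub>FC\<^esub> ?t) Y) p = SFn (NAt ?u Y) p" .
  qed
qed

lemma upow_constraints:
  "monoidal_constraints (op_cat UF) (op_monoidal UF UF_monoidal) FC (composition_monoidal SET)
     (comp_fctr (op_cat UF) integral yoneda) upow_unit (upow_mult :: 'v uf_ob \<Rightarrow> 'v uf_ob \<Rightarrow> _)"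
  (is "monoidal_constraints ?C ?M _ ?L ?K _ _")
proof -
  interpret op: monoidal_category ?C ?M by (rule monoidal_category_op_UF)
  have K: "FOb ?K P = upow P" if "P \<in> Ob UF" for P :: "'v uf_ob"
    using that by (simp add: yoneda_sel integral_sel is_fctr_hom_fctr upow_def)
  have KA: "FAr ?K h = FAr integral (FAr yoneda h)" if "h \<in> Hom UF P Q" for h :: "'v uf_ar" and P Q
    using that by (simp add: Hom_def)
  have Ar: "h \<in> Hom UF (UDm h) (UCd h)" "UDm h \<in> Ob UF" "UCd h \<in> Ob UF" if "h \<in> Ar UF" for h :: "'v uf_ar"
    using that category.dm_cd[OF category_UF that] by (simp_all add: Hom_def)
  show ?thesis
    unfolding monoidal_constraints_def op_cat_sel op_UF_monoidal_sel
  proof (intro conjI ballI)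
    show "upow_unit \<in> Hom FC (Unit ?L) (FOb ?K uf_unit)"
      unfolding composition_monoidal_sel K[OF unit_Ob] by (rule upow_unit_Hom)
    show "iso FC (upow_unit :: 'v endo_trans)" by (rule upow_unit_iso)
    fix A B T :: "'v uf_ob"
    assume A: "A \<in> Ob UF"
    show "FAr ?K (Lun ?M A) \<cdot>\<^bsub>FC\<^esub> upow_mult uf_unit A \<cdot>\<^bsub>FC\<^esub> TAr ?L upow_unit (One FC (FOb ?K A)) = Lun ?L (FOb ?K A)"
      unfolding K[OF A] KA[OF op.lun_hom[unfolded op_cat_sel, OF A]] by (rule upow_mult_left_unit[OF A])
    show "FAr ?K (Run ?M A) \<cdot>\<^bsub>FC\<^esub> upow_mult A uf_unit \<cdot>\<^bsub>FC\<^esub> TAr ?L (One FC (FOb ?K A)) upow_unit = Run ?L (FOb ?K A)"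
      unfolding K[OF A] KA[OF op.run_hom[unfolded op_cat_sel, OF A]] by (rule upow_mult_right_unit[OF A])
    assume B: "B \<in> Ob UF"
    show "upow_mult A B \<in> Hom FC (TOb ?L (FOb ?K A) (FOb ?K B)) (FOb ?K (uf_tensor A B))"
      unfolding composition_monoidal_sel K[OF A] K[OF B] K[OF tensor_Ob[OF A B]] by (rule upow_mult_Hom[OF A B])
    show "iso FC (upow_mult A B)" by (rule upow_mult_iso[OF A B])
    assume T: "T \<in> Ob UF"
    show "FAr ?K (Asc ?M A B T) \<cdot>\<^bsub>FC\<^esub> upow_mult (uf_tensor A B) T \<cdot>\<^bsub>FC\<^esub> TAr ?L (upow_mult A B) (One FC (FOb ?K T)) =
      upow_mult A (uf_tensor B T) \<cdot>\<^bsub>FC\<^esub> TAr ?L (One FC (FOb ?K A)) (upow_mult B T) \<cdot>\<^bsub>FC\<^esub>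
        Asc ?L (FOb ?K A) (FOb ?K B) (FOb ?K T)"
      unfolding K[OF A] K[OF B] K[OF T] KA[OF op.asc_hom[unfolded op_cat_sel, OF A B T]]
      by (rule upow_mult_assoc[OF A B T])
  next
    \<comment> \<open>Arrows of \<open>op_cat UF\<close> run backwards, so \<open>Dm UF\<close> and
      \<open>Cd UF\<close> change places in the naturality square.\<close>
    fix f g :: "'v uf_ar" assume f: "f \<in> Ar UF" and g: "g \<in> Ar UF"
    note tH = op.tar[unfolded op_cat_sel op_UF_monoidal_sel, OF Ar(1)[OF f] Ar(1)[OF g]]
    show "upow_mult (Dm UF f) (Dm UF g) \<cdot>\<^bsub>FC\<^esub> TAr ?L (FAr ?K f) (FAr ?K g) =
      FAr ?K (TAr UF_monoidal f g) \<cdot>\<^bsub>FC\<^esub> upow_mult (Cd UF f) (Cd UF g)"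
      unfolding KA[OF Ar(1)[OF f]] KA[OF Ar(1)[OF g]] KA[OF tH] Dm_UF Cd_UF
      by (rule upow_mult_natural[OF Ar(1)[OF f] Ar(1)[OF g]])
  qed
qed

end

section \<open>Representable functors and the conclusion\<close>

lemma isomorphic_tensor:
  assumes "monoidal_category C M" "isomorphic C A A'" "isomorphic C B B'"
  shows "isomorphic C (TOb M A B) (TOb M A' B')"
  using assms monoidal_category.iso_tensor[OF assms(1)] monoidal_category.tar[OF assms(1)]
  unfolding isomorphic_def by blast

lemma (in category) isomorphic_trans: "isomorphic C A B \<Longrightarrow> isomorphic C B D \<Longrightarrow> isomorphic C A D"
  unfolding isomorphic_def using iso_cmp cmp_hom by blast

theorem proposition16:
  fixes M :: "('v::set_universe uf_fctr, 'v uf_trans) monoidal"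
  assumes "transported M"
  shows "representable (Unit M) \<and>
    (\<forall>A B. representable A \<longrightarrow> representable B \<longrightarrow> representable (TOb M A B)) \<and>
    induced_on_UF M UF_monoidal"
proof -
  from assms obtain e m where M: "monoidal_category UF_SET M"
    and FC: "monoidal_category FC (composition_monoidal SET :: ('v endo, 'v endo_trans) monoidal)"
    and int: "is_fctr UF_SET FC (integral :: ('v uf_fctr, 'v uf_trans, 'v endo, 'v endo_trans) fctr)"
    and em: "monoidal_constraints UF_SET M FC (composition_monoidal SET) integral e m"
    unfolding transported_def strong_monoidal_def by blast
  interpret M: monoidal_category UF_SET M by (rule M)
  interpret full_faithful_strong_monoidal UF_SET M FC "composition_monoidal SET" integral e m
  proof (intro full_faithful_strong_monoidal.intro full_faithful_strong_monoidal_axioms.intro M FC int em)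
    show "s = t" if "s \<in> Hom UF_SET A B" "t \<in> Hom UF_SET A B" "FAr integral s = FAr integral t"
      for A B :: "'v uf_fctr" and s t
      using that by (rule integral_faithful)
    show "\<exists>t \<in> Hom UF_SET A B. FAr integral t = s"
      if "A \<in> Ob UF_SET" "B \<in> Ob UF_SET" "s \<in> Hom FC (FOb integral A) (FOb integral B)"
      for A B :: "'v uf_fctr" and s
      using integral_full[OF int that] by blast
  qed
  have y: "is_fctr (op_cat UF) UF_SET (yoneda :: ('v uf_ob, _, _, _) fctr)"
    by (rule is_fctr_yoneda[OF M.category_axioms])
  \<comment> \<open>The constraints of the composite functor are the ultrapower comparisons;
    reflecting them along \<open>integral\<close> gives those of the Yoneda embedding.\<close>
  obtain e' m' where c: "monoidal_constraints (op_cat UF) (op_monoidal UF UF_monoidal) UF_SET M yoneda e' m'"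
    using reflects_monoidal_constraints[OF monoidal_category_op_UF y upow_constraints[OF int FC]] by blast
  have "induced_on_UF M UF_monoidal"
    unfolding induced_on_UF_def strong_monoidal_def using monoidal_category_op_UF M y c by blast
  \<comment> \<open>The unit constraint of the Yoneda embedding is itself an isomorphism onto a hom
    functor.\<close>
  moreover have unit: "isomorphic UF_SET (Unit M) (hom_fctr uf_unit)"
  proof -
    have "e' \<in> Hom UF_SET (Unit M) (hom_fctr uf_unit) \<and> iso UF_SET e'"
      using c unfolding monoidal_constraints_def op_UF_monoidal_sel yoneda_sel(1)[OF unit_Ob]
      by (elim conjE) (intro conjI)
    then show ?thesis unfolding isomorphic_def by blast
  qed
  moreover have "representable (TOb M A B)" if "representable A" "representable B" for A B
  proof -
    \<comment> \<open>Tensoring isomorphisms reduces to two hom functors, whose tensor is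
      representable by the constraint \<open>m' P Q\<close>.\<close>
    obtain P Q where AB: "A \<in> Ob UF_SET" "B \<in> Ob UF_SET" and P: "P \<in> Ob UF" and Q: "Q \<in> Ob UF"
      and AP: "isomorphic UF_SET A (hom_fctr P)" and BQ: "isomorphic UF_SET B (hom_fctr Q)"
      using \<open>representable A\<close> \<open>representable B\<close> unfolding representable_def by blast
    have "\<forall>P \<in> Ob UF. \<forall>Q \<in> Ob UF. m' P Q \<in> Hom UF_SET (TOb M (FOb yoneda P) (FOb yoneda Q)) (FOb yoneda (uf_tensor P Q)) \<and>
        iso UF_SET (m' P Q)"
      using c unfolding monoidal_constraints_def op_cat_sel op_UF_monoidal_sel by (elim conjE) assumption
    then have "m' P Q \<in> Hom UF_SET (TOb M (hom_fctr P) (hom_fctr Q)) (hom_fctr (uf_tensor P Q)) \<and> iso UF_SET (m' P Q)"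
      using P Q yoneda_sel(1)[OF P] yoneda_sel(1)[OF Q] yoneda_sel(1)[OF tensor_Ob[OF P Q]] by metis
    then have "isomorphic UF_SET (TOb M (hom_fctr P) (hom_fctr Q)) (hom_fctr (uf_tensor P Q))"
      unfolding isomorphic_def by blast
    with isomorphic_tensor[OF M AP BQ] have "isomorphic UF_SET (TOb M A B) (hom_fctr (uf_tensor P Q))"
      by (rule M.isomorphic_trans)
    then show ?thesis
      unfolding representable_def using M.tob[OF AB] tensor_Ob[OF P Q] by blast
  qed
  ultimately show ?thesis
    unfolding representable_def using M.unit_ob unit_Ob by blast
qed

end
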